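(* Let $d\ge 1$ be an integer, $\alpha\in(0,2]$, $m>1$ and $R>0$. Put $$\lambda=\frac{1}{d(m-1)+\alpha},\qquad k=\left(\frac{d}{d(m-1)+\alpha}\right)\left(\frac{\Gamma\left(\frac d2\right)}{2^\alpha\,\Gamma\left(1+\frac\alpha2\right)\Gamma\left(\frac{d+\alpha}{2}\right)}\right).$$ Define $\Phi_{\alpha,m}:\mathbb{R}^d\to[0,\infty)$ by $$\Phi_{\alpha,m}(y)=\left(k\,(R^2-|y|^2)_+^{\frac\alpha2}\right)^{\frac1{m-1}}.$$ Then $\Phi_{\alpha,m}$ is a solution, in the sense of distributions on $\mathbb{R}^d$, of $$-\lambda\,\nabla\cdot\left(y\,\Phi_{\alpha,m}\right)=\nabla\cdot\left(\Phi_{\alpha,m}\,\nabla^{\alpha-1}\left(\Phi_{\alpha,m}^{m-1}\right)\right).$$ Consequently, the function $$u(t,x)=t^{-\frac{d}{d(m-1)+\alpha}}\left(k\left(R^2-|x|^2\,t^{-\frac{2}{d(m-1)+\alpha}}\right)_+^{\frac\alpha2}\right)^{\frac{1}{m-1}},\qquad t>0,\ x\in\mathbb{R}^d,$$ has the following properties: (i) $u$ is a weak solution of $$\partial_t u-\nabla\cdot\left(u\,\nabla^{\alpha-1}\left(|u|^{m-1}\right)\right)=0$$ in each strip $(t_0,T)\times\mathbb{R}^d$, $0<t_0<T<\infty$ (with datum $u(t_0,\cdot)$ at time $t_0$); (ii) $u$ satisfies this equation in the pointwise sense at all $(t,x)$ with $t>0$ and $|x|\neq R\,t^{\frac{1}{d(m-1)+\alpha}}$;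 (iii) $u$ is $\min\left\{\frac{\alpha}{2(m-1)},1\right\}$-H\"older continuous at the interface $|x|=R\,t^{\frac{1}{d(m-1)+\alpha}}$.
   Context: Notation: $s_+=\max\{s,0\}$; $\Gamma$ is the Gamma function; $\mathcal{F}$ is the Fourier transform on $\mathbb{R}^d$, normalized so that $\mathcal F(\nabla u)=i\xi\,\mathcal F u$. The vector-valued operator $\nabla^{\beta}$ is defined by $\nabla^\beta u=\mathcal{F}^{-1}\left(i\xi|\xi|^{\beta-1}\mathcal{F}u\right)$, so that $\nabla^1=\nabla$. Equivalently, $\nabla^{\alpha-1}u=\nabla I_{2-\alpha}(u)$, where $I_\beta$ is the Riesz potential (Fourier symbol $|\xi|^{-\beta}$), and $I_0$ is the identity. For $0<\beta<d$, $$I_\beta(u)(x)=C_\beta\int_{\mathbb{R}^d}\frac{u(x+z)}{|z|^{d-\beta}}\,dz,\qquad C_\beta=\frac{\Gamma\left(\frac{d-\beta}{2}\right)}{\pi^{d/2}\,2^{\beta}\,\Gamma\left(\frac\beta2\right)}.$$ In the remaining case $d=1$, $\alpha\le 1$ (so $\beta=2-\alpha\ge d$), $I_{2-\alpha}$ is applied only to bounded compactly supported functions and is understood through the same formula if $\alpha<1$, and with the kernel $C_\beta|z|^{\beta-d}$ replaced by $-\frac1\pi\log|z|$ if $\alpha=1$; then $\nabla I_{2-\alpha}=\nabla^{\alpha-1}$ still has symbol $i\xi|\xi|^{\alpha-2}$. Weak solutions: let $0\le t_0<T$ and $Q=(t_0,T)\times\mathbb{R}^d$. A function $u:Q\to\mathbb{R}$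 is a weak solution in $Q$ of $\partial_t u-\nabla\cdot(u\nabla^{\alpha-1}(|u|^{m-1}))=0$ with initial condition $u(t_0,x)=u_0(x)$ if $u\in L^1(Q)$, $I_{2-\alpha}(|u|^{m-1})\in L^1(t_0,T;W^{1,1}_{\rm loc}(\mathbb{R}^d))$, $u\,\nabla I_{2-\alpha}(|u|^{m-1})\in L^1(Q)$, and $$\int_{t_0}^T\int_{\mathbb{R}^d} u\left(\varphi_t-\nabla I_{2-\alpha}(|u|^{m-1})\cdot\nabla\varphi\right)dx\,dt+\int_{\mathbb{R}^d}u_0(x)\,\varphi(t_0,x)\,dx=0$$ for each test function $\varphi$ that is $C^1$ on $[t_0,T)\times\mathbb{R}^d$, has compact support in the space variable $x$, and vanishes near $t=T$. *)

theory Defs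
  imports "HOL-Analysis.Analysis"
begin

section \<open>Test functions, weak gradients and distributional divergence\<close>

definition locally_integrable ::
  "('a::euclidean_space \<Rightarrow> 'b::{banach,second_countable_topology}) \<Rightarrow> bool" where
  "locally_integrable f \<longleftrightarrow> (\<forall>K. compact K \<longrightarrow> set_integrable lborel K f)"

primrec Ck :: "nat \<Rightarrow> ('a::euclidean_space \<Rightarrow> real) \<Rightarrow> bool" where
  "Ck 0 f \<longleftrightarrow> continuous_on UNIV f"
| "Ck (Suc n) f \<longleftrightarrow> (\<forall>x. f differentiable (at x)) \<and>
     (\<forall>b\<in>Basis. Ck n (\<lambda>x. frechet_derivative f (at x) b))"

definition test_function :: "('a::euclidean_space \<Rightarrow> real) \<Rightarrow> bool" where
  "test_function \<phi> \<longleftrightarrow> (\<forall>n. Ck n \<phi>) \<and> compact (closure {x. \<phi> x \<noteq> 0})"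

definition grad :: "('a::euclidean_space \<Rightarrow> real) \<Rightarrow> 'a \<Rightarrow> 'a" where
  "grad \<phi> x = (\<Sum>b\<in>Basis. frechet_derivative \<phi> (at x) b *\<^sub>R b)"

definition weak_gradient :: "('a::euclidean_space \<Rightarrow> real) \<Rightarrow> ('a \<Rightarrow> 'a) \<Rightarrow> bool" where
  "weak_gradient f G \<longleftrightarrow> locally_integrable f \<and> locally_integrable G \<and>
     (\<forall>\<phi>. test_function \<phi> \<longrightarrow>
        (LBINT x. f x *\<^sub>R grad \<phi> x) = - (LBINT x. \<phi> x *\<^sub>R G x))"

text \<open>The distribution \<open>\<nabla>\<cdot>F\<close> of a locally integrable vector field \<open>F\<close>,
  as a functional on test functions.\<close>
definition dist_div :: "('a::euclidean_space \<Rightarrow> 'a) \<Rightarrow> ('a \<Rightarrow> real) \<Rightarrow> real" where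
  "dist_div F \<phi> = - (LBINT x. F x \<bullet> grad \<phi> x)"

definition has_divergence :: "('a::euclidean_space \<Rightarrow> 'a) \<Rightarrow> real \<Rightarrow> 'a \<Rightarrow> bool" where
  "has_divergence F D x \<longleftrightarrow>
     (\<exists>F'. (F has_derivative F') (at x) \<and> D = (\<Sum>b\<in>Basis. F' b \<bullet> b))"

section \<open>Riesz potentials and fractional gradients\<close>

definition riesz_const :: "nat \<Rightarrow> real \<Rightarrow> real" where
  "riesz_const d \<beta> = Gamma ((real d - \<beta>) / 2) / (pi powr (real d / 2) * 2 powr \<beta> * Gamma (\<beta> / 2))"

text \<open>Only \<open>0 < \<beta> < 2\<close> is used. The logarithmic kernel is the exceptional case \<open>\<beta> = d = 1\<close>.
  For \<open>d = 1 < \<beta>\<close> the constant is negative and the kernel \<open>C\<^sub>\<beta> |z|\<^bsup>\<beta>-1\<^esup>\<close> is unbounded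
  at infinity.\<close>
definition riesz_kernel :: "real \<Rightarrow> 'a::euclidean_space \<Rightarrow> real" where
  "riesz_kernel \<beta> z =
     (if DIM('a) = 1 \<and> \<beta> = 1 then - ln (norm z) / pi
      else riesz_const DIM('a) \<beta> * norm z powr (\<beta> - real DIM('a)))"

definition riesz_potential :: "real \<Rightarrow> ('a::euclidean_space \<Rightarrow> real) \<Rightarrow> 'a \<Rightarrow> real" where
  "riesz_potential \<beta> f x =
     (if \<beta> = 0 then f x else (LBINT z. riesz_kernel \<beta> z * f (x + z)))"

text \<open>Absolute convergence of the integral above, which would otherwise silently be \<open>0\<close>.\<close>
definition riesz_converges :: "real \<Rightarrow> ('a::euclidean_space \<Rightarrow> real) \<Rightarrow> 'a \<Rightarrow> bool" where
  "riesz_converges \<beta> f x \<longleftrightarrow>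
     \<beta> = 0 \<or> integrable lborel (\<lambda>z. riesz_kernel \<beta> z * f (x + z))"

text \<open>\<open>G = \<nabla>\<^bsup>s\<^esup> f\<close>, where \<open>\<nabla>\<^bsup>s\<^esup> = \<nabla> I\<^bsub>1-s\<^esub>\<close> (so \<open>\<nabla>\<^bsup>\<alpha>-1\<^esup> = \<nabla> I\<^bsub>2-\<alpha>\<^esub>\<close> and \<open>\<nabla>\<^bsup>1\<^esup> = \<nabla>\<close>) and the
  gradient is weak. It is a relation because \<open>G\<close> is determined only almost everywhere.\<close>
definition frac_gradient ::
  "real \<Rightarrow> ('a::euclidean_space \<Rightarrow> real) \<Rightarrow> ('a \<Rightarrow> 'a) \<Rightarrow> bool" where
  "frac_gradient s f G \<longleftrightarrow>
     (AE x in lborel. riesz_converges (1 - s) f x) \<and> weak_gradient (riesz_potential (1 - s) f) G"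

section \<open>Solutions of the evolution equation\<close>

text \<open>\<open>\<phi>\<close> is \<open>C\<^sup>1\<close> on \<open>[t\<^sub>0,T) \<times> \<real>\<^sup>d\<close> (one-sided in time at \<open>t\<^sub>0\<close>) with time derivative \<open>\<phi>t\<close> and
  spatial gradient \<open>\<phi>x\<close>; its support in \<open>x\<close> lies in one compact set for all times.\<close>
definition strip_test_function ::
  "real \<Rightarrow> real \<Rightarrow> (real \<times> 'a::euclidean_space \<Rightarrow> real) \<Rightarrow>
   (real \<times> 'a \<Rightarrow> real) \<Rightarrow> (real \<times> 'a \<Rightarrow> 'a) \<Rightarrow> bool" where
  "strip_test_function t0 T \<phi> \<phi>t \<phi>x \<longleftrightarrow>
     (\<forall>p\<in>{t0..<T} \<times> UNIV.
        (\<phi> has_derivative (\<lambda>(s, v). s * \<phi>t p + v \<bullet> \<phi>x p)) (at p within {t0..<T} \<times> UNIV)) \<and>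
     continuous_on ({t0..<T} \<times> UNIV) \<phi>t \<and>
     continuous_on ({t0..<T} \<times> UNIV) \<phi>x \<and>
     (\<exists>K. compact K \<and> (\<forall>t\<in>{t0..<T}. \<forall>x. x \<notin> K \<longrightarrow> \<phi> (t, x) = 0)) \<and>
     (\<exists>\<epsilon>>0. \<forall>t\<in>{t0..<T}. T - \<epsilon> < t \<longrightarrow> (\<forall>x. \<phi> (t, x) = 0))"

text \<open>\<open>G t\<close> is \<open>\<nabla>I\<^bsub>2-\<alpha>\<^esub>(|u(t)|\<^bsup>m-1\<^esup>)\<close> for almost every \<open>t\<close>. Joint integrability of the potential
  and of \<open>G\<close> on \<open>(t\<^sub>0,T) \<times> K\<close> for all compact \<open>K\<close> says that the potential belongs to
  \<open>L\<^sup>1(t\<^sub>0,T; W\<^sup>1\<^sup>,\<^sup>1\<^sub>l\<^sub>o\<^sub>c)\<close>.\<close>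
definition weak_solution ::
  "real \<Rightarrow> real \<Rightarrow> real \<Rightarrow> real \<Rightarrow> ('a::euclidean_space \<Rightarrow> real) \<Rightarrow> (real \<Rightarrow> 'a \<Rightarrow> real) \<Rightarrow> bool" where
  "weak_solution \<alpha> m t0 T u0 u \<longleftrightarrow>
     set_integrable lborel ({t0<..<T} \<times> UNIV) (\<lambda>(t, x). u t x) \<and>
     locally_integrable u0 \<and>
     (\<exists>G :: real \<Rightarrow> 'a \<Rightarrow> 'a.
        (AE t in lborel. t \<in> {t0<..<T} \<longrightarrow>
           frac_gradient (\<alpha> - 1) (\<lambda>x. \<bar>u t x\<bar> powr (m - 1)) (G t)) \<and>
        (\<forall>K. compact K \<longrightarrow>
           set_integrable lborel ({t0<..<T} \<times> K)
             (\<lambda>(t, x). riesz_potential (2 - \<alpha>) (\<lambda>y. \<bar>u t y\<bar> powr (m - 1)) x) \<and>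
           set_integrable lborel ({t0<..<T} \<times> K) (\<lambda>(t, x). G t x)) \<and>
        set_integrable lborel ({t0<..<T} \<times> UNIV) (\<lambda>(t, x). u t x *\<^sub>R G t x) \<and>
        (\<forall>\<phi> \<phi>t \<phi>x. strip_test_function t0 T \<phi> \<phi>t \<phi>x \<longrightarrow>
           (LBINT t:{t0<..<T}. (LBINT x. u t x * (\<phi>t (t, x) - G t x \<bullet> \<phi>x (t, x))))
             + (LBINT x. u0 x * \<phi> (t0, x)) = 0))"

text \<open>\<open>\<partial>\<^sub>t u = \<nabla>\<cdot>(u \<nabla>I\<^bsub>2-\<alpha>\<^esub>(|u|\<^bsup>m-1\<^esup>))\<close> at the point \<open>(t, x)\<close>, all derivatives being classical.\<close>
definition pointwise_solution_at ::
  "real \<Rightarrow> real \<Rightarrow> (real \<Rightarrow> 'a::euclidean_space \<Rightarrow> real) \<Rightarrow> real \<Rightarrow> 'a \<Rightarrow> bool" where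
  "pointwise_solution_at \<alpha> m u t x \<longleftrightarrow>
     (\<exists>G ut D.
        (\<forall>\<^sub>F y in nhds x.
           riesz_converges (2 - \<alpha>) (\<lambda>z. \<bar>u t z\<bar> powr (m - 1)) y \<and>
           (GDERIV (riesz_potential (2 - \<alpha>) (\<lambda>z. \<bar>u t z\<bar> powr (m - 1))) y :> G y)) \<and>
        ((\<lambda>s. u s x) has_real_derivative ut) (at t) \<and>
        has_divergence (\<lambda>y. u t y *\<^sub>R G y) D x \<and>
        ut - D = 0)"

section \<open>Hoelder continuity\<close>

definition holder_on ::
  "real \<Rightarrow> 'a::metric_space set \<Rightarrow> ('a \<Rightarrow> 'b::metric_space) \<Rightarrow> bool" where
  "holder_on \<gamma> S f \<longleftrightarrow> (\<exists>C. \<forall>p\<in>S. \<forall>q\<in>S. dist (f p) (f q) \<le> C * dist p q powr \<gamma>)"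

definition holder_at :: "real \<Rightarrow> ('a::metric_space \<Rightarrow> 'b::metric_space) \<Rightarrow> 'a \<Rightarrow> bool" where
  "holder_at \<gamma> f p \<longleftrightarrow> (\<exists>U. open U \<and> p \<in> U \<and> holder_on \<gamma> U f)"

end

theory Submission
  imports Defs
begin

text \<open>
  Write \<open>p = \<alpha>/2\<close> and \<open>f = (\<rho>\<^sup>2 - |x|\<^sup>2)\<^sub>+\<^sup>p\<close>. Everything rests on the fact that the potential
  \<open>I\<^bsub>2-2p\<^esub> f\<close> is \<open>c - \<kappa>|x|\<^sup>2/2\<close> inside the ball, so that the field \<open>\<nabla>\<^bsup>\<alpha>-1\<^esup>(u\<^bsup>m-1\<^esup>)\<close> is \<open>-(\<lambda>/t) x\<close> on the
  support of \<open>u\<close>. In polar coordinates around \<open>x\<close> the integral splits into integrals over chords,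
  \<open>\<integral>\<^bsub>-b\<^esub>\<^bsup>a\<^esup> ((a - r)(r + b))\<^sup>p |r|\<^bsup>1-2p\<^esup> dr\<close>, which is a quadratic form in \<open>(a, b)\<close>: each half of the chord
  satisfies a second-order linear equation, which \<open>Q(x) = 1 - (2p - 1) x\<^sup>2\<close> also satisfies, and the
  Wronskian of two even solutions vanishes. Averaging over directions
  leaves \<open>\<rho>\<^sup>2\<close> and \<open>|x|\<^sup>2\<close>. The logarithmic kernel is a limit of power kernels.

  Outside the ball the kernel is differentiated under the integral sign; since \<open>|x - z| \<ge> \<rho> - |z|\<close>,
  the vanishing of \<open>f\<close> at the sphere compensates the singularity of the differentiated kernel, so the
  gradient is locally bounded off the sphere and is the weak gradient. In the variables
  \<open>x = t\<^sup>\<lambda> y\<close> the weak formulation becomes the fundamental theorem of calculus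
  for \<open>t \<mapsto> \<phi>(t, t\<^sup>\<lambda> y)\<close>.
\<close>

section \<open>Differentiation under the integral and weak gradients\<close>

text \<open>The exponent of the profile is matched to the kernel: in polar coordinates r^(d-1) times
  r^(2-2p-d) leaves r^(1-2p), so one identity on chords serves every dimension. The equation behind
  it is Gegenbauer's of degree 2 and parameter p - 3/2, with Q as its polynomial solution; adding
  opposite directions joins two halves of a chord into the even solution that is compared with Q.
  The constant \<open>k\<close> is \<open>lam\<close> divided by the rate kappa, so that minus the
  field is (lam/t) x, the velocity of the points t^lam y: the density is carried along by dilation,
  and the nonlocal tail of the field, living where \<open>u\<close> vanishes, never enters the flux.
  The obstacle is the sphere. There the potential is controlled only through its continuity, which
  excludes a surface term in the weak gradient. In dimension one with \<alpha> < 1 the kernel grows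
  and its constant is negative; nonnegative integration is therefore applied to the bare power of
  |w|, and the constant is multiplied in afterwards.\<close>

lemma GDERIV_integral:
  fixes f :: "'a::euclidean_space \<Rightarrow> 'b \<Rightarrow> real" and D :: "'a \<Rightarrow> 'b \<Rightarrow> 'a"
  assumes e: "0 < e"
    and int: "\<And>y. y \<in> ball x e \<Longrightarrow> integrable M (f y)"
    and der: "\<And>y z. y \<in> ball x e \<Longrightarrow> z \<in> space M \<Longrightarrow> GDERIV (\<lambda>y. f y z) y :> D y z"
    and bnd: "\<And>y z. y \<in> ball x e \<Longrightarrow> z \<in> space M \<Longrightarrow> norm (D y z) \<le> w z"
    and w: "integrable M w"
    and meas: "D x \<in> borel_measurable M"
  shows "GDERIV (\<lambda>y. \<integral>z. f y z \<partial>M) x :> (\<integral>z. D x z \<partial>M)"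
proof -
  have x: "x \<in> ball x e" using e by simp
  have Dx: "integrable M (D x)"
    by (rule Bochner_Integration.integrable_bound[OF w meas])
       (use bnd[OF x] in \<open>auto intro!: AE_I2 intro: order_trans[OF _ abs_ge_self]\<close>)
  \<comment> \<open>The mean value inequality on the convex ball turns the gradient bound
    \<open>w\<close> into a Lipschitz bound; the difference quotients minus their linear part are
    then dominated by \<open>2 * w\<close>.\<close>
  have lip: "\<bar>f y z - f x z\<bar> \<le> w z * norm (y - x)" if y: "y \<in> ball x e" and z: "z \<in> space M" for y z
  proof -
    have "norm (f y z - f x z) \<le> w z * norm (y - x)"
    proof (rule differentiable_bound[OF convex_ball[of x e] _ _ y x])
      fix v assume v: "v \<in> ball x e"
      show "((\<lambda>y. f y z) has_derivative (\<lambda>h. h \<bullet> D v z)) (at v within ball x e)"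
        using der[OF v z] by (auto simp: gderiv_def intro: has_derivative_at_withinI)
      show "onorm (\<lambda>h. h \<bullet> D v z) \<le> w z"
      proof (rule onorm_le)
        fix h :: 'a
        have "\<bar>h \<bullet> D v z\<bar> \<le> norm h * norm (D v z)" by (rule Cauchy_Schwarz_ineq2)
        also have "\<dots> \<le> norm h * w z" by (intro mult_left_mono bnd v z) auto
        finally show "norm (h \<bullet> D v z) \<le> w z * norm h" by (simp add: mult.commute)
      qed
    qed
    then show ?thesis by simp
  qed
  let ?V = "\<lambda>y. \<integral>z. f y z \<partial>M" and ?G = "\<integral>z. D x z \<partial>M"
  show ?thesis unfolding gderiv_def has_derivative_iff_norm
  proof (intro conjI bounded_linear_inner_left)
    show "((\<lambda>y. norm (?V y - ?V x - (y - x) \<bullet> ?G) / norm (y - x)) \<longlongrightarrow> 0) (at x)"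
      unfolding tendsto_at_iff_sequentially
    proof (intro allI impI)
      fix X :: "nat \<Rightarrow> 'a" assume X: "\<forall>i. X i \<in> UNIV - {x}" "X \<longlonglongrightarrow> x"
      obtain N where N: "\<And>i. i \<ge> N \<Longrightarrow> X i \<in> ball x e"
        using X(2) e unfolding lim_sequentially by (auto simp: dist_commute)
      \<comment> \<open>Dominated convergence needs every term in the ball, but \<open>X\<close> is
        there only from \<open>N\<close> on; \<open>LIMSEQ_offset\<close> restores the initial terms
        at the end.\<close>
      define Y where "Y i = X (i + N)" for i
      have Y: "Y i \<in> ball x e" "Y i \<noteq> x" for i using N X(1) by (auto simp: Y_def)
      have Ylim: "Y \<longlonglongrightarrow> x" unfolding Y_def by (rule LIMSEQ_ignore_initial_segment[OF X(2)])
      define q where "q i z = (f (Y i) z - f x z - (Y i - x) \<bullet> D x z) / norm (Y i - x)" for i z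
      have [measurable]: "f (Y i) \<in> borel_measurable M" "f x \<in> borel_measurable M" for i
        using int[OF Y(1)[of i]] int[OF x] by auto
      note [measurable] = meas
      have "(\<lambda>i. \<integral>z. q i z \<partial>M) \<longlonglongrightarrow> (\<integral>z. 0 \<partial>M)"
      proof (rule integral_dominated_convergence)
        show "integrable M (\<lambda>z. 2 * w z)" using w by simp
        show "q i \<in> borel_measurable M" for i unfolding q_def by measurable
        show "AE z in M. (\<lambda>i. q i z) \<longlonglongrightarrow> 0"
        proof (rule AE_I2)
          fix z assume z: "z \<in> space M"
          have "((\<lambda>y. norm (f y z - f x z - (y - x) \<bullet> D x z) / norm (y - x)) \<longlongrightarrow> 0) (at x)"
            using der[OF x z] unfolding gderiv_def has_derivative_iff_norm by blast
          then have "((\<lambda>y. norm (f y z - f x z - (y - x) \<bullet> D x z) / norm (y - x)) \<circ> Y) \<longlonglongrightarrow> 0"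
            unfolding tendsto_at_iff_sequentially using Y Ylim by blast
          then have "(\<lambda>i. norm (q i z)) \<longlonglongrightarrow> 0" by (simp add: q_def o_def)
          then show "(\<lambda>i. q i z) \<longlonglongrightarrow> 0" by (rule tendsto_norm_zero_cancel)
        qed
        show "AE z in M. norm (q i z) \<le> 2 * w z" for i
        proof (rule AE_I2)
          fix z assume z: "z \<in> space M"
          have "\<bar>(Y i - x) \<bullet> D x z\<bar> \<le> norm (Y i - x) * norm (D x z)" by (rule Cauchy_Schwarz_ineq2)
          also have "\<dots> \<le> norm (Y i - x) * w z" by (intro mult_left_mono bnd x z) auto
          finally have "\<bar>f (Y i) z - f x z - (Y i - x) \<bullet> D x z\<bar> \<le> 2 * w z * norm (Y i - x)"
            using lip[OF Y(1) z, of i] by (simp add: algebra_simps)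
          then show "norm (q i z) \<le> 2 * w z" using Y(2)[of i] by (simp add: q_def divide_le_eq)
        qed
      qed auto
      then have "(\<lambda>i. \<bar>\<integral>z. q i z \<partial>M\<bar>) \<longlonglongrightarrow> 0" using tendsto_rabs_zero by fastforce
      moreover have "(\<integral>z. q i z \<partial>M) = (?V (Y i) - ?V x - (Y i - x) \<bullet> ?G) / norm (Y i - x)" for i
        unfolding q_def using int[OF Y(1)[of i]] int[OF x] Dx by simp
      ultimately have "(\<lambda>i. ((\<lambda>y. norm (?V y - ?V x - (y - x) \<bullet> ?G) / norm (y - x)) \<circ> X) (i + N)) \<longlonglongrightarrow> 0"
        by (simp add: Y_def o_def)
      then show "((\<lambda>y. norm (?V y - ?V x - (y - x) \<bullet> ?G) / norm (y - x)) \<circ> X) \<longlonglongrightarrow> 0"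
        by (rule LIMSEQ_offset)
    qed
  qed
qed

lemma integrable_bounded_support:
  fixes f :: "'a::euclidean_space \<Rightarrow> 'b::{banach,second_countable_topology}"
  assumes f: "f \<in> borel_measurable borel"
    and supp: "\<And>x. x \<notin> cball 0 N \<Longrightarrow> f x = 0"
    and bnd: "\<And>x. x \<in> cball 0 N \<Longrightarrow> norm (f x) \<le> B"
  shows "integrable lborel f"
proof (rule Bochner_Integration.integrable_bound)
  show "integrable lborel (\<lambda>x::'a. B * indicator (cball 0 N) x :: real)"
    using emeasure_bounded_finite[of "cball 0 N :: 'a set"] by (intro integrable_mult_right integrable_real_indicator) auto
  show "f \<in> borel_measurable lborel" using f by simp
  show "AE x in lborel. norm (f x) \<le> norm (B * indicator (cball 0 N) x)"
  proof (rule AE_I2)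
    fix x :: 'a
    show "norm (f x) \<le> norm (B * indicator (cball 0 N) x)"
      using supp[of x] bnd[of x] by (cases "x \<in> cball 0 N") auto
  qed
qed

lemma integral_translate:
  fixes f :: "'a::euclidean_space \<Rightarrow> 'b::{banach,second_countable_topology}"
  assumes [measurable]: "f \<in> borel_measurable borel"
  shows "(LBINT x. f (c + x)) = (LBINT x. f x)"
  using integral_distr[of "(+) c" lborel borel f] lborel_distr_plus[of c] by simp

lemma integrable_translate:
  fixes f :: "'a::euclidean_space \<Rightarrow> 'b::{banach,second_countable_topology}"
  assumes "integrable lborel f"
  shows "integrable lborel (\<lambda>x. f (c + x))"
  using integrable_distr_eq[of "(+) c" lborel borel f] lborel_distr_plus[of c] assms by simp

text \<open>The equation is a monic quadratic in \<open>\<tau>\<close>. Finiteness lets the sphere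
  serve as the exceptional set of the fundamental theorem of calculus along lines.\<close>

lemma finite_sphere_line:
  fixes x b :: "'a::euclidean_space"
  assumes "norm b = 1"
  shows "finite {\<tau>. norm (x + \<tau> *\<^sub>R b) = \<rho>}"
proof -
  define s where "s = sqrt ((x \<bullet> b)\<^sup>2 - (x \<bullet> x) + \<rho>\<^sup>2)"
  have "{\<tau>. norm (x + \<tau> *\<^sub>R b) = \<rho>} \<subseteq> {- (x \<bullet> b) + s, - (x \<bullet> b) - s}"
  proof
    fix \<tau> assume "\<tau> \<in> {\<tau>. norm (x + \<tau> *\<^sub>R b) = \<rho>}"
    then have "(x + \<tau> *\<^sub>R b) \<bullet> (x + \<tau> *\<^sub>R b) = \<rho>\<^sup>2" by (auto simp: power2_norm_eq_inner[symmetric])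
    moreover have "b \<bullet> b = 1" using assms by (simp add: norm_eq_1)
    ultimately have "x \<bullet> x + 2 * \<tau> * (x \<bullet> b) + \<tau>\<^sup>2 = \<rho>\<^sup>2"
      by (simp add: inner_add_left inner_add_right inner_commute power2_eq_square algebra_simps)
    then have eq: "(\<tau> + x \<bullet> b)\<^sup>2 = (x \<bullet> b)\<^sup>2 - (x \<bullet> x) + \<rho>\<^sup>2" by (simp add: power2_eq_square algebra_simps)
    then have "\<bar>\<tau> + x \<bullet> b\<bar> = s" unfolding s_def by (metis real_sqrt_abs)
    then show "\<tau> \<in> {- (x \<bullet> b) + s, - (x \<bullet> b) - s}" by auto
  qed
  then show ?thesis by (rule finite_subset) simp
qed

text \<open>Integrating over lines through translations avoids splitting the space into a line and its
  complement: \<open>\<integral> F (x + b) - F x dx\<close> vanishes and equals \<open>\<integral>\<integral>\<^sub>0\<^sup>1 D (x + \<tau> b) d\<tau> dx = \<integral> D\<close>.\<close>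

lemma integral_directional_derivative_eq_0:
  fixes F D :: "'a::euclidean_space \<Rightarrow> real"
  assumes b: "norm b = 1"
    and F: "continuous_on UNIV F"
    and [measurable]: "D \<in> borel_measurable borel"
    and supp: "\<And>x. x \<notin> cball 0 N \<Longrightarrow> F x = 0" "\<And>x. x \<notin> cball 0 N \<Longrightarrow> D x = 0"
    and bnd: "\<And>x. x \<in> cball 0 N \<Longrightarrow> \<bar>D x\<bar> \<le> B"
    and der: "\<And>x. norm x \<noteq> \<rho> \<Longrightarrow> \<exists>F'. (F has_derivative F') (at x) \<and> F' b = D x"
  shows "(LBINT x. D x) = 0"
proof -
  have [measurable]: "F \<in> borel_measurable borel" by (rule borel_measurable_continuous_onI[OF F])
  have "continuous_on (cball 0 N) F" using F continuous_on_subset by blast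
  then have "bounded (F ` cball 0 N)" using compact_continuous_image compact_cball compact_imp_bounded by blast
  then obtain B' where B': "\<And>x. x \<in> cball 0 N \<Longrightarrow> norm (F x) \<le> B'" unfolding bounded_iff by blast
  have intF: "integrable lborel F"
    by (rule integrable_bounded_support[of F N B']) (use supp B' in auto)
  define K where "K p = indicator {0..1} (fst p) * D (snd p + fst p *\<^sub>R b)" for p :: "real \<times> 'a"
  have [measurable]: "K \<in> borel_measurable borel"
    unfolding K_def borel_prod[symmetric] by measurable
  have B0: "\<bar>D x\<bar> \<le> \<bar>B\<bar>" for x using supp(2)[of x] bnd[of x] by (cases "x \<in> cball 0 N") auto
  have "integrable lborel K"
  \<comment> \<open>The support of \<open>D\<close>, moved by at most one unit along
    \<open>b\<close>, lies within \<open>N + 1\<close>, and the coordinate \<open>\<tau>\<close>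
    adds one more. Absolute values cover a negative \<open>N\<close> or \<open>B\<close>.\<close>
  proof (rule integrable_bounded_support[of K "\<bar>N\<bar> + 2" "\<bar>B\<bar>"])
    fix p :: "real \<times> 'a" assume p: "p \<notin> cball 0 (\<bar>N\<bar> + 2)"
    show "K p = 0"
    proof (rule ccontr)
      assume "K p \<noteq> 0"
      then have 1: "fst p \<in> {0..1}" "norm (snd p + fst p *\<^sub>R b) \<le> N"
        using supp(2)[of "snd p + fst p *\<^sub>R b"] by (auto simp: K_def indicator_def split: if_splits)
      have "norm (snd p) = norm ((snd p + fst p *\<^sub>R b) - fst p *\<^sub>R b)" by simp
      also have "\<dots> \<le> N + 1"
        by (rule order_trans[OF norm_triangle_ineq4]) (use 1 b in auto)
      finally have "norm p \<le> N + 2"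
        using norm_Pair_le[of "fst p" "snd p"] 1 by auto
      then show False using p by auto
    qed
  next
    fix p show "norm (K p) \<le> \<bar>B\<bar>" using B0[of "snd p + fst p *\<^sub>R b"] by (auto simp: K_def indicator_def)
  qed simp
  then have intK: "integrable (lborel \<Otimes>\<^sub>M lborel) (\<lambda>(\<tau>, x). K (\<tau>, x))"
    by (simp add: lborel_prod)
  have "(LBINT \<tau>. (LBINT x. K (\<tau>, x))) = (LBINT x. (LBINT \<tau>. K (\<tau>, x)))"
    using lborel_pair.Fubini_integral[OF intK] by simp
  moreover have "(LBINT x. K (\<tau>, x)) = indicator {0..1} \<tau> * (LBINT x. D x)" for \<tau>
    using integral_translate[of D "\<tau> *\<^sub>R b"] by (simp add: K_def add.commute)
  moreover have "(LBINT \<tau>. K (\<tau>, x)) = F (b + x) - F x" for x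
  proof -
    have "((\<lambda>\<tau>. D (x + \<tau> *\<^sub>R b)) has_integral F (x + 1 *\<^sub>R b) - F (x + 0 *\<^sub>R b)) {0..1}"
    proof (rule fundamental_theorem_of_calculus_interior_strong)
      show "finite {\<tau>. norm (x + \<tau> *\<^sub>R b) = \<rho>}" using finite_sphere_line[OF b] .
      show "continuous_on {0..1} (\<lambda>\<tau>. F (x + \<tau> *\<^sub>R b))"
        by (intro continuous_on_compose2[OF F] continuous_intros) auto
      fix \<tau> assume "\<tau> \<in> {0<..<1} - {\<tau>. norm (x + \<tau> *\<^sub>R b) = \<rho>}"
      then obtain F' where F': "(F has_derivative F') (at (x + \<tau> *\<^sub>R b))" "F' b = D (x + \<tau> *\<^sub>R b)"
        using der by blast
      have "((\<lambda>\<tau>. F (x + \<tau> *\<^sub>R b)) has_derivative (\<lambda>h. F' (h *\<^sub>R b))) (at \<tau>)"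
        by (rule has_derivative_compose[where f = "\<lambda>\<tau>. x + \<tau> *\<^sub>R b" and g = F])
           (use F'(1) in \<open>auto intro!: derivative_eq_intros\<close>)
      moreover have "F' (h *\<^sub>R b) = h *\<^sub>R D (x + \<tau> *\<^sub>R b)" for h
        using linear_scale[OF has_derivative_linear[OF F'(1)]] F'(2) by simp
      ultimately show "((\<lambda>\<tau>. F (x + \<tau> *\<^sub>R b)) has_vector_derivative D (x + \<tau> *\<^sub>R b)) (at \<tau>)"
        by (simp add: has_vector_derivative_def)
    qed auto
    then have "integral {0..1} (\<lambda>\<tau>. D (x + \<tau> *\<^sub>R b)) = F (x + b) - F x"
      by (simp add: integral_unique)
    moreover have "set_integrable lborel {0..1} (\<lambda>\<tau>. D (x + \<tau> *\<^sub>R b))"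
      unfolding set_integrable_def
      by (rule integrable_bounded_support[of _ 1 "\<bar>B\<bar>"])
         (use B0 in \<open>auto simp: indicator_def\<close>)
    ultimately have "(LBINT \<tau>:{0..1}. D (x + \<tau> *\<^sub>R b)) = F (x + b) - F x"
      by (simp add: set_borel_integral_eq_integral(2))
    then show ?thesis by (simp add: K_def set_lebesgue_integral_def add.commute)
  qed
  ultimately have "(LBINT \<tau>::real. indicator {0..1} \<tau> * (LBINT x. D x)) = (LBINT x. F (b + x) - F x)"
    by simp
  also have "\<dots> = 0"
    using integral_translate[of F b] integrable_translate[OF intF, of b] intF by simp
  finally show ?thesis by (simp add: content_real)
qed

lemma test_function_facts:
  fixes \<phi> :: "'a::euclidean_space \<Rightarrow> real"
  assumes \<phi>: "test_function \<phi>"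
  shows "(\<phi> has_derivative (\<lambda>h. h \<bullet> grad \<phi> x)) (at x)"
    and "continuous_on UNIV \<phi>" and "continuous_on UNIV (grad \<phi>)"
    and "\<exists>N. \<forall>x. x \<notin> cball 0 N \<longrightarrow> \<phi> x = 0 \<and> grad \<phi> x = 0"
proof -
  have "Ck (Suc 0) \<phi>" using \<phi> unfolding test_function_def by blast
  then have d: "\<And>x. \<phi> differentiable (at x)"
    and c: "\<And>b. b \<in> Basis \<Longrightarrow> continuous_on UNIV (\<lambda>x. frechet_derivative \<phi> (at x) b)"
    by auto
  have d': "(\<phi> has_derivative frechet_derivative \<phi> (at x)) (at x)" for x
    using d frechet_derivative_works by blast
  have "frechet_derivative \<phi> (at x) h = h \<bullet> grad \<phi> x" for x h
  proof -
    have lin: "linear (frechet_derivative \<phi> (at x))" using has_derivative_linear[OF d'] .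
    have "frechet_derivative \<phi> (at x) h = frechet_derivative \<phi> (at x) (\<Sum>b\<in>Basis. (h \<bullet> b) *\<^sub>R b)"
      by (simp add: euclidean_representation)
    also have "\<dots> = (\<Sum>b\<in>Basis. (h \<bullet> b) * frechet_derivative \<phi> (at x) b)"
      by (simp add: linear_sum[OF lin] linear_scale[OF lin])
    also have "\<dots> = h \<bullet> grad \<phi> x" by (simp add: grad_def inner_sum_right mult.commute)
    finally show ?thesis .
  qed
  then have eq: "frechet_derivative \<phi> (at x) = (\<lambda>h. h \<bullet> grad \<phi> x)" for x by auto
  show "(\<phi> has_derivative (\<lambda>h. h \<bullet> grad \<phi> x)) (at x)" for x using d'[of x] eq by simp
  show "continuous_on UNIV \<phi>"
    by (simp add: continuous_on_eq_continuous_within has_derivative_continuous[OF d'])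
  show "continuous_on UNIV (grad \<phi>)" unfolding grad_def by (intro continuous_intros c)
  have "bounded (closure {x. \<phi> x \<noteq> 0})" using \<phi> unfolding test_function_def by (blast intro: compact_imp_bounded)
  then obtain N where N: "\<And>x. x \<in> closure {x. \<phi> x \<noteq> 0} \<Longrightarrow> norm x \<le> N" unfolding bounded_iff by blast
  show "\<exists>N. \<forall>x. x \<notin> cball 0 N \<longrightarrow> \<phi> x = 0 \<and> grad \<phi> x = 0"
  proof (intro exI allI impI)
    fix x :: 'a assume "x \<notin> cball 0 N"
    then have x: "x \<in> - closure {x. \<phi> x \<noteq> 0}" using N by auto
    have z: "\<phi> y = 0" if "y \<in> - closure {x. \<phi> x \<noteq> 0}" for y using that closure_subset[of "{x. \<phi> x \<noteq> 0}"] by blast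
    have "((\<lambda>_. 0) has_derivative frechet_derivative \<phi> (at x)) (at x)"
      by (rule has_derivative_transform_within_open[OF d'[of x] _ x]) (rule open_Compl[OF closed_closure], rule z)
    then have "frechet_derivative \<phi> (at x) = (\<lambda>_. 0)" by (rule has_derivative_unique) auto
    then show "\<phi> x = 0 \<and> grad \<phi> x = 0" by (simp add: grad_def z[OF x])
  qed
qed

lemma locally_integrable_bounded:
  fixes g :: "'a::euclidean_space \<Rightarrow> 'b::{banach,second_countable_topology}"
  assumes [measurable]: "g \<in> borel_measurable borel"
    and bnd: "\<And>N. \<exists>B. \<forall>x\<in>cball 0 N. norm (g x) \<le> B"
  shows "locally_integrable g"
  unfolding locally_integrable_def
proof (intro allI impI)
  fix K :: "'a set" assume K: "compact K"
  then have [measurable]: "K \<in> sets borel" by (simp add: borel_compact)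
  obtain N where N: "\<And>x. x \<in> K \<Longrightarrow> norm x \<le> N"
    using compact_imp_bounded[OF K] unfolding bounded_iff by blast
  obtain B where B: "\<forall>x\<in>cball 0 N. norm (g x) \<le> B" using bnd by blast
  show "set_integrable lborel K g" unfolding set_integrable_def
  proof (rule integrable_bounded_support[of _ N "\<bar>B\<bar>"])
    fix x assume "x \<in> cball (0::'a) N"
    then have "norm (g x) \<le> \<bar>B\<bar>" using B by force
    then show "norm (indicator K x *\<^sub>R g x) \<le> \<bar>B\<bar>" by (simp add: indicator_def)
  qed (use N in \<open>auto simp: indicator_def\<close>)
qed

lemma continuous_bounded_on_cball:
  fixes g :: "'a::euclidean_space \<Rightarrow> 'b::real_normed_vector"
  assumes "continuous_on UNIV g"
  shows "\<exists>B. \<forall>x\<in>cball 0 N. norm (g x) \<le> B"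
proof -
  have "bounded (g ` cball 0 N)"
    by (rule compact_imp_bounded[OF compact_continuous_image[OF continuous_on_subset[OF assms subset_UNIV] compact_cball]])
  then obtain B where "\<forall>y\<in>g ` cball 0 N. norm y \<le> B" unfolding bounded_iff by (rule exE)
  then show ?thesis by (intro exI[of _ B]) simp
qed

text \<open>A gradient known almost everywhere would miss a jump across the sphere. Continuity of
  \<open>V\<close> excludes it, since \<open>V x * \<phi> x\<close> is then a primitive along every
  line up to finitely many points; each component of the claim says that a compactly supported
  directional derivative integrates to zero.\<close>

lemma weak_gradient_off_sphere:
  fixes V :: "'a::euclidean_space \<Rightarrow> real"
  assumes V: "continuous_on UNIV V"
    and [measurable]: "g \<in> borel_measurable borel"
    and bnd: "\<And>N. \<exists>B. \<forall>x\<in>cball 0 N. norm (g x) \<le> B"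
    and der: "\<And>x. norm x \<noteq> \<rho> \<Longrightarrow> GDERIV V x :> g x"
  shows "weak_gradient V g"
  unfolding weak_gradient_def
proof (intro conjI allI impI)
  have [measurable]: "V \<in> borel_measurable borel" by (rule borel_measurable_continuous_onI[OF V])
  show "locally_integrable V"
    by (rule locally_integrable_bounded) (use continuous_bounded_on_cball[OF V] in auto)
  show "locally_integrable g" by (rule locally_integrable_bounded) (use bnd in auto)
  fix \<phi> :: "'a \<Rightarrow> real" assume "test_function \<phi>"
  note \<phi> = test_function_facts[OF this]
  note [measurable] = borel_measurable_continuous_onI[OF \<phi>(2)] borel_measurable_continuous_onI[OF \<phi>(3)]
  obtain N where N: "\<And>x. x \<notin> cball 0 N \<Longrightarrow> \<phi> x = 0" "\<And>x. x \<notin> cball 0 N \<Longrightarrow> grad \<phi> x = 0"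
    using \<phi>(4) by blast
  obtain B where B: "\<And>x. x \<in> cball 0 N \<Longrightarrow> norm (g x) \<le> B" using bnd by blast
  obtain B1 where B1: "\<And>x. x \<in> cball 0 N \<Longrightarrow> \<bar>V x\<bar> \<le> B1" using continuous_bounded_on_cball[OF V] unfolding real_norm_def by blast
  obtain B2 where B2: "\<And>x. x \<in> cball 0 N \<Longrightarrow> \<bar>\<phi> x\<bar> \<le> B2" using continuous_bounded_on_cball[OF \<phi>(2)] unfolding real_norm_def by blast
  obtain B3 where B3: "\<And>x. x \<in> cball 0 N \<Longrightarrow> norm (grad \<phi> x) \<le> B3" using continuous_bounded_on_cball[OF \<phi>(3)] by blast
  have b1: "norm (V x *\<^sub>R grad \<phi> x) \<le> \<bar>B1\<bar> * \<bar>B3\<bar>" if "x \<in> cball 0 N" for x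
    unfolding norm_scaleR using B1[OF that] B3[OF that] by (intro mult_mono; (rule norm_ge_zero abs_ge_zero | simp | linarith))
  have b2: "norm (\<phi> x *\<^sub>R g x) \<le> \<bar>B2\<bar> * \<bar>B\<bar>" if "x \<in> cball 0 N" for x
    unfolding norm_scaleR using B2[OF that] B[OF that] by (intro mult_mono; (rule norm_ge_zero abs_ge_zero | simp | linarith))
  have i1: "integrable lborel (\<lambda>x. V x *\<^sub>R grad \<phi> x)"
  proof (rule integrable_bounded_support[OF _ _ b1])
    show "V x *\<^sub>R grad \<phi> x = 0" if "x \<notin> cball 0 N" for x by (simp only: N(2)[OF that] scaleR_zero_right)
  qed auto
  have i2: "integrable lborel (\<lambda>x. \<phi> x *\<^sub>R g x)"
  proof (rule integrable_bounded_support[OF _ _ b2])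
    show "\<phi> x *\<^sub>R g x = 0" if "x \<notin> cball 0 N" for x by (simp only: N(1)[OF that] scaleR_zero_left)
  qed auto
  have "(LBINT x. V x *\<^sub>R grad \<phi> x) + (LBINT x. \<phi> x *\<^sub>R g x) = 0"
  proof (rule euclidean_eqI)
    fix b :: 'a assume b: "b \<in> Basis"
    have "((LBINT x. V x *\<^sub>R grad \<phi> x) + (LBINT x. \<phi> x *\<^sub>R g x)) \<bullet> b
        = (LBINT x. V x * (grad \<phi> x \<bullet> b) + \<phi> x * (g x \<bullet> b))"
    proof -
      have "(LBINT x. V x * (grad \<phi> x \<bullet> b) + \<phi> x * (g x \<bullet> b))
          = (LBINT x. (V x *\<^sub>R grad \<phi> x) \<bullet> b + (\<phi> x *\<^sub>R g x) \<bullet> b)" by simp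
      also have "\<dots> = (LBINT x. (V x *\<^sub>R grad \<phi> x) \<bullet> b) + (LBINT x. (\<phi> x *\<^sub>R g x) \<bullet> b)"
        by (intro Bochner_Integration.integral_add integrable_inner_left i1 i2)
      also have "\<dots> = (LBINT x. V x *\<^sub>R grad \<phi> x) \<bullet> b + (LBINT x. \<phi> x *\<^sub>R g x) \<bullet> b"
        by (simp only: integral_inner_left[OF i1] integral_inner_left[OF i2])
      finally show ?thesis by (simp only: inner_add_left)
    qed
    also have "\<dots> = 0"
    proof (rule integral_directional_derivative_eq_0[of b "\<lambda>x. V x * \<phi> x" _ N "\<bar>B1\<bar> * \<bar>B3\<bar> + \<bar>B2\<bar> * \<bar>B\<bar>" \<rho>])
      show "norm b = 1" using b by simp
      show "continuous_on UNIV (\<lambda>x. V x * \<phi> x)" by (intro continuous_intros V \<phi>)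
      show "V x * \<phi> x = 0" if "x \<notin> cball 0 N" for x using N(1)[OF that] by simp
      show "V x * (grad \<phi> x \<bullet> b) + \<phi> x * (g x \<bullet> b) = 0" if "x \<notin> cball 0 N" for x
        using N[OF that] by simp
      show "\<bar>V x * (grad \<phi> x \<bullet> b) + \<phi> x * (g x \<bullet> b)\<bar> \<le> \<bar>B1\<bar> * \<bar>B3\<bar> + \<bar>B2\<bar> * \<bar>B\<bar>" if "x \<in> cball 0 N" for x
        using b1[OF that] b2[OF that] Basis_le_norm[OF b, of "V x *\<^sub>R grad \<phi> x"] Basis_le_norm[OF b, of "\<phi> x *\<^sub>R g x"]
          abs_triangle_ineq[of "V x * (grad \<phi> x \<bullet> b)" "\<phi> x * (g x \<bullet> b)"]
        unfolding inner_scaleR_left by linarith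
      fix x :: 'a assume "norm x \<noteq> \<rho>"
      then have "(V has_derivative (\<lambda>h. h \<bullet> g x)) (at x)" using der by (auto simp: gderiv_def)
      from has_derivative_mult[OF this \<phi>(1)[of x]]
      show "\<exists>F'. ((\<lambda>x. V x * \<phi> x) has_derivative F') (at x) \<and>
          F' b = V x * (grad \<phi> x \<bullet> b) + \<phi> x * (g x \<bullet> b)"
        by (intro exI[of _ "\<lambda>h. V x * (h \<bullet> grad \<phi> x) + h \<bullet> g x * \<phi> x"] conjI)
           (assumption, simp only: inner_commute[of b] mult.commute[of "\<phi> x"])
    qed simp
    finally show "((LBINT x. V x *\<^sub>R grad \<phi> x) + (LBINT x. \<phi> x *\<^sub>R g x)) \<bullet> b = 0 \<bullet> b" by simp
  qed
  then show "(LBINT x. V x *\<^sub>R grad \<phi> x) = - (LBINT x. \<phi> x *\<^sub>R g x)" by (simp add: eq_neg_iff_add_eq_0)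
qed

section \<open>The integral over a chord\<close>

text \<open>\<open>has_integral_Beta_real\<close> speaks of a gauge integral; as the integrand is
  nonnegative it converges absolutely and is a Lebesgue integral, also for singular
  exponents.\<close>

lemma integrable_Beta_real:
  fixes a b :: real
  assumes "-1 < a" "-1 < b"
  shows "integrable lborel (\<lambda>r. indicator {0<..<1} r * ((1 - r) powr a * r powr b))" (is "integrable _ ?f")
    and "(LBINT r. indicator {0<..<1} r * ((1 - r) powr a * r powr b)) = Beta (b + 1) (a + 1)"
proof -
  have "((\<lambda>t. t powr b * (1 - t) powr a) has_integral Beta (b + 1) (a + 1)) {0..1}"
    using has_integral_Beta_real[of "b + 1" "a + 1"] assms by simp
  then have "((\<lambda>r. (1 - r) powr a * r powr b) has_integral Beta (b + 1) (a + 1)) {0<..<1}"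
    by (simp add: has_integral_Icc_iff_Ioo mult.commute)
  then have h: "(?f has_integral Beta (b + 1) (a + 1)) UNIV"
    by (subst (asm) has_integral_restrict_UNIV[symmetric]) (simp add: indicator_def of_bool_def if_distrib if_distribR cong: if_cong)
  have "?f absolutely_integrable_on UNIV"
    by (rule nonnegative_absolutely_integrable_1) (use h in \<open>auto simp: integrable_on_def\<close>)
  then show i: "integrable lborel ?f"
    unfolding set_integrable_def by (simp add: integrable_completion)
  show "(LBINT r. ?f r) = Beta (b + 1) (a + 1)"
    using has_integral_integral_lborel[OF i] h has_integral_unique by blast
qed

text \<open>As 1 + r + x(1 - r) = (1 + x) + (1 - x) r, this is Euler's integral for Gauss's function
  F(-c, b + 1; a + b + 2; z) at z = -(1 - x)/(1 + x), up to a Beta value and the factor (1 +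
  x)^c.\<close>

definition euler_integral :: "real \<Rightarrow> real \<Rightarrow> real \<Rightarrow> real \<Rightarrow> real" where
  "euler_integral a b c x = (LBINT r. indicator {0<..<1} r * ((1 - r) powr a * r powr b) * (1 + r + x * (1 - r)) powr c)"

lemma euler_integral_base_bounds:
  fixes r x :: real
  assumes "0 < r" "r < 1" "\<bar>x\<bar> < 1"
  shows "1 - \<bar>x\<bar> \<le> 1 + r + x * (1 - r)" "1 + r + x * (1 - r) \<le> 2"
proof -
  have "\<bar>x * (1 - r)\<bar> \<le> \<bar>x\<bar> * 1" unfolding abs_mult by (intro mult_left_mono) (use assms in auto)
  then have "- (x * (1 - r)) \<le> \<bar>x\<bar> * 1" by (rule abs_le_D2)
  then show "1 - \<bar>x\<bar> \<le> 1 + r + x * (1 - r)" using assms by linarith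
  have "\<bar>x * (1 - r)\<bar> \<le> 1 * (1 - r)" unfolding abs_mult by (intro mult_mono) (use assms in auto)
  then have "x * (1 - r) \<le> 1 * (1 - r)" by (rule abs_le_D1)
  then show "1 + r + x * (1 - r) \<le> 2" by (simp add: algebra_simps)
qed

text \<open>A power is increasing or decreasing according to the sign of \<open>c\<close>; the sum
  of the two end values bounds it in both cases, so that dominations need no case
  distinction.\<close>

lemma powr_le_sum_bounds:
  fixes l u y c :: real
  assumes "0 < l" "l \<le> y" "y \<le> u"
  shows "y powr c \<le> l powr c + u powr c"
proof (cases "c \<ge> 0")
  case True
  then have "y powr c \<le> u powr c" using assms by (intro powr_mono2) auto
  then show ?thesis by (simp add: add_increasing)
next
  case False
  then have "y powr c \<le> l powr c" using assms by (intro powr_mono2') auto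
  then show ?thesis by (simp add: add_increasing2)
qed

lemma euler_integral_integrable:
  fixes a b c x :: real
  assumes "-1 < a" "-1 < b" "\<bar>x\<bar> < 1"
  shows "integrable lborel (\<lambda>r. indicator {0<..<1} r * ((1 - r) powr a * r powr b) * (1 + r + x * (1 - r)) powr c)"
proof (rule Bochner_Integration.integrable_bound)
  let ?w = "\<lambda>r::real. indicator {0<..<1} r * ((1 - r) powr a * r powr b) * ((1 - \<bar>x\<bar>) powr c + 2 powr c)"
  show "integrable lborel ?w" by (intro integrable_mult_left integrable_Beta_real assms)
  show "AE r in lborel. norm (indicator {0<..<1} r * ((1 - r) powr a * r powr b) * (1 + r + x * (1 - r)) powr c) \<le> norm (?w r)"
  proof (rule AE_I2)
    fix r :: real
    show "norm (indicator {0<..<1} r * ((1 - r) powr a * r powr b) * (1 + r + x * (1 - r)) powr c) \<le> norm (?w r)"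
    proof (cases "r \<in> {0<..<1}")
      case True
      then show ?thesis
        using powr_le_sum_bounds[of "1 - \<bar>x\<bar>" "1 + r + x * (1 - r)" 2 c] euler_integral_base_bounds[of r x] assms
        by (auto simp: abs_mult intro!: mult_left_mono)
    qed auto
  qed
qed measurable

text \<open>The base has \<open>x\<close>-derivative 1 - r, which raises the exponent
  \<open>a\<close> by one while \<open>c\<close> drops by one: the family is closed under
  differentiation.\<close>

lemma euler_integral_deriv:
  assumes ab: "-1 < a" "-1 < b" and x: "\<bar>x\<bar> < 1"
  shows "(euler_integral a b c has_real_derivative c * euler_integral (a + 1) b (c - 1) x) (at x)"
proof -
  \<comment> \<open>Half of the distance to 1: on the ball |y| stays below \<open>1 - e\<close>, so
    the base stays between \<open>e\<close> and 2.\<close>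
  define e where "e = (1 - \<bar>x\<bar>) / 2"
  have e: "0 < e" using x by (simp add: e_def)
  have ye: "\<bar>y\<bar> \<le> 1 - e" "\<bar>y\<bar> < 1" if "y \<in> ball x e" for y
  proof -
    have "\<bar>x - y\<bar> < e" using that by (simp add: dist_real_def)
    then have "\<bar>y\<bar> < \<bar>x\<bar> + e" by (simp add: abs_if split: if_splits)
    moreover have "\<bar>x\<bar> + e = 1 - e" by (simp add: e_def field_simps)
    ultimately show "\<bar>y\<bar> \<le> 1 - e" "\<bar>y\<bar> < 1" using e by auto
  qed
  let ?w = "\<lambda>r::real. indicator {0<..<1} r * ((1 - r) powr (a + 1) * r powr b) * (\<bar>c\<bar> * (e powr (c - 1) + 2 powr (c - 1)))"
  define f where "f y r = indicator {0<..<1} r * ((1 - r) powr a * r powr b) * (1 + r + y * (1 - r)) powr c" for y r :: real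
  define D where "D y r = c * (indicator {0<..<1} r * ((1 - r) powr (a + 1) * r powr b) * (1 + r + y * (1 - r)) powr (c - 1))" for y r :: real
  have "GDERIV (\<lambda>y. LBINT r. f y r) x :> (LBINT r. D x r)"
  proof (rule GDERIV_integral[of e x lborel f D ?w])
    show "0 < e" by (rule e)
    show "integrable lborel ?w" by (intro integrable_mult_left integrable_Beta_real) (use ab in auto)
    show "D x \<in> borel_measurable lborel" unfolding D_def by measurable
    fix y assume y: "y \<in> ball x e"
    show "integrable lborel (f y)"
      unfolding f_def by (rule euler_integral_integrable[OF ab ye(2)[OF y]])
    fix r :: real
    show "GDERIV (\<lambda>y. f y r) y :> D y r"
    proof (cases "r \<in> {0<..<1}")
      case True
      then have pos: "0 < 1 + r + y * (1 - r)" using euler_integral_base_bounds(1)[of r y] ye[OF y] by auto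
      have "((\<lambda>y. 1 + r + y * (1 - r)) has_real_derivative (1 - r)) (at y)"
        by (auto intro!: derivative_eq_intros)
      from DERIV_fun_powr[OF this pos, of c]
      have "((\<lambda>y. (1 - r) powr a * r powr b * (1 + r + y * (1 - r)) powr c) has_real_derivative
          (1 - r) powr a * r powr b * (c * (1 + r + y * (1 - r)) powr (c - 1) * (1 - r))) (at y)"
        by (intro DERIV_cmult) simp
      moreover have "(1 - r) powr (a + 1) = (1 - r) powr a * (1 - r)" using True by (simp add: powr_add)
      ultimately show ?thesis using True by (simp add: gderiv_deriv f_def D_def mult_ac)
    qed (simp add: f_def D_def GDERIV_const)
    show "norm (D y r) \<le> ?w r"
    proof (cases "r \<in> {0<..<1}")
      case True
      then have "(1 + r + y * (1 - r)) powr (c - 1) \<le> e powr (c - 1) + 2 powr (c - 1)"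
        using powr_le_sum_bounds[of e "1 + r + y * (1 - r)" 2 "c - 1"] euler_integral_base_bounds[of r y] ye[OF y] e by auto
      then have "\<bar>c\<bar> * ((1 - r) powr (a + 1) * r powr b) * (1 + r + y * (1 - r)) powr (c - 1)
         \<le> \<bar>c\<bar> * ((1 - r) powr (a + 1) * r powr b) * (e powr (c - 1) + 2 powr (c - 1))"
        by (intro mult_left_mono) auto
      then show ?thesis using True by (simp add: D_def abs_mult mult_ac)
    qed (simp add: D_def)
  qed
  moreover have "(LBINT r. D x r) = c * euler_integral (a + 1) b (c - 1) x" by (simp add: D_def euler_integral_def)
  ultimately show ?thesis by (simp add: gderiv_deriv euler_integral_def[abs_def] f_def)
qed

text \<open>On (0, 1) the combination of the three integrands is the exact
  \<open>r\<close>-derivative of \<open>-2 * p * P r\<close>. The boundary terms vanish because the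
  exponents p + 1 and 2 - 2p in \<open>P\<close> are positive.\<close>

lemma euler_integral_ode:
  fixes p x :: real
  assumes p: "0 < p" "p < 1" and x: "\<bar>x\<bar> < 1"
  shows "(1 - x\<^sup>2) * (p * (p - 1) * euler_integral (p + 2) (1 - 2 * p) (p - 2) x)
     - (4 - 2 * p + 2 * x) * (p * euler_integral (p + 1) (1 - 2 * p) (p - 1) x)
     + p * (p + 1) * euler_integral p (1 - 2 * p) p x = 0"
proof -
  define h where "h a c r = indicator {0<..<1} r * ((1 - r) powr a * r powr (1 - 2 * p)) * (1 + r + x * (1 - r)) powr c" for a c r :: real
  define P where "P r = (1 - r) powr (p + 1) * r powr (2 - 2 * p) * (1 + r + x * (1 - r)) powr (p - 1)" for r
  define D where "D r = (1 - x\<^sup>2) * (p * (p - 1) * h (p + 2) (p - 2) r) - (4 - 2 * p + 2 * x) * (p * h (p + 1) (p - 1) r)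
     + p * (p + 1) * h p p r" for r
  have int: "integrable lborel (h a c)" if "a > -1" for a c
    unfolding h_def by (rule euler_integral_integrable) (use that p x in auto)
  have "(LBINT r. D r) = (1 - x\<^sup>2) * (p * (p - 1) * euler_integral (p + 2) (1 - 2 * p) (p - 2) x)
     - (4 - 2 * p + 2 * x) * (p * euler_integral (p + 1) (1 - 2 * p) (p - 1) x)
     + p * (p + 1) * euler_integral p (1 - 2 * p) p x"
    unfolding D_def euler_integral_def using int p by (simp add: h_def[symmetric])
  moreover have "(LBINT r. D r) = 0"
  proof -
    have iD: "integrable lborel D" unfolding D_def using int p by simp
    have "((\<lambda>r. D r) has_integral (-2 * p * P 1) - (-2 * p * P 0)) {0..1}"
    proof (rule fundamental_theorem_of_calculus_interior)
      have pos: "1 + r + x * (1 - r) > 0" if "r \<in> {0..1}" for r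
      proof (cases "r = 0 \<or> r = 1")
        case True
        then show ?thesis using x by auto
      next
        case False
        then show ?thesis using that euler_integral_base_bounds(1)[of r x] x by auto
      qed
      have c1: "continuous_on {0..1} (\<lambda>r::real. (1 - r) powr (p + 1))"
        using p by (intro continuous_on_powr' continuous_intros) auto
      have c2: "continuous_on {0..1} (\<lambda>r::real. r powr (2 - 2 * p))"
        using p by (intro continuous_on_powr' continuous_intros) auto
      have c3: "continuous_on {0..1} (\<lambda>r::real. (1 + r + x * (1 - r)) powr (p - 1))"
        by (intro continuous_on_powr' continuous_intros) (use pos in force)+
      show "continuous_on {0..1} (\<lambda>r. -2 * p * P r)" unfolding P_def
        by (intro continuous_on_mult continuous_on_const c1 c2 c3)
      fix r :: real assume r: "r \<in> {0<..<1}"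
      \<comment> \<open>The lowest powers that occur. Every other power is one of these times a
        polynomial, so the claim reduces to a polynomial identity multiplied by
        \<open>S * T * Q\<close>.\<close>
      define S T Q where "S = (1 - r) powr p" and "T = r powr (1 - 2 * p)" and "Q = (1 + r + x * (1 - r)) powr (p - 2)"
      define B where "B = 1 + r + x * (1 - r)"
      have B: "0 < B" unfolding B_def using r euler_integral_base_bounds(1)[of r x] x by auto
      have e1: "(1 - r) powr (p + 1) = S * (1 - r)" "(1 - r) powr (p + 2) = S * (1 - r)\<^sup>2"
        using r by (simp_all add: S_def powr_add powr_numeral)
      have e2: "r powr (2 - 2 * p) = T * r"
        using r powr_add[of r "1 - 2 * p" 1] by (simp add: T_def)
      have e3: "B powr (p - 1) = Q * B" "B powr p = Q * B\<^sup>2"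
        using B powr_add[of B "p - 2" 1] powr_add[of B "p - 2" 2] by (simp_all add: Q_def B_def[symmetric] powr_numeral)
      have "((\<lambda>r. 1 - r) has_real_derivative -1) (at r)" by (auto intro!: derivative_eq_intros)
      from DERIV_fun_powr[OF this, of "p + 1"] r
      have d1: "((\<lambda>r. (1 - r) powr (p + 1)) has_real_derivative -((p + 1) * S)) (at r)" by (simp add: S_def)
      have d2: "((\<lambda>r. r powr (2 - 2 * p)) has_real_derivative (2 - 2 * p) * T) (at r)"
        using has_real_derivative_powr[of r "2 - 2 * p"] r by (simp add: T_def algebra_simps)
      have "((\<lambda>r. 1 + r + x * (1 - r)) has_real_derivative (1 - x)) (at r)" by (auto intro!: derivative_eq_intros)
      from DERIV_fun_powr[OF this, of "p - 1"] B
      have d3: "((\<lambda>r. (1 + r + x * (1 - r)) powr (p - 1)) has_real_derivative (p - 1) * Q * (1 - x)) (at r)"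
        by (simp add: Q_def B_def)
      have "((\<lambda>r. -2 * p * P r) has_real_derivative D r) (at r)"
        unfolding P_def
      proof (rule DERIV_cong[OF DERIV_cmult[OF DERIV_mult[OF DERIV_mult[OF d1 d2] d3]]])
        have x': "x * (1 - r) = B - 1 - r" by (simp add: B_def)
        have "D r = S * T * Q * ((1 - x\<^sup>2) * (p * (p - 1) * (1 - r)\<^sup>2) - (4 - 2 * p + 2 * x) * (p * (1 - r) * B) + p * (p + 1) * B\<^sup>2)"
          unfolding D_def h_def using r
          by (simp add: e1 e3 B_def[symmetric] S_def[symmetric] T_def[symmetric] Q_def[folded B_def, symmetric]) (simp add: algebra_simps)
        also have "\<dots> = S * T * Q * (-2 * p * (-(p + 1) * r * B + (2 - 2 * p) * (1 - r) * B + (1 - r) * r * (p - 1) * (1 - x)))"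
          unfolding B_def by (simp add: power2_eq_square algebra_simps)
        finally show "-2 * p * ((-((p + 1) * S) * r powr (2 - 2 * p) + (2 - 2 * p) * T * (1 - r) powr (p + 1)) * (1 + r + x * (1 - r)) powr (p - 1) + (p - 1) * Q * (1 - x) * ((1 - r) powr (p + 1) * r powr (2 - 2 * p))) = D r"
          by (simp add: e1 e2 e3 B_def[symmetric]) (simp add: algebra_simps)
      qed
      then show "((\<lambda>r. -2 * p * P r) has_vector_derivative D r) (at r)"
        by (simp add: has_real_derivative_iff_has_vector_derivative)
    qed simp
    moreover have "P 1 = 0" "P 0 = 0" using p by (simp_all add: P_def)
    ultimately have "(D has_integral 0) {0..1}" by simp
    moreover have "D r = 0" if "r \<notin> {0..1}" for r using that by (auto simp: D_def h_def)
    ultimately have "(D has_integral 0) UNIV" using has_integral_on_superset[of D 0 "{0..1}" UNIV] by auto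
    then show ?thesis using has_integral_integral_lborel[OF iD] has_integral_unique by blast
  qed
  ultimately show ?thesis by simp
qed

text \<open>\<open>half_chord p x\<close> is \<open>\<integral>\<^bsub>x\<^esub>\<^bsup>1\<^esup> (1 - z\<^sup>2)\<^sup>p (z - x)\<^bsup>1-2p\<^esup> dz\<close>, rescaled to \<open>(0, 1)\<close> so that it can be
  differentiated in \<open>x\<close> under the integral sign.\<close>

definition half_chord :: "real \<Rightarrow> real \<Rightarrow> real" where
  "half_chord p x = (1 - x) powr (2 - p) * euler_integral p (1 - 2 * p) p x"

text \<open>The product rule with the factor (1 - x)^(2-p) turns \<open>euler_integral_ode\<close>
  into Gegenbauer's equation of degree 2 with parameter p - 3/2, whose polynomial solution is a
  multiple of 1 - (2p - 1) x^2.\<close>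

lemma half_chord_ode:
  fixes p :: real
  assumes p: "0 < p" "p < 1"
  obtains U1 U2 where
    "\<And>x. \<bar>x\<bar> < 1 \<Longrightarrow> (half_chord p has_real_derivative U1 x) (at x)"
    "\<And>x. \<bar>x\<bar> < 1 \<Longrightarrow> (U1 has_real_derivative U2 x) (at x)"
    "\<And>x. \<bar>x\<bar> < 1 \<Longrightarrow> (1 - x\<^sup>2) * U2 x + (2 - 2 * p) * x * U1 x + (4 * p - 2) * half_chord p x = 0"
proof -
  define H where "H = euler_integral p (1 - 2 * p) p"
  define H1 where "H1 x = p * euler_integral (p + 1) (1 - 2 * p) (p - 1) x" for x
  define H2 where "H2 x = p * (p - 1) * euler_integral (p + 2) (1 - 2 * p) (p - 2) x" for x
  have H: "(H has_real_derivative H1 x) (at x)" if "\<bar>x\<bar> < 1" for x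
    unfolding H_def H1_def by (rule euler_integral_deriv) (use p that in auto)
  have "(euler_integral (p + 1) (1 - 2 * p) (p - 1) has_real_derivative (p - 1) * euler_integral (p + 1 + 1) (1 - 2 * p) (p - 1 - 1) x) (at x)"
    if "\<bar>x\<bar> < 1" for x by (rule euler_integral_deriv) (use p that in auto)
  then have H1: "(H1 has_real_derivative H2 x) (at x)" if "\<bar>x\<bar> < 1" for x
    unfolding H1_def[abs_def] by (rule DERIV_cong[OF DERIV_cmult]) (use that in \<open>auto simp: H2_def algebra_simps\<close>)
  have ode: "(1 - x\<^sup>2) * H2 x - (4 - 2 * p + 2 * x) * H1 x + p * (p + 1) * H x = 0" if "\<bar>x\<bar> < 1" for x
    unfolding H_def H1_def H2_def by (rule euler_integral_ode[OF p that])
  define U1 where "U1 x = (1 - x) powr (1 - p) * ((1 - x) * H1 x - (2 - p) * H x)" for x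
  define U2 where "U2 x = (1 - x) powr (- p) * ((1 - x)\<^sup>2 * H2 x - 2 * (2 - p) * (1 - x) * H1 x + (2 - p) * (1 - p) * H x)" for x
  have pw: "(1 - x) powr (1 - p) = (1 - x) powr (- p) * (1 - x)"
       "(1 - x) powr (2 - p) = (1 - x) powr (- p) * (1 - x)\<^sup>2" if "\<bar>x\<bar> < 1" for x
    using that powr_add[of "1 - x" "-p" 1] powr_add[of "1 - x" "-p" 2] by (auto simp: powr_numeral)
  have dp: "((\<lambda>x. (1 - x) powr s) has_real_derivative - (s * (1 - x) powr (s - 1))) (at x)" if "\<bar>x\<bar> < 1" for x s
  proof -
    have "((\<lambda>x. 1 - x) has_real_derivative -1) (at x)" by (auto intro!: derivative_eq_intros)
    from DERIV_fun_powr[OF this, of s] that show ?thesis by auto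
  qed
  show thesis
  proof
    fix x :: real assume x: "\<bar>x\<bar> < 1"
    show "(half_chord p has_real_derivative U1 x) (at x)"
      unfolding half_chord_def[abs_def] H_def[symmetric]
      by (rule DERIV_cong[OF DERIV_mult[OF dp[OF x] H[OF x]]])
         (simp add: U1_def pw[OF x] power2_eq_square algebra_simps)
    have "((\<lambda>x. (1 - x) * H1 x - (2 - p) * H x) has_real_derivative (1 - x) * H2 x - (3 - p) * H1 x) (at x)"
      by (auto intro!: derivative_eq_intros H[OF x] H1[OF x] simp: algebra_simps)
    from DERIV_mult[OF dp[OF x] this]
    show "(U1 has_real_derivative U2 x) (at x)"
      unfolding U1_def[abs_def]
      by (rule DERIV_cong) (simp add: U2_def pw[OF x] power2_eq_square algebra_simps)
    \<comment> \<open>With all powers of 1 - x reduced to this one, the remaining identity is linear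
      in \<open>H x\<close>, \<open>H1 x\<close>, \<open>H2 x\<close> with polynomial
      coefficients.\<close>
    define a where "a = (1 - x) powr (- p)"
    have "(1 - x\<^sup>2) * U2 x + (2 - 2 * p) * x * U1 x + (4 * p - 2) * half_chord p x
      = a * (1 - x)\<^sup>2 * ((1 - x\<^sup>2) * H2 x - (4 - 2 * p + 2 * x) * H1 x + p * (p + 1) * H x)"
      unfolding U2_def U1_def half_chord_def pw[OF x] a_def[symmetric] H_def[symmetric]
      by (simp add: power2_eq_square algebra_simps)
    then show "(1 - x\<^sup>2) * U2 x + (2 - 2 * p) * x * U1 x + (4 * p - 2) * half_chord p x = 0"
      using ode[OF x] by simp
  qed
qed

text \<open>At the midpoint the integrand is (1 - r^2)^p r^(1-2p). The substitution s = r^2 makes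
  twice the integral the Beta value at (1 - p, 1 + p), and Gamma(2) = 1.\<close>

lemma half_chord_0:
  fixes p :: real
  assumes p: "0 < p" "p < 1"
  shows "2 * half_chord p 0 = Gamma (1 + p) * Gamma (1 - p)"
proof -
  let ?f = "\<lambda>s::real. (1 - s) powr p * s powr (- p)"
  let ?b = "\<lambda>r::real. (1 - r) powr p * r powr (1 - 2 * p)"
  \<comment> \<open>The substitution rule wants closed intervals written as images. The end points
    contribute nothing, since \<open>0 powr _\<close> is 0.\<close>
  have Icc: "(LBINT s. indicator {0<..<1} s * ?f s) = (LBINT s. ?f s * indicator {(0::real)\<^sup>2..1\<^sup>2} s)"
    by (rule Bochner_Integration.integral_cong) (use p in \<open>auto simp: indicator_def\<close>)
  have i: "integrable lborel (\<lambda>s::real. indicator {0<..<1} s * ?f s)"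
    using integrable_Beta_real(1)[of p "-p"] p by simp
  have "set_integrable lborel {(0::real)\<^sup>2..1\<^sup>2} ?f"
    unfolding set_integrable_def
    by (rule iffD1[OF Bochner_Integration.integrable_cong[OF refl] i]) (use p in \<open>auto simp: indicator_def\<close>)
  then have "(LBINT s. ?f s * indicator {(0::real)\<^sup>2..1\<^sup>2} s) = (LBINT r. ?f (r\<^sup>2) * (2 * r) * indicator {0..1} r)"
    by (rule integral_substitution[where g = "\<lambda>r. r\<^sup>2"]) (auto intro!: derivative_eq_intros continuous_intros)
  also have "\<dots> = (LBINT r. 2 * (indicator {0<..<1} r * ?b r * (1 + r + 0 * (1 - r)) powr p))"
  proof (rule Bochner_Integration.integral_cong[OF refl])
    fix r :: real
    show "?f (r\<^sup>2) * (2 * r) * indicator {0..1} r = 2 * (indicator {0<..<1} r * ?b r * (1 + r + 0 * (1 - r)) powr p)"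
    proof (cases "r \<in> {0<..<1}")
      case True
      have "(1 - r\<^sup>2) powr p = (1 - r) powr p * (1 + r) powr p"
        using True by (subst powr_mult[symmetric]) (auto simp: power2_eq_square algebra_simps)
      moreover have "(r\<^sup>2) powr (- p) * r = r powr (1 - 2 * p)"
      proof -
        have "r\<^sup>2 = r powr 2" using True by simp
        then have "(r\<^sup>2) powr (- p) = r powr (2 * (- p))" by (simp only: powr_powr)
        then show ?thesis using True powr_add[of r "2 * (-p)" 1] by simp
      qed
      moreover have "?f (r\<^sup>2) * (2 * r) = (1 - r\<^sup>2) powr p * ((r\<^sup>2) powr (- p) * r) * 2" by (simp only: mult_ac)
      ultimately have "?f (r\<^sup>2) * (2 * r) = 2 * (?b r * (1 + r) powr p)" by (simp only: mult_ac)
      then show ?thesis using True by simp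
    qed (use p in \<open>auto simp: indicator_def\<close>)
  qed
  also have "\<dots> = 2 * euler_integral p (1 - 2 * p) p 0" by (simp add: euler_integral_def)
  finally have "2 * half_chord p 0 = (LBINT s. indicator {0<..<1} s * ?f s)" by (simp add: Icc half_chord_def)
  also have "\<dots> = Beta (1 - p) (p + 1)" using integrable_Beta_real(2)[of p "-p"] p by simp
  also have "\<dots> = Gamma (1 + p) * Gamma (1 - p)"
    by (simp add: Beta_def add.commute mult.commute Gamma_numeral[of "Num.Bit0 Num.One", simplified])
  finally show ?thesis .
qed

lemma chord_quadratic:
  fixes p x :: real
  assumes p: "0 < p" "p < 1" and x: "\<bar>x\<bar> < 1"
  shows "half_chord p x + half_chord p (- x) = Gamma (1 + p) * Gamma (1 - p) * (1 - (2 * p - 1) * x\<^sup>2)"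
proof -
  obtain U1 U2 where U1: "\<And>x. \<bar>x\<bar> < 1 \<Longrightarrow> (half_chord p has_real_derivative U1 x) (at x)"
    and U2: "\<And>x. \<bar>x\<bar> < 1 \<Longrightarrow> (U1 has_real_derivative U2 x) (at x)"
    and ode: "\<And>x. \<bar>x\<bar> < 1 \<Longrightarrow> (1 - x\<^sup>2) * U2 x + (2 - 2 * p) * x * U1 x + (4 * p - 2) * half_chord p x = 0"
    using half_chord_ode[OF p] by blast
  define j where "j x = half_chord p x + half_chord p (- x)" for x
  define j1 where "j1 x = U1 x - U1 (- x)" for x
  define j2 where "j2 x = U2 x + U2 (- x)" for x
  define c where "c = 2 * p - 1"
  define Q where "Q x = 1 - c * x\<^sup>2" for x :: real
  \<comment> \<open>The Wronskian of \<open>j\<close> and \<open>Q\<close> times the integrating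
    factor (1 - x^2)^(p-1) given by Abel's formula. It is constant, and it is 0 at the origin
    because \<open>j1\<close> and the derivative of \<open>Q\<close> are odd.\<close>
  define Z where "Z x = (j x * (- 2 * c * x) - j1 x * Q x) * (1 - x\<^sup>2) powr (p - 1)" for x
  have neg: "(uminus has_real_derivative -1) (at y)" for y :: real by (auto intro!: derivative_eq_intros)
  have dj: "(j has_real_derivative j1 x) (at x)" if "\<bar>x\<bar> < 1" for x
    using DERIV_add[OF U1[OF that] DERIV_chain2[OF U1[of "- x"] neg]] that
    by (simp add: j_def[abs_def] j1_def)
  have dj1: "(j1 has_real_derivative j2 x) (at x)" if "\<bar>x\<bar> < 1" for x
    using DERIV_diff[OF U2[OF that] DERIV_chain2[OF U2[of "- x"] neg]] that
    by (simp add: j1_def[abs_def] j2_def)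
  have jode: "(1 - x\<^sup>2) * j2 x + (2 - 2 * p) * x * j1 x + (4 * p - 2) * j x = 0" if "\<bar>x\<bar> < 1" for x
    using ode[OF that] ode[of "- x"] that by (simp add: j2_def j1_def j_def algebra_simps)
  have dQ: "(Q has_real_derivative (- 2 * c * x)) (at x)" for x
    unfolding Q_def[abs_def] by (auto intro!: derivative_eq_intros)
  have x2: "x\<^sup>2 < 1" if "\<bar>x\<bar> < 1" for x :: real using that by (simp add: abs_square_less_1)
  have c: "\<bar>c\<bar> < 1" using p by (auto simp: c_def abs_if)
  \<comment> \<open>As |2p - 1| < 1, \<open>Q\<close> has no zero in (-1, 1); a vanishing Wronskian
    therefore makes the quotient \<open>j x / Q x\<close> constant.\<close>
  have Qpos: "Q x > 0" if "\<bar>x\<bar> < 1" for x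
  proof -
    have "\<bar>c\<bar> * \<bar>x\<^sup>2\<bar> < 1 * 1" using c x2[OF that] by (intro mult_strict_mono') auto
    then have "c * x\<^sup>2 < 1" using abs_ge_self[of "c * x\<^sup>2"] unfolding abs_mult by linarith
    then show ?thesis by (simp add: Q_def)
  qed
  have dZ: "(Z has_real_derivative 0) (at x)" if x: "\<bar>x\<bar> < 1" for x
  proof -
    let ?P = "(1 - x\<^sup>2) powr (p - 2)"
    have P: "(1 - x\<^sup>2) powr (p - 1) = ?P * (1 - x\<^sup>2)"
      using powr_add[of "1 - x\<^sup>2" "p - 2" 1] x2[OF x] by simp
    have "((\<lambda>x. 1 - x\<^sup>2) has_real_derivative - 2 * x) (at x)" by (auto intro!: derivative_eq_intros)
    from DERIV_fun_powr[OF this, of "p - 1"] x2[OF x]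
    have d1: "((\<lambda>x. (1 - x\<^sup>2) powr (p - 1)) has_real_derivative (p - 1) * ?P * (- 2 * x)) (at x)" by simp
    have d2: "((\<lambda>x. j x * (- 2 * c * x) - j1 x * Q x) has_real_derivative j x * (- 2 * c) - j2 x * Q x) (at x)"
      by (auto intro!: derivative_eq_intros dj[OF x] dj1[OF x] dQ simp: algebra_simps)
    have "(j x * (- 2 * c) - j2 x * Q x) * (1 - x\<^sup>2) + (p - 1) * (- 2 * x) * (j x * (- 2 * c * x) - j1 x * Q x)
       = - Q x * ((1 - x\<^sup>2) * j2 x + (2 - 2 * p) * x * j1 x + (4 * p - 2) * j x)"
      unfolding Q_def c_def by (simp add: power2_eq_square algebra_simps)
    also have "\<dots> = 0" using jode[OF x] by simp
    finally have "?P * ((j x * (- 2 * c) - j2 x * Q x) * (1 - x\<^sup>2) + (p - 1) * (- 2 * x) * (j x * (- 2 * c * x) - j1 x * Q x)) = 0"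
      by simp
    then show ?thesis unfolding Z_def[abs_def]
      by (intro DERIV_cong[OF DERIV_mult[OF d2 d1]]) (simp add: P algebra_simps)
  qed
  have Z0: "Z x = 0" if "\<bar>x\<bar> < 1" for x
  proof -
    have "Z x = Z 0" by (rule DERIV_isconst3[of "-1" 1]) (use dZ that in auto)
    also have "\<dots> = 0" by (simp add: Z_def j1_def)
    finally show ?thesis .
  qed
  have W: "j x * (- 2 * c * x) = j1 x * Q x" if "\<bar>x\<bar> < 1" for x
    using that x2[OF that] Z0[OF that] by (simp add: Z_def)
  have "((\<lambda>x. j x / Q x) has_real_derivative 0) (at x)" if "\<bar>x\<bar> < 1" for x
    by (rule DERIV_cong[OF DERIV_divide[OF dj[OF that] dQ]]) (use Qpos[OF that] W[OF that] in auto)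
  then have "j x / Q x = j 0 / Q 0"
    by (intro DERIV_isconst3[of "-1" 1 x 0 "\<lambda>x. j x / Q x"]) (use x in auto)
  then have "j x = j 0 * Q x" using Qpos[OF x] by (simp add: Q_def field_simps)
  then show ?thesis using half_chord_0[OF p] by (simp add: j_def Q_def c_def)
qed

text \<open>The chord [-b, a] is mapped affinely to [-1, 1]: \<open>L\<close> is its half length and
  \<open>x\<close> the new position of the base point, so that a = L(1 - x) and b = L(1 +
  x).\<close>

lemma nn_integral_half_chord:
  fixes p a b :: real
  assumes p: "0 < p" "p < 1" and ab: "0 < a" "0 < b"
  shows "(\<integral>\<^sup>+r. ennreal (indicator {0<..<a} r * (((a - r) * (r + b)) powr p * r powr (1 - 2 * p))) \<partial>lborel)
    = ennreal (((a + b) / 2)\<^sup>2 * half_chord p ((b - a) / (a + b)))"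
proof -
  define L x where "L = (a + b) / 2" and "x = (b - a) / (a + b)"
  have L: "0 < L" using ab by (simp add: L_def)
  have x: "\<bar>x\<bar> < 1" using ab by (simp add: x_def abs_if field_simps)
  have aL: "a = L * (1 - x)" and bL: "b = L * (1 + x)"
    using ab by (simp_all add: L_def x_def field_simps)
  let ?h = "\<lambda>r. indicator {0<..<1} r * ((1 - r) powr p * r powr (1 - 2 * p)) * (1 + r + x * (1 - r)) powr p"
  have "(\<integral>\<^sup>+r. ennreal (indicator {0<..<a} r * (((a - r) * (r + b)) powr p * r powr (1 - 2 * p))) \<partial>lborel)
     = ennreal \<bar>a\<bar> * (\<integral>\<^sup>+r. ennreal (indicator {0<..<a} (0 + a * r) * (((a - (0 + a * r)) * ((0 + a * r) + b)) powr p * (0 + a * r) powr (1 - 2 * p))) \<partial>lborel)"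
    by (rule nn_integral_real_affine) (use ab in auto)
  also have "(\<integral>\<^sup>+r. ennreal (indicator {0<..<a} (0 + a * r) * (((a - (0 + a * r)) * ((0 + a * r) + b)) powr p * (0 + a * r) powr (1 - 2 * p))) \<partial>lborel)
     = (\<integral>\<^sup>+r. ennreal (a powr (1 - p) * L powr p * ?h r) \<partial>lborel)"
  proof (intro nn_integral_cong arg_cong[where f = ennreal])
    fix r :: real
    show "indicator {0<..<a} (0 + a * r) * (((a - (0 + a * r)) * ((0 + a * r) + b)) powr p * (0 + a * r) powr (1 - 2 * p))
       = a powr (1 - p) * L powr p * ?h r"
    proof (cases "r \<in> {0<..<1}")
      case True
      have B: "0 < 1 + r + x * (1 - r)" using euler_integral_base_bounds(1)[of r x] True x by auto
      have "(a - a * r) * (a * r + b) = (a * (1 - r)) * (L * (1 + r + x * (1 - r)))"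
        unfolding bL by (subst (2) aL) (simp add: algebra_simps)
      then have "((a - a * r) * (a * r + b)) powr p = (a powr p * (1 - r) powr p) * (L powr p * (1 + r + x * (1 - r)) powr p)"
        using True ab L B by (simp add: powr_mult)
      moreover have "(a * r) powr (1 - 2 * p) = a powr (1 - 2 * p) * r powr (1 - 2 * p)"
        using True ab by (simp add: powr_mult)
      moreover have "a powr (1 - p) = a powr p * a powr (1 - 2 * p)"
        by (simp flip: powr_add)
      ultimately show ?thesis using True ab by (simp add: mult_ac)
    next
      case False
      then show ?thesis using ab by (auto simp: indicator_def zero_less_mult_iff)
    qed
  qed
  also have "\<dots> = ennreal (LBINT r. a powr (1 - p) * L powr p * ?h r)"
  proof (rule nn_integral_eq_integral)
    show "integrable lborel (\<lambda>r. a powr (1 - p) * L powr p * ?h r)"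
      by (intro integrable_mult_right euler_integral_integrable) (use p x in auto)
  qed (simp add: indicator_def)
  also have "(LBINT r. a powr (1 - p) * L powr p * ?h r) = a powr (1 - p) * L powr p * euler_integral p (1 - 2 * p) p x"
    by (simp add: euler_integral_def)
  also have "ennreal \<bar>a\<bar> * ennreal (a powr (1 - p) * L powr p * euler_integral p (1 - 2 * p) p x)
      = ennreal (a * (a powr (1 - p) * L powr p * euler_integral p (1 - 2 * p) p x))"
    using ab by (simp add: ennreal_mult')
  \<comment> \<open>Homogeneity: the integrand has degree 2p + (1 - 2p) in the length, and dr adds
    one more, whence the square of \<open>L\<close>.\<close>
  also have "a * (a powr (1 - p) * L powr p * euler_integral p (1 - 2 * p) p x) = L\<^sup>2 * half_chord p x"
  proof -
    have "a * a powr (1 - p) = a powr (2 - p)" using ab powr_add[of a 1 "1 - p"] by simp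
    also have "\<dots> = L powr (2 - p) * (1 - x) powr (2 - p)" using L x by (subst aL) (simp add: powr_mult)
    finally have "a * a powr (1 - p) * L powr p = (L powr (2 - p) * L powr p) * (1 - x) powr (2 - p)" by simp
    also have "L powr (2 - p) * L powr p = L\<^sup>2" using L by (simp flip: powr_add)
    finally show ?thesis by (simp add: half_chord_def mult_ac)
  qed
  finally show ?thesis by (simp add: L_def x_def)
qed

lemma half_chord_nonneg: "0 \<le> half_chord p x"
  unfolding half_chord_def euler_integral_def by (intro mult_nonneg_nonneg Bochner_Integration.integral_nonneg) (auto simp: indicator_def)

text \<open>Exchanging \<open>a\<close> and \<open>b\<close> changes the sign of the relative
  position, so the two halves add up to the even combination of
  \<open>chord_quadratic\<close>.\<close>

lemma nn_integral_chord:
  fixes p a b :: real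
  assumes p: "0 < p" "p < 1" and ab: "0 < a" "0 < b"
  shows "(\<integral>\<^sup>+r. ennreal (indicator {0<..<a} r * (((a - r) * (r + b)) powr p * r powr (1 - 2 * p))) \<partial>lborel)
     + (\<integral>\<^sup>+r. ennreal (indicator {0<..<b} r * (((b - r) * (r + a)) powr p * r powr (1 - 2 * p))) \<partial>lborel)
    = ennreal (Gamma (1 + p) * Gamma (1 - p) * ((a + b)\<^sup>2 - (2 * p - 1) * (a - b)\<^sup>2) / 4)"
proof -
  define x where "x = (b - a) / (a + b)"
  have x: "\<bar>x\<bar> < 1" using ab by (simp add: x_def abs_if field_simps)
  have mx: "(a - b) / (a + b) = - x" unfolding x_def by (simp only: minus_divide_left minus_diff_eq)
  have "ennreal (((a + b) / 2)\<^sup>2 * half_chord p x) + ennreal (((b + a) / 2)\<^sup>2 * half_chord p (- x))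
     = ennreal (((a + b) / 2)\<^sup>2 * (half_chord p x + half_chord p (- x)))"
    by (simp add: ennreal_plus[symmetric] half_chord_nonneg add.commute[of b a] distrib_left del: ennreal_plus)
  also have "((a + b) / 2)\<^sup>2 * (half_chord p x + half_chord p (- x))
      = Gamma (1 + p) * Gamma (1 - p) * ((a + b)\<^sup>2 - (2 * p - 1) * ((a + b)\<^sup>2 * x\<^sup>2)) / 4"
    unfolding chord_quadratic[OF p x] by (simp add: power_divide field_simps)
  also have "(a + b)\<^sup>2 * x\<^sup>2 = (a - b)\<^sup>2"
    using ab by (simp add: x_def power_divide power2_commute)
  finally show ?thesis
    using nn_integral_half_chord[OF p ab] nn_integral_half_chord[OF p ab(2,1)]
    by (simp add: mx x_def[symmetric] add.commute[of b a])
qed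

section \<open>Polar coordinates and the Riesz potential of a ball profile\<close>

lemma borel_cball [measurable]: "cball (x::'a::metric_space) e \<in> sets borel"
  by (rule borel_closed[OF closed_cball])

lemma nn_integral_lborel_swap:
  fixes f :: "'a::euclidean_space \<Rightarrow> 'b::euclidean_space \<Rightarrow> ennreal"
  assumes "case_prod f \<in> borel_measurable (borel \<Otimes>\<^sub>M borel)"
  shows "(\<integral>\<^sup>+y. (\<integral>\<^sup>+x. f x y \<partial>lborel) \<partial>lborel) = (\<integral>\<^sup>+x. (\<integral>\<^sup>+y. f x y \<partial>lborel) \<partial>lborel)"
proof (rule lborel_pair.Fubini')
  show "case_prod f \<in> borel_measurable (lborel \<Otimes>\<^sub>M lborel)"
    using assms by (simp add: measurable_cong_sets[OF sets_pair_measure_cong[OF sets_lborel sets_lborel] refl])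
qed

lemma nn_integral_scaleR:
  fixes F :: "'a::euclidean_space \<Rightarrow> ennreal"
  assumes [measurable]: "F \<in> borel_measurable borel" and c: "c \<noteq> 0"
  shows "(\<integral>\<^sup>+x. F x \<partial>lborel) = ennreal (\<bar>c\<bar> ^ DIM('a)) * (\<integral>\<^sup>+x. F (c *\<^sub>R x) \<partial>lborel)"
proof -
  have "(\<integral>\<^sup>+x. F x \<partial>lborel) = (\<integral>\<^sup>+x. F x \<partial>density (distr lborel borel (\<lambda>x::'a. 0 + c *\<^sub>R x)) (\<lambda>_. ennreal (\<bar>c\<bar> ^ DIM('a))))"
    using lborel_affine[OF c, where t = "0::'a"] by simp
  also have "\<dots> = ennreal (\<bar>c\<bar> ^ DIM('a)) * (\<integral>\<^sup>+x. F (c *\<^sub>R x) \<partial>lborel)"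
    by (subst nn_integral_density) (auto simp: nn_integral_distr nn_integral_cmult)
  finally show ?thesis .
qed

lemma nn_integral_inverse_power:
  assumes d: "0 < d" and c: "0 < (c::real)"
  shows "(\<integral>\<^sup>+r. ennreal (1 / r ^ Suc d) * indicator {c..} r \<partial>lborel) = ennreal (1 / (d * c ^ d))"
proof -
  have "(\<integral>\<^sup>+r. ennreal (1 / r ^ Suc d) * indicator {c..} r \<partial>lborel) = ennreal (0 - (- 1 / (d * c ^ d)))"
  proof (rule nn_integral_FTC_atLeast)
    fix r :: real assume "c \<le> r"
    then have r: "0 < r" using c by simp
    have "((\<lambda>r. inverse (r ^ d)) has_real_derivative - (inverse (r ^ d) * (real d * r ^ (d - 1)) * inverse (r ^ d))) (at r)"
      using r by (auto intro!: derivative_eq_intros)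
    from DERIV_cmult[OF this, of "- 1 / d"]
    have "((\<lambda>r. - 1 / (d * r ^ d)) has_real_derivative (- 1 / d) * - (inverse (r ^ d) * (real d * r ^ (d - 1)) * inverse (r ^ d))) (at r)"
      by (simp add: field_simps)
    moreover have "r ^ d = r * r ^ (d - 1)" using d by (cases d) auto
    ultimately show "((\<lambda>r. - 1 / (d * r ^ d)) has_real_derivative 1 / r ^ Suc d) (at r)"
      using r d by (elim DERIV_cong) (simp add: field_simps)
    show "0 \<le> 1 / r ^ Suc d" using r by simp
  next
    have "filterlim (\<lambda>r::real. d * r ^ d) at_top at_top"
      using d by (intro filterlim_tendsto_pos_mult_at_top[OF tendsto_const] filterlim_pow_at_top filterlim_ident) auto
    then show "((\<lambda>r::real. - 1 / (d * r ^ d)) \<longlongrightarrow> 0) at_top"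
      by (intro tendsto_divide_0[OF tendsto_const] filterlim_at_top_imp_at_infinity)
  qed measurable
  then show ?thesis by simp
qed

text \<open>Polar coordinates without a sphere measure: with \<open>z\<close> in the unit ball and weight \<open>|z|\<^sup>d\<close>, the
  radial integral over \<open>r z\<close> is scale invariant, and \<open>\<integral> |w/r|\<^sup>d 1\<^bsub>|w| \<le> r\<^esub> dr/r = 1/d\<close>.\<close>

lemma nn_integral_polar:
  fixes F :: "'a::euclidean_space \<Rightarrow> ennreal"
  assumes [measurable]: "F \<in> borel_measurable borel"
  shows "(\<integral>\<^sup>+w. F w \<partial>lborel) = of_nat DIM('a) *
    (\<integral>\<^sup>+z. indicator (cball 0 1) z * ennreal (norm z ^ DIM('a)) *
      (\<integral>\<^sup>+r. indicator {0<..} r * ennreal (r ^ (DIM('a) - 1)) * F (r *\<^sub>R z) \<partial>lborel) \<partial>lborel)"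
proof -
  let ?d = "DIM('a)"
  let ?I = "indicator (cball (0::'a) 1) :: 'a \<Rightarrow> ennreal"
  have [measurable]: "(\<lambda>z::'a. ennreal (norm z ^ ?d)) \<in> borel_measurable borel" by measurable
  have "(\<integral>\<^sup>+z. ?I z * ennreal (norm z ^ ?d) * (\<integral>\<^sup>+r. indicator {0<..} r * ennreal (r ^ (?d - 1)) * F (r *\<^sub>R z) \<partial>lborel) \<partial>lborel)
     = (\<integral>\<^sup>+z. (\<integral>\<^sup>+r. ?I z * ennreal (norm z ^ ?d) * (indicator {0<..} r * ennreal (r ^ (?d - 1)) * F (r *\<^sub>R z)) \<partial>lborel) \<partial>lborel)"
    by (intro nn_integral_cong nn_integral_cmult[symmetric]) measurable
  also have "\<dots> = (\<integral>\<^sup>+r. (\<integral>\<^sup>+z. ?I z * ennreal (norm z ^ ?d) * (indicator {0<..} r * ennreal (r ^ (?d - 1)) * F (r *\<^sub>R z)) \<partial>lborel) \<partial>lborel)"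
    by (rule nn_integral_lborel_swap) measurable
  \<comment> \<open>The substitution z = w/r at fixed r: the unit ball becomes |w| <= r, and the
    powers of r combine to r^-(d+1).\<close>
  also have "\<dots> = (\<integral>\<^sup>+(r::real). (\<integral>\<^sup>+w. F w * ennreal (norm w ^ ?d) * (indicator {0<..} r * (if norm w \<le> r then 1 else 0) * ennreal (1 / r ^ Suc ?d)) \<partial>lborel) \<partial>lborel)"
  proof (rule nn_integral_cong)
    fix r :: real
    show "(\<integral>\<^sup>+z. ?I z * ennreal (norm z ^ ?d) * (indicator {0<..} r * ennreal (r ^ (?d - 1)) * F (r *\<^sub>R z)) \<partial>lborel)
       = (\<integral>\<^sup>+w. F w * ennreal (norm w ^ ?d) * (indicator {0<..} r * (if norm w \<le> r then 1 else 0) * ennreal (1 / r ^ Suc ?d)) \<partial>lborel)"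
    proof (cases "0 < r")
      case True
      have "(\<integral>\<^sup>+z. ?I z * ennreal (norm z ^ ?d) * (indicator {0<..} r * ennreal (r ^ (?d - 1)) * F (r *\<^sub>R z)) \<partial>lborel)
        = ennreal (\<bar>1 / r\<bar> ^ ?d) * (\<integral>\<^sup>+w. ?I ((1 / r) *\<^sub>R w) * ennreal (norm ((1 / r) *\<^sub>R w) ^ ?d) * (indicator {0<..} r * ennreal (r ^ (?d - 1)) * F (r *\<^sub>R (1 / r) *\<^sub>R w)) \<partial>lborel)"
        by (rule nn_integral_scaleR) (use True in \<open>measurable, auto\<close>)
      also have "\<dots> = (\<integral>\<^sup>+w. ennreal (\<bar>1 / r\<bar> ^ ?d) * (?I ((1 / r) *\<^sub>R w) * ennreal (norm ((1 / r) *\<^sub>R w) ^ ?d) * (indicator {0<..} r * ennreal (r ^ (?d - 1)) * F (r *\<^sub>R (1 / r) *\<^sub>R w))) \<partial>lborel)"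
        by (rule nn_integral_cmult[symmetric]) measurable
      also have "\<dots> = (\<integral>\<^sup>+w. F w * ennreal (norm w ^ ?d) * (indicator {0<..} r * (if norm w \<le> r then 1 else 0) * ennreal (1 / r ^ Suc ?d)) \<partial>lborel)"
      proof (rule nn_integral_cong)
        fix w :: 'a
        have "(1 / r) ^ ?d * (norm w / r) ^ ?d * r ^ (?d - 1) = norm w ^ ?d * (1 / r ^ Suc ?d)"
        proof -
          obtain n where n: "?d = Suc n" using DIM_positive[where 'a = 'a] by (cases "?d") auto
          show ?thesis unfolding n using True by (simp add: field_simps power_divide)
        qed
        then have "ennreal ((1 / r) ^ ?d) * ennreal ((norm w / r) ^ ?d) * ennreal (r ^ (?d - 1)) = ennreal (norm w ^ ?d) * ennreal (1 / r ^ Suc ?d)"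
          using True by (simp flip: ennreal_mult del: power_Suc)
        moreover have "?I ((1 / r) *\<^sub>R w) = (if norm w \<le> r then 1 else 0)"
          using True by (auto simp: indicator_def field_simps)
        ultimately show "ennreal (\<bar>1 / r\<bar> ^ ?d) * (?I ((1 / r) *\<^sub>R w) * ennreal (norm ((1 / r) *\<^sub>R w) ^ ?d) * (indicator {0<..} r * ennreal (r ^ (?d - 1)) * F (r *\<^sub>R (1 / r) *\<^sub>R w)))
          = F w * ennreal (norm w ^ ?d) * (indicator {0<..} r * (if norm w \<le> r then 1 else 0) * ennreal (1 / r ^ Suc ?d))"
          using True by (simp add: mult_ac del: power_Suc)
      qed
      finally show ?thesis .
    qed simp
  qed
  also have "\<dots> = (\<integral>\<^sup>+w. (\<integral>\<^sup>+(r::real). F w * ennreal (norm w ^ ?d) * (indicator {0<..} r * (if norm w \<le> r then 1 else 0) * ennreal (1 / r ^ Suc ?d)) \<partial>lborel) \<partial>lborel)"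
    by (rule nn_integral_lborel_swap[symmetric]) measurable
  also have "\<dots> = (\<integral>\<^sup>+w. F w * ennreal (1 / ?d) \<partial>lborel)"
  proof (rule nn_integral_cong_AE)
    \<comment> \<open>At \<open>w = 0\<close> the factor |w|^d kills the left side while the right
      side may be nonzero, so the equality holds only almost everywhere.\<close>
    have "AE w in lborel. w \<noteq> (0::'a)" by (rule AE_lborel_singleton)
    then show "AE w in lborel. (\<integral>\<^sup>+(r::real). F w * ennreal (norm w ^ ?d) * (indicator {0<..} r * (if norm w \<le> r then 1 else 0) * ennreal (1 / r ^ Suc ?d)) \<partial>lborel) = F w * ennreal (1 / ?d)"
    proof eventually_elim
      case (elim w)
      have "(\<integral>\<^sup>+(r::real). F w * ennreal (norm w ^ ?d) * (indicator {0<..} r * (if norm w \<le> r then 1 else 0) * ennreal (1 / r ^ Suc ?d)) \<partial>lborel)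
        = F w * ennreal (norm w ^ ?d) * (\<integral>\<^sup>+(r::real). (indicator {0<..} r * (if norm w \<le> r then 1 else 0) * ennreal (1 / r ^ Suc ?d)) \<partial>lborel)"
        by (rule nn_integral_cmult) measurable
      also have "(\<integral>\<^sup>+(r::real). (indicator {0<..} r * (if norm w \<le> r then 1 else 0) * ennreal (1 / r ^ Suc ?d)) \<partial>lborel)
        = (\<integral>\<^sup>+r. ennreal (1 / r ^ Suc ?d) * indicator {norm w..} r \<partial>lborel)"
      proof (rule nn_integral_cong)
        fix r :: real
        have "0 < r" if "norm w \<le> r" using that elim by (meson less_le_trans zero_less_norm_iff)
        then show "indicator {0<..} r * (if norm w \<le> r then 1 else 0) * ennreal (1 / r ^ Suc ?d) = ennreal (1 / r ^ Suc ?d) * indicator {norm w..} r"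
          by (auto simp: indicator_def simp del: power_Suc)
      qed
      also have "\<dots> = ennreal (1 / (?d * norm w ^ ?d))"
        by (rule nn_integral_inverse_power) (use elim in auto)
      also have "F w * ennreal (norm w ^ ?d) * ennreal (1 / (?d * norm w ^ ?d)) = F w * ennreal (1 / ?d)"
        using elim by (simp add: mult.assoc flip: ennreal_mult)
      finally show ?case .
    qed
  qed
  also have "\<dots> = (\<integral>\<^sup>+w. F w \<partial>lborel) * ennreal (1 / ?d)" by (rule nn_integral_multc) measurable
  finally have "of_nat ?d * (\<integral>\<^sup>+z. ?I z * ennreal (norm z ^ ?d) * (\<integral>\<^sup>+r. indicator {0<..} r * ennreal (r ^ (?d - 1)) * F (r *\<^sub>R z) \<partial>lborel) \<partial>lborel)
     = (\<integral>\<^sup>+w. F w \<partial>lborel) * (ennreal (real ?d) * ennreal (1 / ?d))"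
    by (simp add: mult_ac ennreal_of_nat_eq_real_of_nat)
  also have "ennreal (real ?d) * ennreal (1 / ?d) = 1" by (simp flip: ennreal_mult)
  finally show ?thesis by simp
qed

text \<open>On the ray through z the radial integral of r^(s-1) runs up to N/|z|; its value
  (N/|z|)^s / s cancels all powers of |z|, leaving a constant on the unit ball. Convergence at the
  origin is the condition \<open>0 < s\<close>.\<close>

lemma integrable_norm_powr_cball:
  fixes s N :: real
  assumes s: "0 < s" and N: "0 < N"
  shows "integrable lborel (\<lambda>w::'a::euclidean_space. indicator (cball 0 N) w * norm w powr (s - DIM('a)))"
proof (rule integrableI_nonneg)
  let ?d = "DIM('a)"
  let ?F = "\<lambda>w::'a. ennreal (indicator (cball 0 N) w * norm w powr (s - ?d))"
  have "(\<integral>\<^sup>+w. ?F w \<partial>lborel) = of_nat ?d * (\<integral>\<^sup>+z. indicator (cball 0 1) z * ennreal (norm z ^ ?d) *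
      (\<integral>\<^sup>+r. indicator {0<..} r * ennreal (r ^ (?d - 1)) * ?F (r *\<^sub>R z) \<partial>lborel) \<partial>lborel)"
    by (rule nn_integral_polar) measurable
  also have "(\<integral>\<^sup>+z. indicator (cball 0 1) z * ennreal (norm z ^ ?d) *
      (\<integral>\<^sup>+r. indicator {0<..} r * ennreal (r ^ (?d - 1)) * ?F (r *\<^sub>R z) \<partial>lborel) \<partial>lborel)
    = (\<integral>\<^sup>+z. ennreal (N powr s / s) * indicator (cball (0::'a) 1) z \<partial>lborel)"
  proof (rule nn_integral_cong_AE)
    have "AE z in lborel. z \<noteq> (0::'a)" by (rule AE_lborel_singleton)
    then show "AE z in lborel. indicator (cball 0 1) z * ennreal (norm z ^ ?d) *
      (\<integral>\<^sup>+r. indicator {0<..} r * ennreal (r ^ (?d - 1)) * ?F (r *\<^sub>R z) \<partial>lborel) = ennreal (N powr s / s) * indicator (cball (0::'a) 1) z"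
    proof eventually_elim
      case (elim z)
      define n where "n = norm z"
      have n: "0 < n" using elim by (simp add: n_def)
      have "(\<integral>\<^sup>+r. indicator {0<..} r * ennreal (r ^ (?d - 1)) * ?F (r *\<^sub>R z) \<partial>lborel)
        = (\<integral>\<^sup>+r. ennreal (n powr (s - ?d)) * ennreal (indicator {0..N / n} r * r powr (s - 1)) \<partial>lborel)"
      proof (rule nn_integral_cong)
        fix r :: real
        show "indicator {0<..} r * ennreal (r ^ (?d - 1)) * ?F (r *\<^sub>R z) = ennreal (n powr (s - ?d)) * ennreal (indicator {0..N / n} r * r powr (s - 1))"
        proof (cases "0 < r")
          case True
          have "r ^ (?d - 1) = r powr (real ?d - 1)" using True by (simp add: powr_realpow[symmetric] of_nat_diff)
          then have "r ^ (?d - 1) * (r * n) powr (s - ?d) = n powr (s - ?d) * r powr (s - 1)"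
            using True n by (simp add: powr_mult mult_ac flip: powr_add)
          then show ?thesis using True n by (auto simp: indicator_def n_def[symmetric] field_simps simp flip: ennreal_mult)
        next
          case False
          then show ?thesis by (cases "r = 0") (auto simp: indicator_def)
        qed
      qed
      also have "\<dots> = ennreal (n powr (s - ?d)) * (\<integral>\<^sup>+r. ennreal (indicator {0..N / n} r * r powr (s - 1)) \<partial>lborel)"
        by (rule nn_integral_cmult) measurable
      also have "(\<integral>\<^sup>+r. ennreal (indicator {0..N / n} r * r powr (s - 1)) \<partial>lborel) = ennreal ((N / n) powr s / s)"
      proof -
        have "((\<lambda>r. r powr (s - 1)) has_integral ((N / n) powr (s - 1 + 1) / (s - 1 + 1))) {0..N / n}"
          by (rule has_integral_powr_from_0) (use s N n in auto)
        then have "((\<lambda>r. r powr (s - 1)) has_integral ((N / n) powr s / s)) {0..N / n}" by simp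
        then have "((\<lambda>r. indicator {0..N / n} r * r powr (s - 1)) has_integral ((N / n) powr s / s)) UNIV"
          by (subst (asm) has_integral_restrict_UNIV[symmetric]) (simp add: indicator_def of_bool_def if_distrib if_distribR cong: if_cong)
        from nn_integral_has_integral_lborel[OF _ _ this] show ?thesis by (simp add: indicator_def)
      qed
      also have "ennreal (norm z ^ ?d) * (ennreal (n powr (s - ?d)) * ennreal ((N / n) powr s / s)) = ennreal (N powr s / s)"
      proof -
        have "n ^ ?d * (n powr (s - ?d)) = n powr s"
          using n by (simp add: powr_realpow[symmetric] flip: powr_add)
        then have e: "n ^ ?d * (n powr (s - ?d) * ((N / n) powr s / s)) = N powr s / s"
          using n N by (simp add: powr_divide field_simps)
        have "ennreal (n ^ ?d) * (ennreal (n powr (s - ?d)) * ennreal ((N / n) powr s / s))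
            = ennreal (n ^ ?d * (n powr (s - ?d) * ((N / n) powr s / s)))"
          using n s by (subst ennreal_mult, simp, simp, subst ennreal_mult) auto
        then show ?thesis unfolding e unfolding n_def .
      qed
      finally show ?case by (simp add: mult_ac)
    qed
  qed
  also have "\<dots> = ennreal (N powr s / s) * emeasure lborel (cball (0::'a) 1)"
    by (subst nn_integral_cmult) auto
  also have "of_nat ?d * \<dots> < \<infinity>"
    using emeasure_bounded_finite[of "cball (0::'a) 1"] by (auto simp: ennreal_mult_less_top ennreal_of_nat_eq_real_of_nat)
  finally show "(\<integral>\<^sup>+w. ?F w \<partial>lborel) < \<infinity>" .
qed (auto simp: indicator_def)

section \<open>Symmetries of Lebesgue measure and second moments of directions\<close>

lemma distr_lborel_permute_Basis:
  fixes \<sigma> :: "'a::euclidean_space \<Rightarrow> 'a"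
  assumes \<sigma>: "bij_betw \<sigma> Basis Basis"
  shows "distr lborel borel (\<lambda>z::'a. \<Sum>b\<in>Basis. (z \<bullet> \<sigma> b) *\<^sub>R b) = lborel"
proof (rule lborel_eqI[symmetric])
  let ?S = "\<lambda>z::'a. \<Sum>b\<in>Basis. (z \<bullet> \<sigma> b) *\<^sub>R b"
  have [measurable]: "?S \<in> borel_measurable borel" by measurable
  fix l u :: 'a assume lu: "\<And>b. b \<in> Basis \<Longrightarrow> l \<bullet> b \<le> u \<bullet> b"
  define \<tau> where "\<tau> = inv_into Basis \<sigma>"
  have \<tau>: "\<tau> b \<in> Basis" "\<sigma> (\<tau> b) = b" if "b \<in> Basis" for b
    using that \<sigma> unfolding \<tau>_def by (auto simp: bij_betw_def f_inv_into_f inv_into_into)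
  have \<tau>\<sigma>: "\<sigma> b \<in> Basis" "\<tau> (\<sigma> b) = b" if "b \<in> Basis" for b
    using that \<sigma> unfolding \<tau>_def by (auto simp: bij_betw_def)
  define P where "P v = (\<Sum>b\<in>Basis. (v \<bullet> \<tau> b) *\<^sub>R b)" for v :: 'a
  have P: "P v \<bullet> b = v \<bullet> \<tau> b" if "b \<in> Basis" for v b
    unfolding P_def using that by (simp add: inner_sum_left_Basis)
  \<comment> \<open>The preimage of a box is a box with the same side lengths in another order,
    hence of the same volume; \<open>\<tau>\<close> inverts \<open>\<sigma>\<close>.\<close>
  have "?S -` box l u = box (P l) (P u)"
  proof (rule set_eqI)
    fix z
    have "z \<in> ?S -` box l u \<longleftrightarrow> (\<forall>b\<in>Basis. l \<bullet> b < z \<bullet> \<sigma> b \<and> z \<bullet> \<sigma> b < u \<bullet> b)"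
      by (simp add: mem_box inner_sum_left_Basis)
    also have "\<dots> \<longleftrightarrow> (\<forall>b\<in>Basis. l \<bullet> \<tau> b < z \<bullet> b \<and> z \<bullet> b < u \<bullet> \<tau> b)"
    proof (intro iffI ballI)
      fix b :: 'a assume h: "\<forall>b\<in>Basis. l \<bullet> b < z \<bullet> \<sigma> b \<and> z \<bullet> \<sigma> b < u \<bullet> b" and b: "b \<in> Basis"
      show "l \<bullet> \<tau> b < z \<bullet> b \<and> z \<bullet> b < u \<bullet> \<tau> b" using bspec[OF h \<tau>(1)[OF b]] \<tau>(2)[OF b] by simp
    next
      fix b :: 'a assume h: "\<forall>b\<in>Basis. l \<bullet> \<tau> b < z \<bullet> b \<and> z \<bullet> b < u \<bullet> \<tau> b" and b: "b \<in> Basis"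
      show "l \<bullet> b < z \<bullet> \<sigma> b \<and> z \<bullet> \<sigma> b < u \<bullet> b" using bspec[OF h \<tau>\<sigma>(1)[OF b]] \<tau>\<sigma>(2)[OF b] by simp
    qed
    also have "\<dots> \<longleftrightarrow> z \<in> box (P l) (P u)" by (simp add: mem_box P)
    finally show "z \<in> ?S -` box l u \<longleftrightarrow> z \<in> box (P l) (P u)" .
  qed
  then have "emeasure (distr lborel borel ?S) (box l u) = emeasure lborel (box (P l) (P u))"
    by (subst emeasure_distr) auto
  also have "\<dots> = ennreal (\<Prod>b\<in>Basis. (P u - P l) \<bullet> b)"
    by (rule emeasure_lborel_box) (use lu \<tau> in \<open>simp add: P\<close>)
  also have "(\<Prod>b\<in>Basis. (P u - P l) \<bullet> b) = (\<Prod>b\<in>Basis. (u - l) \<bullet> \<tau> b)"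
    by (intro prod.cong refl) (simp add: inner_diff_left P)
  also have "\<dots> = (\<Prod>b\<in>Basis. (u - l) \<bullet> b)"
    using prod.reindex_bij_betw[OF bij_betw_inv_into[OF \<sigma>], of "\<lambda>b. (u - l) \<bullet> b"] by (simp add: \<tau>_def)
  finally show "emeasure (distr lborel borel ?S) (box l u) = ennreal (\<Prod>b\<in>Basis. (u - l) \<bullet> b)" .
qed simp

lemma distr_lborel_reflect:
  fixes i :: "'a::euclidean_space"
  assumes i: "i \<in> Basis"
  shows "distr lborel borel (\<lambda>z::'a. \<Sum>b\<in>Basis. ((if b = i then -1 else 1) * (z \<bullet> b)) *\<^sub>R b) = lborel"
proof -
  let ?c = "\<lambda>b. if b = i then -1 else 1 :: real"
  have "lborel = density (distr lborel borel (\<lambda>z::'a. 0 + (\<Sum>b\<in>Basis. (?c b * (z \<bullet> b)) *\<^sub>R b))) (\<lambda>_. (\<Prod>b\<in>(Basis::'a set). \<bar>?c b\<bar>))"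
    by (rule lborel_affine_euclidean) auto
  moreover have "(\<Prod>b\<in>(Basis::'a set). \<bar>?c b\<bar>) = 1" by (intro prod.neutral) auto
  ultimately show ?thesis by (simp add: density_1)
qed

text \<open>Reflecting one coordinate makes the mixed moments vanish, and exchanging two coordinates
  makes the pure moments equal. The latter add up to the volume, because the squared coordinates of
  z/|z| sum to 1; each is therefore the volume divided by the dimension.\<close>

lemma integral_inner_sq_ball:
  fixes x :: "'a::euclidean_space"
  shows "integrable lborel (\<lambda>z::'a. indicator (cball 0 1) z * ((x \<bullet> z)\<^sup>2 / (norm z)\<^sup>2))"
    and "(LBINT z. indicator (cball 0 1) z * ((x \<bullet> z)\<^sup>2 / (norm z)\<^sup>2))
      = (norm x)\<^sup>2 / DIM('a) * measure lborel (cball (0::'a) 1)"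
proof -
  let ?C = "cball (0::'a) 1"
  have fin: "emeasure lborel ?C < \<infinity>" by (rule emeasure_bounded_finite) auto
  have iC: "integrable lborel (\<lambda>z. indicator ?C z :: real)" using fin by (intro integrable_real_indicator) auto
  have intb: "integrable lborel f" if "f \<in> borel_measurable borel" "\<And>z. \<bar>f z\<bar> \<le> B * indicator ?C z" for f :: "'a \<Rightarrow> real" and B
    by (rule Bochner_Integration.integrable_bound[of lborel "\<lambda>z. B * indicator ?C z"])
       (use that iC in \<open>auto intro!: AE_I2 intro: order_trans[OF _ abs_ge_self]\<close>)
  define h where "h i j z = indicator ?C z * ((z \<bullet> i) * (z \<bullet> j) / (norm z)\<^sup>2)" for i j z :: 'a
  have [measurable]: "h i j \<in> borel_measurable borel" for i j unfolding h_def by measurable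
  have ih: "integrable lborel (h i j)" for i j
  proof (rule intb[of _ "norm i * norm j"])
    fix z
    have "\<bar>(z \<bullet> i) * (z \<bullet> j)\<bar> \<le> (norm z * norm i) * (norm z * norm j)"
      unfolding abs_mult by (intro mult_mono Cauchy_Schwarz_ineq2) auto
    then have "\<bar>(z \<bullet> i) * (z \<bullet> j)\<bar> / (norm z)\<^sup>2 \<le> norm i * norm j"
      by (cases "z = 0") (auto simp: divide_le_eq power2_eq_square mult_ac)
    then show "\<bar>h i j z\<bar> \<le> norm i * norm j * indicator ?C z"
      by (auto simp: h_def indicator_def)
  qed simp
  define g where "g i j = (LBINT z. h i j z)" for i j
  have norm_sq: "(norm v)\<^sup>2 = (\<Sum>b\<in>Basis. (v \<bullet> b)\<^sup>2)" for v :: 'a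
    unfolding power2_norm_eq_inner by (subst euclidean_inner) (simp add: power2_eq_square)
  have norm_eqI: "norm v = norm w" if "(\<Sum>b\<in>Basis. (v \<bullet> b)\<^sup>2) = (\<Sum>b\<in>Basis. (w \<bullet> b)\<^sup>2)" for v w :: 'a
    using that norm_sq[of v] norm_sq[of w] by (simp add: norm_eq_sqrt_inner power2_norm_eq_inner)
  have g_distr: "g i j = (LBINT z. h i j (T z))"
    if "distr lborel borel T = lborel" and [measurable]: "T \<in> borel_measurable borel" for T i j
    using integral_distr[of T lborel borel "h i j"] that(1) by (simp add: g_def)
  have off: "g i j = 0" if ij: "i \<in> Basis" "j \<in> Basis" "i \<noteq> j" for i j
  proof -
    let ?T = "\<lambda>z::'a. \<Sum>b\<in>Basis. ((if b = i then -1 else 1) * (z \<bullet> b)) *\<^sub>R b"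
    have T: "?T z \<bullet> b = (if b = i then -1 else 1) * (z \<bullet> b)" if "b \<in> Basis" for z b
      using that by (simp add: inner_sum_left_Basis)
    have "norm (?T z) = norm z" for z
      by (rule norm_eqI, rule sum.cong[OF refl]) (simp add: T power_mult_distrib)
    then have "h i j (?T z) = - h i j z" for z
      using T[OF ij(1)] T[OF ij(2)] ij(3) by (simp add: h_def indicator_def)
    moreover have "g i j = (LBINT z. h i j (?T z))"
      by (rule g_distr[OF distr_lborel_reflect[OF ij(1)]]) measurable
    ultimately show ?thesis by (simp add: g_def)
  qed
  have diag: "g i i = g j j" if ij: "i \<in> Basis" "j \<in> Basis" for i j
  proof -
    define \<sigma> where "\<sigma> b = (if b = i then j else if b = j then i else b)" for b
    let ?T = "\<lambda>z::'a. \<Sum>b\<in>Basis. (z \<bullet> \<sigma> b) *\<^sub>R b"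
    have \<sigma>: "bij_betw \<sigma> Basis Basis"
      by (rule bij_betwI[of _ _ _ \<sigma>]) (use ij in \<open>auto simp: \<sigma>_def\<close>)
    have T: "?T z \<bullet> b = z \<bullet> \<sigma> b" if "b \<in> Basis" for z b
      using that by (simp add: inner_sum_left_Basis)
    have "norm (?T z) = norm z" for z
    proof (rule norm_eqI)
      have "(\<Sum>b\<in>Basis. (?T z \<bullet> b)\<^sup>2) = (\<Sum>b\<in>Basis. (z \<bullet> \<sigma> b)\<^sup>2)" by (rule sum.cong) (simp_all add: T)
      also have "\<dots> = (\<Sum>b\<in>Basis. (z \<bullet> b)\<^sup>2)" by (rule sum.reindex_bij_betw[OF \<sigma>])
      finally show "(\<Sum>b\<in>Basis. (?T z \<bullet> b)\<^sup>2) = (\<Sum>b\<in>Basis. (z \<bullet> b)\<^sup>2)" .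
    qed
    then have "h i i (?T z) = h j j z" for z
      using T[OF ij(1)] by (simp add: h_def indicator_def \<sigma>_def)
    moreover have "g i i = (LBINT z. h i i (?T z))"
      by (rule g_distr[OF distr_lborel_permute_Basis[OF \<sigma>]]) measurable
    ultimately show ?thesis by (simp add: g_def)
  qed
  have "(\<Sum>i\<in>Basis. g i i) = (LBINT z. (\<Sum>i\<in>Basis. h i i z))" unfolding g_def using ih by simp
  also have "\<dots> = (LBINT z. indicator ?C z)"
  proof (rule integral_cong_AE)
    have "AE z in lborel. z \<noteq> (0::'a)" by (rule AE_lborel_singleton)
    then show "AE z in lborel. (\<Sum>i\<in>Basis. h i i z) = indicator ?C z"
    proof eventually_elim
      case (elim z)
      have "(\<Sum>i\<in>Basis. h i i z) = indicator ?C z * ((\<Sum>i\<in>Basis. (z \<bullet> i)\<^sup>2) / (norm z)\<^sup>2)"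
        by (simp add: h_def sum_distrib_left sum_divide_distrib power2_eq_square)
      then show ?case using elim by (simp flip: norm_sq)
    qed
  qed measurable
  also have "\<dots> = measure lborel ?C" by simp
  finally have sum: "(\<Sum>i\<in>Basis. g i i) = measure lborel ?C" .
  have gii: "g i i = measure lborel ?C / DIM('a)" if i: "i \<in> Basis" for i
  proof -
    have "(\<Sum>j\<in>Basis. g j j) = (\<Sum>j\<in>(Basis::'a set). g i i)" by (rule sum.cong[OF refl diag]) (use i in auto)
    then show ?thesis using sum by (simp add: field_simps)
  qed
  have expand: "indicator ?C z * ((x \<bullet> z)\<^sup>2 / (norm z)\<^sup>2) = (\<Sum>i\<in>Basis. \<Sum>j\<in>Basis. ((x \<bullet> i) * (x \<bullet> j)) * h i j z)" for z
  proof -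
    have "(x \<bullet> z)\<^sup>2 = (\<Sum>i\<in>Basis. (x \<bullet> i) * (z \<bullet> i)) * (\<Sum>j\<in>Basis. (x \<bullet> j) * (z \<bullet> j))"
      unfolding power2_eq_square by (subst (1 2) euclidean_inner) simp
    also have "\<dots> = (\<Sum>i\<in>Basis. \<Sum>j\<in>Basis. ((x \<bullet> i) * (x \<bullet> j)) * ((z \<bullet> i) * (z \<bullet> j)))"
      by (simp add: sum_product mult_ac)
    finally show ?thesis by (simp add: h_def sum_distrib_left sum_divide_distrib mult_ac)
  qed
  show "integrable lborel (\<lambda>z::'a. indicator (cball 0 1) z * ((x \<bullet> z)\<^sup>2 / (norm z)\<^sup>2))"
    unfolding expand using ih by simp
  have "(LBINT z. indicator ?C z * ((x \<bullet> z)\<^sup>2 / (norm z)\<^sup>2)) = (\<Sum>i\<in>Basis. \<Sum>j\<in>Basis. ((x \<bullet> i) * (x \<bullet> j)) * g i j)"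
    unfolding expand g_def using ih by simp
  also have "\<dots> = (\<Sum>i\<in>Basis. \<Sum>j\<in>Basis. if j = i then (x \<bullet> i)\<^sup>2 * (measure lborel ?C / DIM('a)) else 0)"
    by (intro sum.cong refl) (auto simp: off gii power2_eq_square)
  also have "\<dots> = (norm x)\<^sup>2 / DIM('a) * measure lborel ?C"
    by (simp add: norm_sq sum_distrib_right sum_divide_distrib)
  finally show "(LBINT z. indicator ?C z * ((x \<bullet> z)\<^sup>2 / (norm z)\<^sup>2)) = (norm x)\<^sup>2 / DIM('a) * measure lborel ?C" .
qed

text \<open>The line x + rz meets the sphere at r = a and r = -b, with \<open>D\<close> a quarter of
  the discriminant, so \<open>\<rho>\<^sup>2 - (norm (x + r *\<^sub>R z))\<^sup>2\<close> equals
  |z|^2 (a - r)(r + b). The powers of r collect to 1 - 2p and those of |z| to 2 - d; the latter meet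
  the weight |z|^d of the polar formula.\<close>

lemma nn_integral_ball_ray:
  fixes x z :: "'a::euclidean_space" and p :: real
  assumes p: "0 < p" "p < 1" and x: "norm x < \<rho>" and z: "z \<noteq> 0"
  defines "D \<equiv> (x \<bullet> z)\<^sup>2 + (norm z)\<^sup>2 * (\<rho>\<^sup>2 - (norm x)\<^sup>2)"
  shows "(\<integral>\<^sup>+r. indicator {0<..} r * ennreal (r ^ (DIM('a) - 1)) *
       ennreal (norm (r *\<^sub>R z) powr (2 - 2 * p - DIM('a)) * (max (\<rho>\<^sup>2 - (norm (x + r *\<^sub>R z))\<^sup>2) 0) powr p) \<partial>lborel)
    = ennreal (norm z powr (2 - real DIM('a))) *
      (\<integral>\<^sup>+r. ennreal (indicator {0<..<(- (x \<bullet> z) + sqrt D) / (norm z)\<^sup>2} r *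
         ((((- (x \<bullet> z) + sqrt D) / (norm z)\<^sup>2 - r) * (r + ((x \<bullet> z) + sqrt D) / (norm z)\<^sup>2)) powr p * r powr (1 - 2 * p))) \<partial>lborel)"
proof -
  let ?d = "DIM('a)"
  define n where "n = norm z"
  have n: "0 < n" using z by (simp add: n_def)
  define a b where "a = (- (x \<bullet> z) + sqrt D) / n\<^sup>2" and "b = ((x \<bullet> z) + sqrt D) / n\<^sup>2"
  have "(norm x)\<^sup>2 < \<rho>\<^sup>2" using x by (intro power_strict_mono) auto
  then have D: "(x \<bullet> z)\<^sup>2 < D" unfolding D_def using z by simp
  then have "\<bar>x \<bullet> z\<bar> < sqrt D" by (metis real_sqrt_abs real_sqrt_less_mono)
  then have b: "0 < b" using n by (simp add: b_def)
  have "0 \<le> D" using D zero_le_power2[of "x \<bullet> z"] by linarith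
  then have sD: "(sqrt D)\<^sup>2 = D" by simp
  have ab: "a - b = - 2 * (x \<bullet> z) / n\<^sup>2" by (simp add: a_def b_def diff_divide_distrib[symmetric])
  have "a * b = ((sqrt D)\<^sup>2 - (x \<bullet> z)\<^sup>2) / (n\<^sup>2 * n\<^sup>2)"
    unfolding a_def b_def by (simp add: power2_eq_square algebra_simps)
  also have "\<dots> = (\<rho>\<^sup>2 - (norm x)\<^sup>2) / n\<^sup>2" unfolding sD unfolding D_def using n by (simp add: n_def field_simps)
  finally have ab': "a * b = (\<rho>\<^sup>2 - (norm x)\<^sup>2) / n\<^sup>2" .
  have fact: "\<rho>\<^sup>2 - (norm (x + r *\<^sub>R z))\<^sup>2 = n\<^sup>2 * ((a - r) * (r + b))" for r
  proof -
    have "(norm (x + r *\<^sub>R z))\<^sup>2 = (norm x)\<^sup>2 + 2 * r * (x \<bullet> z) + r\<^sup>2 * n\<^sup>2"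
      unfolding n_def power2_norm_eq_inner by (simp add: inner_add_left inner_add_right inner_commute[of z x] power2_eq_square algebra_simps)
    moreover have "(a - r) * (r + b) = a * b + r * (a - b) - r\<^sup>2" by (simp add: power2_eq_square algebra_simps)
    moreover have "n\<^sup>2 * (a * b + r * (a - b) - r\<^sup>2) = \<rho>\<^sup>2 - (norm x)\<^sup>2 - 2 * r * (x \<bullet> z) - r\<^sup>2 * n\<^sup>2"
      unfolding ab ab' using n by (simp add: field_simps)
    ultimately show ?thesis by simp
  qed
  have "(\<integral>\<^sup>+r. indicator {0<..} r * ennreal (r ^ (?d - 1)) *
       ennreal (norm (r *\<^sub>R z) powr (2 - 2 * p - ?d) * (max (\<rho>\<^sup>2 - (norm (x + r *\<^sub>R z))\<^sup>2) 0) powr p) \<partial>lborel)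
    = (\<integral>\<^sup>+r. ennreal (n powr (2 - real ?d)) * ennreal (indicator {0<..<a} r * (((a - r) * (r + b)) powr p * r powr (1 - 2 * p))) \<partial>lborel)"
  proof (rule nn_integral_cong)
    fix r :: real
    consider "r \<le> 0" | "0 < r" "a \<le> r" | "0 < r" "r < a" by linarith
    then show "indicator {0<..} r * ennreal (r ^ (?d - 1)) *
       ennreal (norm (r *\<^sub>R z) powr (2 - 2 * p - ?d) * (max (\<rho>\<^sup>2 - (norm (x + r *\<^sub>R z))\<^sup>2) 0) powr p)
      = ennreal (n powr (2 - real ?d)) * ennreal (indicator {0<..<a} r * (((a - r) * (r + b)) powr p * r powr (1 - 2 * p)))"
    proof cases
      case 2
      then have "n\<^sup>2 * ((a - r) * (r + b)) \<le> 0" using b by (intro mult_nonneg_nonpos mult_nonpos_nonneg) auto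
      then show ?thesis using 2 unfolding fact by (simp add: max_def)
    next
      case 3
      have 4: "0 < (a - r) * (r + b)" using 3 b by simp
      have e1: "r ^ (?d - 1) = r powr (real ?d - 1)" using 3 by (simp add: powr_realpow[symmetric] of_nat_diff)
      have e2: "(r * n) powr (2 - 2 * p - ?d) = r powr (2 - 2 * p - ?d) * n powr (2 - 2 * p - ?d)"
        using 3 n by (simp add: powr_mult)
      have e3: "r powr (real ?d - 1) * r powr (2 - 2 * p - ?d) = r powr (1 - 2 * p)"
        by (simp flip: powr_add)
      have e4: "(n\<^sup>2 * ((a - r) * (r + b))) powr p = n powr (2 * p) * ((a - r) * (r + b)) powr p"
      proof -
        have "n\<^sup>2 = n powr 2" using n by simp
        then have "(n\<^sup>2) powr p = n powr (2 * p)" by (simp only: powr_powr)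
        then show ?thesis using 4 n by (simp add: powr_mult)
      qed
      have e5: "n powr (2 - 2 * p - ?d) * n powr (2 * p) = n powr (2 - real ?d)"
        by (simp flip: powr_add)
      have "r ^ (?d - 1) * ((r * n) powr (2 - 2 * p - ?d) * (n\<^sup>2 * ((a - r) * (r + b))) powr p)
         = (n powr (2 - 2 * p - ?d) * n powr (2 * p)) * (((a - r) * (r + b)) powr p * (r powr (real ?d - 1) * r powr (2 - 2 * p - ?d)))"
        unfolding e1 e2 e4 by (simp only: mult_ac)
      then have "r ^ (?d - 1) * ((r * n) powr (2 - 2 * p - ?d) * (n\<^sup>2 * ((a - r) * (r + b))) powr p)
         = n powr (2 - real ?d) * (((a - r) * (r + b)) powr p * r powr (1 - 2 * p))"
        unfolding e3 e5 .
      moreover have "max (n\<^sup>2 * ((a - r) * (r + b))) 0 = n\<^sup>2 * ((a - r) * (r + b))"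
        using mult_pos_pos[OF _ 4, of "n\<^sup>2"] n by (intro max_absorb1) simp
      ultimately show ?thesis using 3 unfolding fact by (simp add: n_def[symmetric] flip: ennreal_mult)
    qed auto
  qed
  also have "\<dots> = ennreal (n powr (2 - real ?d)) * (\<integral>\<^sup>+r. ennreal (indicator {0<..<a} r * (((a - r) * (r + b)) powr p * r powr (1 - 2 * p))) \<partial>lborel)"
    by (rule nn_integral_cmult) measurable
  finally show ?thesis by (simp add: n_def a_def b_def)
qed

text \<open>Under z -> -z the rays pair up to full chords through \<open>x\<close>. The quadratic
  form of the chord leaves \<rho>^2 - |x|^2 plus a multiple of (x . z)^2/|z|^2, whose mean over
  directions is |x|^2/d.\<close>

lemma nn_integral_riesz_ball:
  fixes x :: "'a::euclidean_space" and p :: real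
  assumes p: "0 < p" "p < 1" and x: "norm x < \<rho>"
  shows "(\<integral>\<^sup>+w. ennreal (norm w powr (2 - 2 * p - DIM('a)) * (max (\<rho>\<^sup>2 - (norm (x + w))\<^sup>2) 0) powr p) \<partial>lborel)
    = ennreal (DIM('a) * measure lborel (cball (0::'a) 1) / 2 * (Gamma (1 + p) * Gamma (1 - p)) *
        (\<rho>\<^sup>2 - (norm x)\<^sup>2 * (1 - (2 - 2 * p) / DIM('a))))"
proof -
  let ?d = "DIM('a)"
  let ?C = "cball (0::'a) 1"
  define c where "c = Gamma (1 + p) * Gamma (1 - p)"
  have c: "0 < c" unfolding c_def using p by (intro mult_pos_pos Gamma_real_pos) auto
  define F where "F w = ennreal (norm w powr (2 - 2 * p - ?d) * (max (\<rho>\<^sup>2 - (norm (x + w))\<^sup>2) 0) powr p)" for w :: 'a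
  have [measurable]: "F \<in> borel_measurable borel" unfolding F_def by measurable
  define I where "I z = (\<integral>\<^sup>+r. indicator {0<..} r * ennreal (r ^ (?d - 1)) * F (r *\<^sub>R z) \<partial>lborel)" for z
  have [measurable]: "I \<in> borel_measurable borel" unfolding I_def by measurable
  define E where "E z = indicator ?C z * ennreal (norm z ^ ?d)" for z :: 'a
  have [measurable]: "E \<in> borel_measurable borel" unfolding E_def by measurable
  have x2: "(norm x)\<^sup>2 < \<rho>\<^sup>2" using x by (intro power_strict_mono) auto
  have pol: "(\<integral>\<^sup>+w. F w \<partial>lborel) = of_nat ?d * (\<integral>\<^sup>+z. E z * I z \<partial>lborel)"
    unfolding I_def E_def by (rule nn_integral_polar) measurable
  have "(\<integral>\<^sup>+z. E z * I z \<partial>lborel) = ennreal (\<bar>-1\<bar> ^ ?d) * (\<integral>\<^sup>+z. E (-1 *\<^sub>R z) * I (-1 *\<^sub>R z) \<partial>lborel)"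
    by (rule nn_integral_scaleR) auto
  then have neg: "(\<integral>\<^sup>+z. E z * I z \<partial>lborel) = (\<integral>\<^sup>+z. E z * I (- z) \<partial>lborel)"
    by (simp add: E_def indicator_def)
  \<comment> \<open>The contribution of the two opposite rays together, after all powers of |z| have
    cancelled: ((a + b)^2 - (2p - 1)(a - b)^2)/4 times |z|^4 is \<open>D\<close> minus (2p - 1)(x .
    z)^2.\<close>
  define q where "q z = indicator ?C z * (c * ((2 - 2 * p) * ((x \<bullet> z)\<^sup>2 / (norm z)\<^sup>2) + (\<rho>\<^sup>2 - (norm x)\<^sup>2)))" for z :: 'a
  have q0: "0 \<le> q z" for z unfolding q_def using c x2 p by (intro mult_nonneg_nonneg add_nonneg_nonneg) auto
  define s where "s z = indicator ?C z * ((x \<bullet> z)\<^sup>2 / (norm z)\<^sup>2)" for z :: 'a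
  have qs: "q = (\<lambda>z. c * (2 - 2 * p) * s z + c * (\<rho>\<^sup>2 - (norm x)\<^sup>2) * indicator ?C z)"
    by (simp add: q_def s_def fun_eq_iff algebra_simps)
  have iC: "integrable lborel (\<lambda>z. indicator ?C z :: real)"
    using emeasure_bounded_finite[of ?C] by (intro integrable_real_indicator) auto
  have int_s: "integrable lborel s" and Is: "(LBINT z. s z) = (norm x)\<^sup>2 / ?d * measure lborel ?C"
    unfolding s_def by (fact integral_inner_sq_ball)+
  have iq: "integrable lborel q" unfolding qs using int_s iC by simp
  have Iq: "(LBINT z. q z) = c * (2 - 2 * p) * ((norm x)\<^sup>2 / ?d * measure lborel ?C) + c * (\<rho>\<^sup>2 - (norm x)\<^sup>2) * measure lborel ?C"
    unfolding qs using int_s iC by (simp add: Is)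
  have "(\<integral>\<^sup>+z. E z * I z \<partial>lborel) + (\<integral>\<^sup>+z. E z * I z \<partial>lborel) = (\<integral>\<^sup>+z. E z * I z + E z * I (- z) \<partial>lborel)"
    by (subst (2) neg, subst nn_integral_add) auto
  also have "\<dots> = (\<integral>\<^sup>+z. ennreal (q z) \<partial>lborel)"
  proof (rule nn_integral_cong_AE)
    have "AE z in lborel. z \<noteq> (0::'a)" by (rule AE_lborel_singleton)
    then show "AE z in lborel. E z * I z + E z * I (- z) = ennreal (q z)"
    proof eventually_elim
      case (elim z)
      define n where "n = norm z"
      have n: "0 < n" using elim by (simp add: n_def)
      define D where "D = (x \<bullet> z)\<^sup>2 + n\<^sup>2 * (\<rho>\<^sup>2 - (norm x)\<^sup>2)"
      define a b where "a = (- (x \<bullet> z) + sqrt D) / n\<^sup>2" and "b = ((x \<bullet> z) + sqrt D) / n\<^sup>2"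
      have D: "(x \<bullet> z)\<^sup>2 < D" unfolding D_def using n x2 by simp
      then have "\<bar>x \<bullet> z\<bar> < sqrt D" by (metis real_sqrt_abs real_sqrt_less_mono)
      then have ab: "0 < a" "0 < b" using n by (simp_all add: a_def b_def)
      have "0 \<le> D" using D zero_le_power2[of "x \<bullet> z"] by linarith
  then have sD: "(sqrt D)\<^sup>2 = D" by simp
      have I1: "I z = ennreal (n powr (2 - real ?d)) * (\<integral>\<^sup>+r. ennreal (indicator {0<..<a} r * (((a - r) * (r + b)) powr p * r powr (1 - 2 * p))) \<partial>lborel)"
        unfolding I_def F_def a_def b_def D_def n_def by (rule nn_integral_ball_ray[OF p x elim])
      have "- z \<noteq> 0" using elim by simp
      from nn_integral_ball_ray[OF p x this]
      have I2: "I (- z) = ennreal (n powr (2 - real ?d)) * (\<integral>\<^sup>+r. ennreal (indicator {0<..<b} r * (((b - r) * (r + a)) powr p * r powr (1 - 2 * p))) \<partial>lborel)"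
        unfolding I_def F_def a_def b_def D_def n_def by simp
      have IZ: "I z + I (- z) = ennreal (n powr (2 - real ?d)) * ennreal (c * ((a + b)\<^sup>2 - (2 * p - 1) * (a - b)\<^sup>2) / 4)"
        unfolding I1 I2 c_def nn_integral_chord[OF p ab, symmetric] by (simp add: distrib_left)
      have "(a + b)\<^sup>2 = 4 * D / (n\<^sup>2 * n\<^sup>2)"
      proof -
        have "a + b = 2 * sqrt D / n\<^sup>2" by (simp add: a_def b_def flip: add_divide_distrib)
        then show ?thesis using sD by (simp add: power_divide power_mult_distrib power2_eq_square[of "n\<^sup>2"])
      qed
      moreover have "(a - b)\<^sup>2 = 4 * (x \<bullet> z)\<^sup>2 / (n\<^sup>2 * n\<^sup>2)"
      proof -
        have "a - b = - 2 * (x \<bullet> z) / n\<^sup>2" by (simp add: a_def b_def flip: diff_divide_distrib)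
        then show ?thesis by (simp add: power_divide power_mult_distrib power2_eq_square[of "n\<^sup>2"])
      qed
      ultimately have "c * ((a + b)\<^sup>2 - (2 * p - 1) * (a - b)\<^sup>2) / 4 = c * ((D - (2 * p - 1) * (x \<bullet> z)\<^sup>2) / (n\<^sup>2 * n\<^sup>2))"
        using n by (simp add: field_simps)
      then have II: "I z + I (- z) = ennreal (n powr (2 - real ?d)) * ennreal (c * ((D - (2 * p - 1) * (x \<bullet> z)\<^sup>2) / (n\<^sup>2 * n\<^sup>2)))"
        unfolding IZ by (simp only:)
      have nn: "n ^ ?d * n powr (2 - real ?d) = n\<^sup>2"
      proof -
        have "n ^ ?d * n powr (2 - real ?d) = n powr real ?d * n powr (2 - real ?d)"
          by (simp only: powr_realpow[OF n])
        also have "\<dots> = n powr 2" by (simp flip: powr_add)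
        finally show ?thesis using n by simp
      qed
      have sq: "(D - (2 * p - 1) * (x \<bullet> z)\<^sup>2) / (n\<^sup>2 * n\<^sup>2) * n\<^sup>2 = (2 - 2 * p) * ((x \<bullet> z)\<^sup>2 / n\<^sup>2) + (\<rho>\<^sup>2 - (norm x)\<^sup>2)"
        unfolding D_def using n by (simp add: field_simps)
      have nn0: "0 \<le> c * ((D - (2 * p - 1) * (x \<bullet> z)\<^sup>2) / (n\<^sup>2 * n\<^sup>2))"
      proof -
        have "(2 * p - 1) * (x \<bullet> z)\<^sup>2 \<le> 1 * (x \<bullet> z)\<^sup>2" using p by (intro mult_right_mono) auto
        then show ?thesis using c D by simp
      qed
      have "E z * I z + E z * I (- z) = indicator ?C z * (ennreal (n ^ ?d) * (I z + I (- z)))"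
        by (simp add: E_def n_def[symmetric] distrib_left mult.assoc)
      also have "ennreal (n ^ ?d) * (I z + I (- z)) = ennreal (n ^ ?d * n powr (2 - real ?d) * (c * ((D - (2 * p - 1) * (x \<bullet> z)\<^sup>2) / (n\<^sup>2 * n\<^sup>2))))"
      proof -
        have "ennreal A * (ennreal B * ennreal X) = ennreal (A * B * X)" if "0 \<le> A" "0 \<le> B" "0 \<le> X" for A B X
          using that by (simp add: ennreal_mult mult.assoc)
        from this[OF _ _ nn0] show ?thesis unfolding II using n by simp
      qed
      also have "n ^ ?d * n powr (2 - real ?d) * (c * ((D - (2 * p - 1) * (x \<bullet> z)\<^sup>2) / (n\<^sup>2 * n\<^sup>2)))
         = c * ((2 - 2 * p) * ((x \<bullet> z)\<^sup>2 / n\<^sup>2) + (\<rho>\<^sup>2 - (norm x)\<^sup>2))"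
        unfolding nn sq[symmetric] by (simp only: mult_ac)
      also have "indicator ?C z * ennreal \<dots> = ennreal (q z)" by (simp add: q_def n_def indicator_def)
      finally show ?case .
    qed
  qed
  also have "\<dots> = ennreal (LBINT z. q z)" by (rule nn_integral_eq_integral[OF iq]) (simp add: q0)
  \<comment> \<open>Pairing \<open>z\<close> with \<open>- z\<close> counts every ray twice, which
    is the origin of the factor 1/2 in the result.\<close>
  finally have "2 * (\<integral>\<^sup>+z. E z * I z \<partial>lborel) = ennreal (LBINT z. q z)" by (simp add: mult_2)
  moreover have "ennreal (LBINT z. q z) = 2 * ennreal ((LBINT z. q z) / 2)"
    by (simp add: ennreal_mult'[of 2, symmetric, simplified])
  ultimately have "2 * (\<integral>\<^sup>+z. E z * I z \<partial>lborel) = 2 * ennreal ((LBINT z. q z) / 2)" by simp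
  then have "(\<integral>\<^sup>+z. E z * I z \<partial>lborel) = ennreal ((LBINT z. q z) / 2)"
    by (subst (asm) ennreal_mult_cancel_left) auto
  then have "(\<integral>\<^sup>+w. F w \<partial>lborel) = ennreal (?d * ((LBINT z. q z) / 2))"
    unfolding pol ennreal_of_nat_eq_real_of_nat by (simp only: ennreal_mult'[OF of_nat_0_le_iff])
  also have "?d * ((LBINT z. q z) / 2) = ?d * measure lborel ?C / 2 * c * (\<rho>\<^sup>2 - (norm x)\<^sup>2 * (1 - (2 - 2 * p) / ?d))"
    unfolding Iq by (simp add: field_simps)
  finally show ?thesis unfolding F_def c_def .
qed

section \<open>Convergence, continuity and local bounds for the potential of the profile\<close>

definition profile :: "real \<Rightarrow> real \<Rightarrow> 'a::euclidean_space \<Rightarrow> real" where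
  "profile p \<rho> x = (max (\<rho>\<^sup>2 - (norm x)\<^sup>2) 0) powr p"

lemma profile_measurable [measurable]: "profile p \<rho> \<in> borel_measurable borel"
  unfolding profile_def by measurable

lemma profile_nonneg: "0 \<le> profile p \<rho> x"
  by (simp add: profile_def)

lemma profile_eq_0: "0 < \<rho> \<Longrightarrow> \<rho> \<le> norm x \<Longrightarrow> profile p \<rho> x = 0"
  by (simp add: profile_def max_def power_mono)

lemma profile_le: "0 < p \<Longrightarrow> 0 < \<rho> \<Longrightarrow> profile p \<rho> x \<le> \<rho> powr (2 * p)"
proof -
  assume "0 < p" "0 < \<rho>"
  then have "profile p \<rho> x \<le> (\<rho>\<^sup>2) powr p" unfolding profile_def by (intro powr_mono2) auto
  moreover have "\<rho>\<^sup>2 = \<rho> powr 2" using \<open>0 < \<rho>\<close> by simp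
  then have "(\<rho>\<^sup>2) powr p = \<rho> powr (2 * p)" by (simp only: powr_powr)
  ultimately show ?thesis by simp
qed

lemma profile_continuous:
  assumes "0 < p"
  shows "continuous_on UNIV (profile p \<rho> :: 'a::euclidean_space \<Rightarrow> real)"
  unfolding profile_def using assms by (intro continuous_on_powr' continuous_intros) auto

lemma riesz_kernel_measurable [measurable]: "riesz_kernel \<beta> \<in> borel_measurable (borel :: 'a::euclidean_space measure)"
  unfolding riesz_kernel_def by measurable

text \<open>On bounded sets the logarithm is dominated by |z|^(-1/2), an integrable power in
  dimension one. The summand 2 serves r <= 1, and N^2 serves r > 1 through ln r <= r <= r^2
  r^(-1/2).\<close>

lemma ln_le_powr_neg_half:
  assumes "0 < (r::real)" "r \<le> N"
  shows "\<bar>ln r\<bar> \<le> (2 + N\<^sup>2) * r powr (- 1 / 2)"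
proof (cases "r \<le> 1")
  case True
  have "- ln r = 2 * ln (r powr (- 1 / 2))" using assms by (simp add: ln_powr)
  also have "\<dots> \<le> 2 * r powr (- 1 / 2)" using assms ln_bound[of "r powr (- 1 / 2)"] by simp
  also have "\<dots> \<le> (2 + N\<^sup>2) * r powr (- 1 / 2)" by (intro mult_right_mono) auto
  finally show ?thesis using True assms by (simp add: abs_if)
next
  case False
  have "ln r \<le> r" using assms by (simp add: ln_bound)
  also have "r \<le> r powr (3 / 2)" using False powr_mono[of 1 "3 / 2" r] by simp
  also have "r powr (3 / 2) = r\<^sup>2 * r powr (- 1 / 2)"
    using assms by (simp add: powr_add[of r 2 "- 1 / 2", simplified])
  also have "\<dots> \<le> (2 + N\<^sup>2) * r powr (- 1 / 2)"
    using assms power_mono[of r N 2] by (intro mult_right_mono) (simp_all add: add_increasing)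
  finally show ?thesis using False by simp
qed

lemma riesz_kernel_locally_integrable:
  assumes \<beta>: "0 < \<beta>" and N: "0 < N"
  shows "integrable lborel (\<lambda>z::'a::euclidean_space. indicator (cball 0 N) z * riesz_kernel \<beta> z)"
proof (cases "DIM('a) = 1 \<and> \<beta> = 1")
  case True
  have "integrable lborel (\<lambda>z::'a. (2 + N\<^sup>2) / pi * (indicator (cball 0 N) z * norm z powr (1 / 2 - DIM('a))))"
    by (intro integrable_mult_right integrable_norm_powr_cball N) simp
  then show ?thesis
  proof (rule Bochner_Integration.integrable_bound)
    show "AE z in lborel. norm (indicator (cball 0 N) z * riesz_kernel \<beta> z)
        \<le> norm ((2 + N\<^sup>2) / pi * (indicator (cball (0::'a) N) z * norm z powr (1 / 2 - DIM('a))))"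
    proof (rule AE_I2)
      fix z :: 'a
      show "norm (indicator (cball 0 N) z * riesz_kernel \<beta> z)
        \<le> norm ((2 + N\<^sup>2) / pi * (indicator (cball (0::'a) N) z * norm z powr (1 / 2 - DIM('a))))"
      proof (cases "z = 0 \<or> norm z > N")
        case False
        then show ?thesis
          using ln_le_powr_neg_half[of "norm z" N] True
          by (simp add: riesz_kernel_def divide_right_mono)
      qed (use True in \<open>auto simp: riesz_kernel_def\<close>)
    qed
  qed measurable
next
  case False
  have "integrable lborel (\<lambda>z::'a. riesz_const DIM('a) \<beta> * (indicator (cball 0 N) z * norm z powr (\<beta> - DIM('a))))"
    by (intro integrable_mult_right integrable_norm_powr_cball N \<beta>)
  moreover have "riesz_kernel \<beta> = (\<lambda>z::'a. riesz_const DIM('a) \<beta> * norm z powr (\<beta> - DIM('a)))"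
    using False by (auto simp: riesz_kernel_def fun_eq_iff)
  ultimately show ?thesis by (simp only: mult.left_commute)
qed

text \<open>The profile lives in the ball of radius \<rho>, so only |z| <= M + N contributes. The
  majorant does not depend on the point or on the radius: it dominates limits in \<open>x\<close>
  and gives bounds uniform in time, where the radius varies.\<close>

lemma riesz_integrand_bound:
  assumes p: "0 < p" and \<rho>: "0 < \<rho>" "\<rho> \<le> N" and x: "norm x \<le> M"
  shows "\<bar>riesz_kernel \<beta> z * profile p \<rho> (x + z)\<bar>
     \<le> \<bar>N powr (2 * p) * (indicator (cball (0::'a::euclidean_space) (M + N)) z * riesz_kernel \<beta> z)\<bar>"
proof (cases "norm z \<le> M + N")
  case True
  have "profile p \<rho> (x + z) \<le> N powr (2 * p)"
    using profile_le[OF p \<rho>(1)] powr_mono2[of "2 * p" \<rho> N] p \<rho> by (meson order_trans less_imp_le mult_pos_pos zero_less_numeral)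
  then show ?thesis using True profile_nonneg[of p \<rho> "x + z"]
    by (simp add: abs_mult mult.commute mult_left_mono)
next
  case False
  have "norm z \<le> norm (x + z) + norm x" using norm_triangle_ineq4[of "x + z" x] by simp
  then have "\<rho> \<le> norm (x + z)" using False x \<rho> by linarith
  then have "profile p \<rho> (x + z) = 0" by (rule profile_eq_0[OF \<rho>(1)])
  then show ?thesis by simp
qed

lemma riesz_integrable:
  fixes x :: "'a::euclidean_space"
  assumes p: "0 < p" and \<beta>: "0 < \<beta>" and \<rho>: "0 < \<rho>"
  shows "integrable lborel (\<lambda>z. riesz_kernel \<beta> z * profile p \<rho> (x + z))"
proof (rule Bochner_Integration.integrable_bound)
  show "integrable lborel (\<lambda>z::'a. \<rho> powr (2 * p) * (indicator (cball 0 (norm x + \<rho>)) z * riesz_kernel \<beta> z))"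
    by (intro integrable_mult_right riesz_kernel_locally_integrable \<beta>) (use \<rho> in \<open>simp add: add_nonneg_pos\<close>)
  show "AE z in lborel. norm (riesz_kernel \<beta> z * profile p \<rho> (x + z))
     \<le> norm (\<rho> powr (2 * p) * (indicator (cball 0 (norm x + \<rho>)) z * riesz_kernel \<beta> z))"
    using riesz_integrand_bound[OF p \<rho> order_refl order_refl] by (intro AE_I2) simp
qed measurable

lemma riesz_potential_continuous:
  assumes p: "0 < p" and \<beta>: "0 < \<beta>" and \<rho>: "0 < \<rho>"
  shows "continuous_on UNIV (riesz_potential \<beta> (profile p \<rho>) :: 'a::euclidean_space \<Rightarrow> real)"
  unfolding continuous_on_sequentially
proof (intro allI ballI impI)
  fix X :: "nat \<Rightarrow> 'a" and x assume X: "(\<forall>n. X n \<in> UNIV) \<and> X \<longlonglongrightarrow> x"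
  then have Xx: "X \<longlonglongrightarrow> x" by simp
  obtain M where M: "0 < M" "\<And>n. norm (X n) \<le> M"
    using convergent_imp_Bseq[of X] Xx unfolding convergent_def Bseq_def by blast
  have "(\<lambda>n. LBINT z. riesz_kernel \<beta> z * profile p \<rho> (X n + z)) \<longlonglongrightarrow> (LBINT z. riesz_kernel \<beta> z * profile p \<rho> (x + z))"
  proof (rule integral_dominated_convergence)
    show "integrable lborel (\<lambda>z::'a. \<bar>\<rho> powr (2 * p) * (indicator (cball 0 (M + \<rho>)) z * riesz_kernel \<beta> z)\<bar>)"
      by (intro integrable_abs integrable_mult_right riesz_kernel_locally_integrable \<beta>) (use \<rho> M in simp)
    show "AE z in lborel. (\<lambda>n. riesz_kernel \<beta> z * profile p \<rho> (X n + z)) \<longlonglongrightarrow> riesz_kernel \<beta> z * profile p \<rho> (x + z)"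
    proof (rule AE_I2)
      fix z
      have "isCont (profile p \<rho>) (x + z)" using profile_continuous[OF p, where 'a = 'a] by (simp add: continuous_on_eq_continuous_at)
      moreover have "(\<lambda>n. X n + z) \<longlonglongrightarrow> x + z" by (intro tendsto_intros Xx)
      ultimately have "(\<lambda>n. profile p \<rho> (X n + z)) \<longlonglongrightarrow> profile p \<rho> (x + z)" by (rule isCont_tendsto_compose)
      then show "(\<lambda>n. riesz_kernel \<beta> z * profile p \<rho> (X n + z)) \<longlonglongrightarrow> riesz_kernel \<beta> z * profile p \<rho> (x + z)"
        by (intro tendsto_intros)
    qed
    show "AE z in lborel. norm (riesz_kernel \<beta> z * profile p \<rho> (X n + z))
        \<le> \<bar>\<rho> powr (2 * p) * (indicator (cball 0 (M + \<rho>)) z * riesz_kernel \<beta> z)\<bar>" for n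
      unfolding real_norm_def by (intro AE_I2 riesz_integrand_bound[OF p \<rho> order_refl M(2)])
  qed measurable
  then show "(riesz_potential \<beta> (profile p \<rho>) \<circ> X) \<longlonglongrightarrow> riesz_potential \<beta> (profile p \<rho>) x"
    using \<beta> by (simp add: riesz_potential_def o_def)
qed

text \<open>Uniformity in the radius is what integrability over a time strip demands, since the
  support of the solution grows with time.\<close>

lemma riesz_potential_bound:
  assumes p: "0 < p" and \<beta>: "0 < \<beta>" and N: "0 < N"
  shows "\<exists>B. \<forall>\<rho> x. 0 < \<rho> \<longrightarrow> \<rho> \<le> N \<longrightarrow> norm x \<le> N \<longrightarrow> \<bar>riesz_potential \<beta> (profile p \<rho>) (x::'a::euclidean_space)\<bar> \<le> B"
proof (intro exI allI impI)
  fix \<rho> :: real and x :: 'a assume \<rho>: "0 < \<rho>" "\<rho> \<le> N" and x: "norm x \<le> N"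
  have "norm (LBINT z. riesz_kernel \<beta> z * profile p \<rho> (x + z)) \<le>
     (LBINT z. \<bar>N powr (2 * p) * (indicator (cball (0::'a) (N + N)) z * riesz_kernel \<beta> z)\<bar>)"
  proof (rule Bochner_Integration.integral_norm_bound_integral)
    show "integrable lborel (\<lambda>z. riesz_kernel \<beta> z * profile p \<rho> (x + z))" by (rule riesz_integrable[OF p \<beta> \<rho>(1)])
    show "integrable lborel (\<lambda>z::'a. \<bar>N powr (2 * p) * (indicator (cball 0 (N + N)) z * riesz_kernel \<beta> z)\<bar>)"
      by (intro integrable_abs integrable_mult_right riesz_kernel_locally_integrable \<beta>) (use N in simp)
  qed (use riesz_integrand_bound[OF p \<rho> x] in simp)
  then show "\<bar>riesz_potential \<beta> (profile p \<rho>) x\<bar> \<le> (LBINT z. \<bar>N powr (2 * p) * (indicator (cball (0::'a) (N + N)) z * riesz_kernel \<beta> z)\<bar>)"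
    using \<beta> by (simp add: riesz_potential_def)
qed

lemma profile_pair_measurable [measurable]:
  "(\<lambda>q. profile p (fst q) (snd q)) \<in> borel_measurable (borel \<Otimes>\<^sub>M (borel :: 'a::euclidean_space measure))"
  unfolding profile_def by measurable

text \<open>Joint in radius and point: composed with the map from time to radius, it yields
  measurability on space-time strips.\<close>

lemma riesz_potential_measurable:
  "(\<lambda>q. riesz_potential \<beta> (profile p (fst q)) (snd q)) \<in> borel_measurable (borel \<Otimes>\<^sub>M (borel :: 'a::euclidean_space measure))"
proof (cases "\<beta> = 0")
  case True
  then show ?thesis unfolding riesz_potential_def by simp
next
  case False
  have "(\<lambda>q. LBINT z. riesz_kernel \<beta> z * profile p (fst q) (snd q + z)) \<in> borel_measurable (borel \<Otimes>\<^sub>M (borel :: 'a measure))"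
    unfolding profile_def by (rule lborel.borel_measurable_lebesgue_integral) measurable
  then show ?thesis using False by (simp add: riesz_potential_def)
qed

section \<open>The quadratic potential inside the ball\<close>

text \<open>The constant kappa of the potential: inside the ball the gradient of the potential of
  \<open>profile p \<rho>\<close> is -kappa x, for every radius. The constant \<open>k\<close> of
  the theorem is \<open>lam\<close> divided by it.\<close>

definition profile_rate :: "nat \<Rightarrow> real \<Rightarrow> real" where
  "profile_rate d p = 2 powr (2 * p) * Gamma (1 + p) * Gamma (d / 2 + p) / (d * Gamma (d / 2))"

lemma Gamma_three_halves: "Gamma (1 + 1/2 :: real) = sqrt pi / 2"
proof -
  have "(1/2 :: real) \<notin> \<int>\<^sub>\<le>\<^sub>0" by (auto elim!: nonpos_Ints_cases)
  from Gamma_plus1[OF this] show ?thesis by (simp add: add.commute Gamma_one_half_real)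
qed

lemma measure_cball_DIM_1:
  assumes "DIM('a::euclidean_space) = 1"
  shows "measure lborel (cball (0::'a) 1) = 2"
  using content_cball[of 1 "0::'a"] assms by simp

text \<open>Leaving \<open>ennreal\<close> requires a nonnegative right-hand side. Its last factor
  is at least \<rho>^2 - |x|^2 as p < 1, even if 1 - (2 - 2p)/d is negative, as happens for d = 1
  and p < 1/2.\<close>

lemma riesz_ball_has_integral:
  fixes x :: "'a::euclidean_space" and p :: real
  assumes p: "0 < p" "p < 1" and x: "norm x < \<rho>"
  shows "integrable lborel (\<lambda>w. norm w powr (2 - 2 * p - DIM('a)) * profile p \<rho> (x + w))"
    and "(LBINT w. norm w powr (2 - 2 * p - DIM('a)) * profile p \<rho> (x + w))
      = DIM('a) * measure lborel (cball (0::'a) 1) / 2 * (Gamma (1 + p) * Gamma (1 - p)) *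
        (\<rho>\<^sup>2 - (norm x)\<^sup>2 * (1 - (2 - 2 * p) / DIM('a)))" (is "_ = ?v")
proof -
  have nn: "(\<integral>\<^sup>+w. ennreal (norm w powr (2 - 2 * p - DIM('a)) * profile p \<rho> (x + w)) \<partial>lborel) = ennreal ?v"
    unfolding profile_def by (rule nn_integral_riesz_ball[OF p x])
  have "(norm x)\<^sup>2 < \<rho>\<^sup>2" using x by (intro power_strict_mono) auto
  moreover have "(norm x)\<^sup>2 * (1 - (2 - 2 * p) / DIM('a)) \<le> (norm x)\<^sup>2 * 1"
    using p by (intro mult_left_mono) auto
  ultimately have c: "0 \<le> \<rho>\<^sup>2 - (norm x)\<^sup>2 * (1 - (2 - 2 * p) / DIM('a))" by linarith
  have b: "0 < Gamma (1 + p) * Gamma (1 - p)" using p by (intro mult_pos_pos Gamma_real_pos) auto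
  have a: "0 \<le> DIM('a) * measure lborel (cball (0::'a) 1) / 2" by simp
  have v: "0 \<le> ?v" by (rule mult_nonneg_nonneg[OF mult_nonneg_nonneg[OF a less_imp_le[OF b]] c])
  have "integrable lborel (\<lambda>w. norm w powr (2 - 2 * p - DIM('a)) * profile p \<rho> (x + w)) \<and>
    (LBINT w. norm w powr (2 - 2 * p - DIM('a)) * profile p \<rho> (x + w)) = ?v"
    by (rule iffD1[OF nn_integral_eq_integrable]) (use nn v in \<open>auto simp: profile_nonneg\<close>)
  then show "integrable lborel (\<lambda>w. norm w powr (2 - 2 * p - DIM('a)) * profile p \<rho> (x + w))"
    and "(LBINT w. norm w powr (2 - 2 * p - DIM('a)) * profile p \<rho> (x + w)) = ?v" by blast+
qed

text \<open>A majorant for the difference quotients of r^e at e = 0, uniform in \<open>e\<close>.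
  Both cases come from 1 + s <= exp s; for r > 1 the extra factor r^e is at most
  \<open>N\<close>.\<close>

lemma powr_minus_1_over_bound:
  fixes r e N :: real
  assumes r: "0 < r" "r \<le> N" and e: "0 < e" "e \<le> 1" and N: "1 \<le> N"
  shows "\<bar>(r powr e - 1) / e\<bar> \<le> (2 + N\<^sup>2) * N * r powr (- 1 / 2)"
proof -
  have "\<bar>r powr e - 1\<bar> \<le> e * \<bar>ln r\<bar> * N"
  proof (cases "r \<le> 1")
    case True
    have "r powr e = exp (e * ln r)" using r by (simp add: powr_def)
    then have "1 - r powr e \<le> - (e * ln r)" using exp_ge_add_one_self[of "e * ln r"] by linarith
    moreover have "r powr e \<le> 1" using True r e powr_le1 by simp
    moreover have "0 \<le> - (e * ln r)" using True r e by (simp add: mult_nonneg_nonpos)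
    ultimately have "\<bar>r powr e - 1\<bar> \<le> \<bar>e * ln r\<bar> * 1" by linarith
    also have "\<dots> \<le> \<bar>e * ln r\<bar> * N" using N by (intro mult_left_mono) auto
    finally show ?thesis using e by (simp add: abs_mult)
  next
    case False
    then have l: "0 < ln r" by simp
    have "1 - e * ln r \<le> exp (- (e * ln r))" using exp_ge_add_one_self[of "- (e * ln r)"] by simp
    then have "r powr e * (1 - e * ln r) \<le> r powr e * exp (- (e * ln r))" by (intro mult_left_mono) auto
    also have "\<dots> = 1" using r by (simp add: powr_def flip: exp_add)
    finally have "r powr e - 1 \<le> r powr e * (e * ln r)" by (simp add: algebra_simps)
    also have "\<dots> \<le> N * (e * ln r)"
    proof (intro mult_right_mono)
      have "r powr e \<le> r powr 1" using False e by (intro powr_mono) auto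
      then show "r powr e \<le> N" using r by simp
    qed (use e l in auto)
    finally have "r powr e - 1 \<le> N * (e * ln r)" .
    moreover have "1 \<le> r powr e" using False e by (simp add: ge_one_powr_ge_zero)
    ultimately show ?thesis using l by (simp add: mult_ac)
  qed
  also have "\<dots> \<le> e * ((2 + N\<^sup>2) * r powr (- 1 / 2)) * N"
    using ln_le_powr_neg_half[OF r] e N by (intro mult_right_mono mult_left_mono) auto
  finally show ?thesis using e by (simp add: divide_le_eq abs_divide mult_ac)
qed

text \<open>The logarithmic kernel is the derivative of \<open>|w|\<^sup>\<epsilon>\<close> at \<open>\<epsilon> = 0\<close>; subtracting the potential at \<open>0\<close>
  removes the divergent constant.\<close>

lemma log_potential_ball:
  fixes x :: "'a::euclidean_space"
  assumes d: "DIM('a) = 1" and x: "norm x < \<rho>"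
  shows "(LBINT w. (profile (1/2) \<rho> (x + w) - profile (1/2) \<rho> w) * ln (norm w)) = pi / 2 * (norm x)\<^sup>2"
proof -
  \<comment> \<open>The exponents \<open>P n\<close> are chosen so that in dimension one the power
    kernel is exactly |w|^(e n), while \<open>P n\<close> tends to 1/2. The shift by 2 keeps
    \<open>P n\<close> positive.\<close>
  define e where "e n = 1 / real (n + 2)" for n :: nat
  define P where "P n = 1 / 2 - e n / 2" for n
  have e: "0 < e n" "e n \<le> 1 / 2" for n by (auto simp: e_def field_simps)
  have P: "0 < P n" "P n < 1" "1 - 2 * P n = e n" for n using e[of n] by (auto simp: P_def)
  have elim: "e \<longlonglongrightarrow> 0" unfolding e_def using LIMSEQ_ignore_initial_segment[OF lim_1_over_n, of 2] by simp
  have Plim: "P \<longlonglongrightarrow> 1 / 2" unfolding P_def using tendsto_diff[OF tendsto_const[of "1/2"] tendsto_divide[OF elim tendsto_const[of 2]]] by simp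
  have \<rho>: "0 < \<rho>" using x norm_ge_zero[of x] by linarith
  \<comment> \<open>Beyond this radius both \<open>w\<close> and \<open>x + w\<close> lie outside
    the ball; the added 1 gives \<open>1 \<le> N\<close> for the majorant.\<close>
  define N where "N = norm x + \<rho> + 1"
  have N: "1 \<le> N" using \<rho> by (simp add: N_def)
  define B where "B = 2 * (\<rho>\<^sup>2 + 1)"
  let ?f = "\<lambda>n w. profile (P n) \<rho> (x + w) - profile (P n) \<rho> w"
  have fb: "\<bar>?f n w\<bar> \<le> B * indicator (cball 0 N) w" for n w
  proof (cases "norm w \<le> N")
    case True
    have "profile (P n) \<rho> v \<le> \<rho>\<^sup>2 + 1" for v :: 'a
    proof -
      have "profile (P n) \<rho> v \<le> (\<rho>\<^sup>2) powr P n" unfolding profile_def using P by (intro powr_mono2) (auto intro: less_imp_le)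
      also have "\<dots> \<le> (\<rho>\<^sup>2 + 1) powr P n" using P by (intro powr_mono2) (auto intro: less_imp_le)
      also have "\<dots> \<le> (\<rho>\<^sup>2 + 1) powr 1" using P by (intro powr_mono) (auto intro: less_imp_le)
      finally show ?thesis by (simp add: add_nonneg_nonneg)
    qed
    from this[of "x + w"] this[of w] show ?thesis
      using True profile_nonneg[of "P n" \<rho> w] profile_nonneg[of "P n" \<rho> "x + w"] by (simp add: B_def)
  next
    case False
    have "norm w \<le> norm (x + w) + norm x" using norm_triangle_ineq4[of "x + w" x] by simp
    then have "\<rho> \<le> norm (x + w)" "\<rho> \<le> norm w" using False norm_ge_zero[of x] unfolding N_def by linarith+
    then show ?thesis using False by (simp add: profile_eq_0[OF \<rho>])
  qed
  have val: "(LBINT w. norm w powr e n * profile (P n) \<rho> (y + w)) = Gamma (1 + P n) * Gamma (1 - P n) * (\<rho>\<^sup>2 + e n * (norm y)\<^sup>2)"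
    and ival: "integrable lborel (\<lambda>w. norm w powr e n * profile (P n) \<rho> (y + w))"
    if "norm y < \<rho>" for n and y :: 'a
  proof -
    have h1: "2 - 2 * P n - real DIM('a) = e n" and h2: "1 - (2 - 2 * P n) / real DIM('a) = - e n"
      using P(3)[of n] d by simp_all
    show "integrable lborel (\<lambda>w. norm w powr e n * profile (P n) \<rho> (y + w))"
      using riesz_ball_has_integral(1)[OF P(1,2) that, of n] unfolding h1 .
    show "(LBINT w. norm w powr e n * profile (P n) \<rho> (y + w)) = Gamma (1 + P n) * Gamma (1 - P n) * (\<rho>\<^sup>2 + e n * (norm y)\<^sup>2)"
      using riesz_ball_has_integral(2)[OF P(1,2) that, of n] unfolding h1 h2 measure_cball_DIM_1[OF d] unfolding d
      by (simp add: mult.commute)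
  qed
  have iprof: "integrable lborel (profile (P n) \<rho> :: 'a \<Rightarrow> real)" for n
    by (rule integrable_bounded_support[of _ \<rho> "\<rho> powr (2 * P n)"])
       (auto simp: profile_eq_0[OF \<rho>] profile_le[OF P(1) \<rho>] profile_nonneg abs_of_nonneg)
  \<comment> \<open>Both profiles have the same integral by translation invariance, so the -1 in the
    quotient costs nothing. In dimension one the coefficient of the squared norm is
    \<open>e n\<close>, which the division cancels.\<close>
  have eqn: "(LBINT w. ?f n w * ((norm w powr e n - 1) / e n)) = Gamma (1 + P n) * Gamma (1 - P n) * (norm x)\<^sup>2" for n
  proof -
    have v0: "(LBINT w::'a. norm w powr e n * profile (P n) \<rho> w) = Gamma (1 + P n) * Gamma (1 - P n) * (\<rho>\<^sup>2 + e n * 0)"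
      and i0: "integrable lborel (\<lambda>w::'a. norm w powr e n * profile (P n) \<rho> w)"
      using val[of 0 n] ival[of 0 n] \<rho> by simp_all
    note i1 = ival[OF x, of n] and i2 = integrable_translate[OF iprof[of n], of x] and i3 = iprof[of n]
    have "(LBINT w. ?f n w * ((norm w powr e n - 1) / e n))
      = (LBINT w. ((norm w powr e n * profile (P n) \<rho> (x + w) - norm w powr e n * profile (P n) \<rho> w)
           - (profile (P n) \<rho> (x + w) - profile (P n) \<rho> w)) / e n)"
      using e(1)[of n] by (intro Bochner_Integration.integral_cong refl) (simp add: field_simps)
    also have "\<dots> = ((LBINT w. norm w powr e n * profile (P n) \<rho> (x + w)) - (LBINT w::'a. norm w powr e n * profile (P n) \<rho> w)
           - ((LBINT w. profile (P n) \<rho> (x + w)) - (LBINT w::'a. profile (P n) \<rho> w))) / e n"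
      using i0 i1 i2 i3 by simp
    also have "\<dots> = Gamma (1 + P n) * Gamma (1 - P n) * (norm x)\<^sup>2"
      unfolding val[OF x] v0 integral_translate[OF profile_measurable] using e(1)[of n] by (simp add: field_simps)
    finally show ?thesis .
  qed
  have "(\<lambda>n. LBINT w. ?f n w * ((norm w powr e n - 1) / e n)) \<longlonglongrightarrow> (LBINT w. (profile (1/2) \<rho> (x + w) - profile (1/2) \<rho> w) * ln (norm w))"
  proof (rule integral_dominated_convergence)
    show "integrable lborel (\<lambda>w::'a. B * ((2 + N\<^sup>2) * N) * (indicator (cball 0 N) w * norm w powr (1 / 2 - DIM('a))))"
      by (intro integrable_mult_right integrable_norm_powr_cball) (use N in auto)
    have AE0: "AE w in lborel. w \<noteq> (0::'a)" by (rule AE_lborel_singleton)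
    show "AE w in lborel. norm (?f n w * ((norm w powr e n - 1) / e n)) \<le> B * ((2 + N\<^sup>2) * N) * (indicator (cball 0 N) w * norm w powr (1 / 2 - DIM('a)))" for n
      using AE0
    proof eventually_elim
      case (elim w)
      have B0: "0 \<le> B" by (simp add: B_def)
      show ?case
      proof (cases "norm w \<le> N")
        case True
        have "\<bar>?f n w\<bar> * \<bar>(norm w powr e n - 1) / e n\<bar> \<le> B * ((2 + N\<^sup>2) * N * norm w powr (- 1 / 2))"
          using fb[of n w] powr_minus_1_over_bound[of "norm w" N "e n"] True elim e[of n] N B0
          by (intro mult_mono) auto
        then show ?thesis using True d by (simp add: abs_mult mult_ac)
      next
        case False
        then have "?f n w = 0" using fb[of n w] by simp
        then show ?thesis using False by simp
      qed
    qed
    show "AE w in lborel. (\<lambda>n. ?f n w * ((norm w powr e n - 1) / e n)) \<longlonglongrightarrow> (profile (1/2) \<rho> (x + w) - profile (1/2) \<rho> w) * ln (norm w)"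
      using AE0
    proof eventually_elim
      case (elim w)
      have prof: "(\<lambda>n. profile (P n) \<rho> v) \<longlonglongrightarrow> profile (1/2) \<rho> v" for v :: 'a
      proof (cases "max (\<rho>\<^sup>2 - (norm v)\<^sup>2) 0 = 0")
        case False
        then show ?thesis unfolding profile_def by (intro tendsto_powr tendsto_const Plim) auto
      qed (simp add: profile_def)
      have "((\<lambda>t. norm w powr t) has_real_derivative ln (norm w)) (at 0)"
        using elim by (simp add: powr_def) (auto intro!: derivative_eq_intros)
      then have "((\<lambda>h. (norm w powr (0 + h) - norm w powr 0) / h) \<longlongrightarrow> ln (norm w)) (at 0)"
        unfolding DERIV_def .
      moreover have "filterlim e (at 0) sequentially"
        unfolding filterlim_at using elim \<open>e \<longlonglongrightarrow> 0\<close> e(1) by (auto intro!: always_eventually simp: less_imp_neq[symmetric] order_less_imp_not_eq2)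
      ultimately have "(\<lambda>n. (norm w powr (0 + e n) - norm w powr 0) / e n) \<longlonglongrightarrow> ln (norm w)"
        by (rule filterlim_compose)
      then have "(\<lambda>n. (norm w powr e n - 1) / e n) \<longlonglongrightarrow> ln (norm w)" using elim by simp
      then show ?case by (intro tendsto_intros prof)
    qed
  qed measurable
  moreover have "(\<lambda>n. Gamma (1 + P n) * Gamma (1 - P n) * (norm x)\<^sup>2) \<longlonglongrightarrow> Gamma (1 + 1/2) * Gamma (1 - 1/2) * (norm x)\<^sup>2"
    by (intro tendsto_intros Plim) (auto elim!: nonpos_Ints_cases)
  ultimately have "(LBINT w. (profile (1/2) \<rho> (x + w) - profile (1/2) \<rho> w) * ln (norm w)) = Gamma (1 + 1/2) * Gamma (1 - 1/2) * (norm x)\<^sup>2"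
    unfolding eqn by (rule LIMSEQ_unique)
  also have "Gamma (1 + 1/2 :: real) = sqrt pi / 2" by (rule Gamma_three_halves)
  also have "Gamma (1 - 1/2 :: real) = sqrt pi" by (simp add: Gamma_one_half_real)
  finally show ?thesis by simp
qed

text \<open>The factor 1 - (2 - 2p)/d is 2g/d with g = d/2 - 1 + p, and Gamma(g) comes from
  \<open>riesz_const\<close>; together they give Gamma(g + 1) = Gamma(d/2 + p). The excluded case is
  g = 0, the pole where the logarithm takes over. For d = 1 and p < 1/2 both g and Gamma(g) are
  negative.\<close>

lemma riesz_const_rate:
  fixes p :: real
  assumes d: "0 < d" and p: "0 < p" "p < 1" and nl: "\<not> (d = 1 \<and> p = 1 / 2)"
  shows "riesz_const d (2 - 2 * p) * (d * unit_ball_vol d / 2 * (Gamma (1 + p) * Gamma (1 - p)) * (1 - (2 - 2 * p) / d))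
    = profile_rate d p / 2"
proof -
  let ?h = "real d / 2"
  have h: "0 < ?h" using d by simp
  define g where "g = ?h - 1 + p"
  have "g \<notin> \<int>\<^sub>\<le>\<^sub>0"
  proof
    assume "g \<in> \<int>\<^sub>\<le>\<^sub>0"
    then obtain k :: nat where k: "g = - real k" by (elim nonpos_Ints_cases')
    have "d = 1"
    proof (rule ccontr)
      assume "d \<noteq> 1"
      then have "2 \<le> real d" using d by simp
      then show False using k p by (simp add: g_def)
    qed
    then have "p = 1 / 2 - real k" using k by (simp add: g_def)
    then show False using p nl \<open>d = 1\<close> by (cases k) auto
  qed
  then have G: "Gamma (?h + p) = g * Gamma g" using Gamma_plus1[of g] by (simp add: g_def algebra_simps)
  have G2: "Gamma (?h + 1) = ?h * Gamma ?h"
    by (rule Gamma_plus1) (use h in \<open>auto elim!: nonpos_Ints_cases'\<close>)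
  have pos: "0 < Gamma (1 - p)" "0 < Gamma ?h" using p h by (auto intro: Gamma_real_pos)
  have e1: "(real d - (2 - 2 * p)) / 2 = g" "(2 - 2 * p) / 2 = 1 - p" by (simp_all add: g_def field_simps)
  have e2: "2 powr (2 - 2 * p) * 2 powr (2 * p) = (4::real)" by (simp flip: powr_add)
  have e3: "real d * (1 - (2 - 2 * p) / d) = 2 * g" using d by (simp add: g_def field_simps)
  have "riesz_const d (2 - 2 * p) * (d * unit_ball_vol d / 2 * (Gamma (1 + p) * Gamma (1 - p)) * (1 - (2 - 2 * p) / d))
     = riesz_const d (2 - 2 * p) * (unit_ball_vol d / 2 * (Gamma (1 + p) * Gamma (1 - p)) * (real d * (1 - (2 - 2 * p) / d)))"
    by (simp only: mult_ac times_divide_eq_left times_divide_eq_right)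
  also have "\<dots> = Gamma g * g * Gamma (1 + p) / (2 powr (2 - 2 * p) * Gamma (?h + 1))"
    unfolding e3 riesz_const_def e1 unit_ball_vol_def using pos by (simp add: field_simps)
  also have "\<dots> = Gamma (?h + p) * Gamma (1 + p) / (2 powr (2 - 2 * p) * (?h * Gamma ?h))"
    unfolding G G2 by (simp add: mult_ac)
  also have "\<dots> = 2 powr (2 * p) * (Gamma (?h + p) * Gamma (1 + p)) / ((2 powr (2 - 2 * p) * 2 powr (2 * p)) * (?h * Gamma ?h))"
    by simp
  also have "\<dots> = profile_rate d p / 2" unfolding e2 profile_rate_def using d pos by (simp add: field_simps)
  finally show ?thesis .
qed

text \<open>The additive constant is left existential because only the gradient matters. In the
  logarithmic case it is the value at the centre, as only differences of the potential are known
  there.\<close>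

lemma riesz_potential_inside:
  assumes p: "0 < p" "p < 1" and \<rho>: "0 < \<rho>"
  shows "\<exists>c. \<forall>x::'a::euclidean_space. norm x < \<rho> \<longrightarrow>
    riesz_potential (2 - 2 * p) (profile p \<rho>) x = c - profile_rate DIM('a) p / 2 * (norm x)\<^sup>2"
proof (cases "DIM('a) = 1 \<and> p = 1 / 2")
  case True
  then have p': "p = 1 / 2" and d: "DIM('a) = 1" by auto
  let ?V = "riesz_potential (2 - 2 * p) (profile p \<rho>) :: 'a \<Rightarrow> real"
  have profile_rate: "profile_rate DIM('a) p = 1"
    using Gamma_three_halves by (simp add: profile_rate_def p' d Gamma_one_half_real)
  have K: "riesz_kernel (2 - 2 * p) z = - ln (norm z) / pi" for z :: 'a
    using d by (simp add: riesz_kernel_def p')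
  have int: "integrable lborel (\<lambda>z. riesz_kernel (2 - 2 * p) z * profile p \<rho> (x + z))" for x :: 'a
    by (rule riesz_integrable) (use p \<rho> in auto)
  have int0: "integrable lborel (\<lambda>z::'a. riesz_kernel (2 - 2 * p) z * profile p \<rho> z)" using int[of 0] by simp
  have "?V x = ?V 0 - profile_rate DIM('a) p / 2 * (norm x)\<^sup>2" if x: "norm x < \<rho>" for x
  proof -
    have "?V x - ?V 0 = (LBINT z. riesz_kernel (2 - 2 * p) z * profile p \<rho> (x + z) - riesz_kernel (2 - 2 * p) z * profile p \<rho> z)"
      unfolding riesz_potential_def using p int[of x] int0 by simp
    also have "\<dots> = (LBINT z. (- 1 / pi) * ((profile (1/2) \<rho> (x + z) - profile (1/2) \<rho> z) * ln (norm z)))"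
      unfolding K by (intro Bochner_Integration.integral_cong refl) (simp add: p' field_simps)
    also have "\<dots> = (- 1 / pi) * (LBINT z. (profile (1/2) \<rho> (x + z) - profile (1/2) \<rho> z) * ln (norm z))"
      by (rule integral_mult_right_zero)
    also have "\<dots> = - (norm x)\<^sup>2 / 2" unfolding log_potential_ball[OF d x] by simp
    finally show ?thesis by (simp add: profile_rate)
  qed
  then show ?thesis by blast
next
  case False
  let ?d = "DIM('a)"
  let ?A = "?d * unit_ball_vol ?d / 2 * (Gamma (1 + p) * Gamma (1 - p))"
  have vol: "measure lborel (cball (0::'a) 1) = unit_ball_vol ?d" using content_cball[of 1 "0::'a"] by simp
  have K: "riesz_kernel (2 - 2 * p) z = riesz_const ?d (2 - 2 * p) * norm z powr (2 - 2 * p - ?d)" for z :: 'a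
    using False by (auto simp: riesz_kernel_def)
  have "riesz_potential (2 - 2 * p) (profile p \<rho>) x = riesz_const ?d (2 - 2 * p) * ?A * \<rho>\<^sup>2 - profile_rate ?d p / 2 * (norm x)\<^sup>2"
    if x: "norm x < \<rho>" for x :: 'a
  proof -
    have "riesz_potential (2 - 2 * p) (profile p \<rho>) x = (LBINT z. riesz_const ?d (2 - 2 * p) * (norm z powr (2 - 2 * p - ?d) * profile p \<rho> (x + z)))"
      unfolding riesz_potential_def K using p by (simp add: mult.assoc)
    also have "\<dots> = riesz_const ?d (2 - 2 * p) * (LBINT z. norm z powr (2 - 2 * p - ?d) * profile p \<rho> (x + z))"
      by (rule integral_mult_right_zero)
    also have "\<dots> = riesz_const ?d (2 - 2 * p) * (?A * (\<rho>\<^sup>2 - (norm x)\<^sup>2 * (1 - (2 - 2 * p) / ?d)))"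
      unfolding riesz_ball_has_integral(2)[OF p x] vol ..
    also have "\<dots> = riesz_const ?d (2 - 2 * p) * ?A * \<rho>\<^sup>2 - riesz_const ?d (2 - 2 * p) * (?A * (1 - (2 - 2 * p) / ?d)) * (norm x)\<^sup>2"
      by (simp only: right_diff_distrib mult_ac)
    also have "riesz_const ?d (2 - 2 * p) * (?A * (1 - (2 - 2 * p) / ?d)) = profile_rate ?d p / 2"
      by (rule riesz_const_rate) (use p False in auto)
    finally show ?thesis .
  qed
  then show ?thesis by blast
qed

section \<open>The gradient of the potential on both sides of the sphere\<close>

text \<open>For \<open>p = 1\<close> the potential is the identity; the slope \<open>0\<close> makes the formula for
  \<open>profile_grad\<close> below valid in this case too.\<close>

definition kernel_slope :: "nat \<Rightarrow> real \<Rightarrow> real" where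
  "kernel_slope d p = (if p = 1 then 0 else if d = 1 \<and> p = 1 / 2 then - 1 / pi
     else riesz_const d (2 - 2 * p) * (2 - 2 * p - d))"

text \<open>The logarithm fits the pattern of the powers: its gradient has exponent -2 = -2p - d,
  with slope -1/pi. One formula then covers all kernels.\<close>

lemma riesz_kernel_GDERIV:
  fixes w :: "'a::euclidean_space"
  assumes w: "w \<noteq> 0" and p: "p \<noteq> 1"
  shows "GDERIV (riesz_kernel (2 - 2 * p)) w :> (kernel_slope DIM('a) p * norm w powr (- 2 * p - DIM('a))) *\<^sub>R w"
proof -
  let ?d = "real DIM('a)"
  have n: "0 < norm w" using w by simp
  show ?thesis
  proof (cases "DIM('a) = 1 \<and> p = 1 / 2")
    case True
    have "((\<lambda>r. - ln r / pi) has_real_derivative - (1 / norm w) / pi) (at (norm w))"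
      using n by (auto intro!: derivative_eq_intros)
    from GDERIV_DERIV_compose[OF GDERIV_norm[OF w] this]
    have "GDERIV (\<lambda>w. - ln (norm w) / pi) w :> (- (1 / norm w) / pi) *\<^sub>R sgn w" .
    moreover have "riesz_kernel (2 - 2 * p) = (\<lambda>w::'a. - ln (norm w) / pi)" using True by (simp add: riesz_kernel_def fun_eq_iff)
    moreover have "norm w powr (- 2 * p - DIM('a)) = 1 / (norm w * norm w)"
    proof -
      have "- 2 * p - DIM('a) = - 2" using True by simp
      moreover have "norm w powr (- 2) = 1 / (norm w * norm w)"
        using n powr_minus[of "norm w" 2] by (simp add: power2_eq_square inverse_eq_divide)
      ultimately show ?thesis by (simp only:)
    qed
    moreover have "kernel_slope DIM('a) p = - 1 / pi" using True p by (simp add: kernel_slope_def)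
    moreover have "(- (1 / norm w) / pi) *\<^sub>R sgn w = (- 1 / pi * (1 / (norm w * norm w))) *\<^sub>R w"
      by (simp add: sgn_div_norm inverse_eq_divide)
    ultimately show ?thesis by (simp only:)
  next
    case False
    let ?c = "riesz_const DIM('a) (2 - 2 * p)"
    have "((\<lambda>r. ?c * r powr (2 - 2 * p - ?d)) has_real_derivative ?c * ((2 - 2 * p - ?d) * norm w powr (2 - 2 * p - ?d - 1))) (at (norm w))"
      by (intro DERIV_cmult has_real_derivative_powr n)
    from GDERIV_DERIV_compose[OF GDERIV_norm[OF w] this]
    have "GDERIV (\<lambda>w. ?c * norm w powr (2 - 2 * p - ?d)) w :> (?c * ((2 - 2 * p - ?d) * norm w powr (2 - 2 * p - ?d - 1))) *\<^sub>R sgn w" .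
    moreover have "riesz_kernel (2 - 2 * p) = (\<lambda>w::'a. ?c * norm w powr (2 - 2 * p - ?d))" using False by (auto simp: riesz_kernel_def fun_eq_iff)
    moreover have "norm w powr (2 - 2 * p - ?d - 1) = norm w powr (- 2 * p - ?d) * norm w"
      using n powr_add[of "norm w" "- 2 * p - ?d" 1] by (simp add: algebra_simps)
    moreover have "kernel_slope DIM('a) p = ?c * (2 - 2 * p - ?d)" using False p by (auto simp: kernel_slope_def)
    moreover have "(?c * ((2 - 2 * p - ?d) * (norm w powr (- 2 * p - ?d) * norm w))) *\<^sub>R sgn w
        = (?c * (2 - 2 * p - ?d) * norm w powr (- 2 * p - ?d)) *\<^sub>R w"
      using n by (simp add: sgn_div_norm)
    ultimately show ?thesis by (simp only:)
  qed
qed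

text \<open>The value 0 on the sphere is a convention on a null set, where \<open>u\<close> vanishes
  as well. Outside, the derivative is placed on the kernel, which is smooth at a positive distance
  from the ball, and not on the profile, whose derivative blows up at the sphere if p < 1.\<close>

definition profile_grad :: "real \<Rightarrow> real \<Rightarrow> 'a::euclidean_space \<Rightarrow> 'a" where
  "profile_grad p \<rho> x = (if norm x < \<rho> then - profile_rate DIM('a) p *\<^sub>R x
     else if norm x = \<rho> then 0
     else LBINT z. (profile p \<rho> z * (kernel_slope DIM('a) p * norm (z - x) powr (- 2 * p - DIM('a)))) *\<^sub>R (x - z))"

lemma profile_grad_measurable:
  "(\<lambda>q. profile_grad p (fst q) (snd q)) \<in> borel_measurable (borel \<Otimes>\<^sub>M (borel :: 'a::euclidean_space measure))"
proof -
  have [measurable]: "(\<lambda>q. LBINT z. (profile p (fst q) z * (kernel_slope DIM('a) p * norm (z - snd q) powr (- 2 * p - DIM('a)))) *\<^sub>R (snd q - z))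
     \<in> borel_measurable (borel \<Otimes>\<^sub>M (borel :: 'a::euclidean_space measure))"
    unfolding profile_def by (rule lborel.borel_measurable_lebesgue_integral) measurable
  show ?thesis unfolding profile_grad_def by measurable
qed

lemma profile_grad_integrand_norm:
  "norm ((profile p \<rho> z * (c * norm (z - x) powr (- 2 * p - d))) *\<^sub>R (x - z))
    = profile p \<rho> z * (\<bar>c\<bar> * norm (z - x) powr (1 - 2 * p - d))" for x z :: "'a::euclidean_space"
proof (cases "z = x")
  case False
  then have "norm (z - x) powr (1 - 2 * p - d) = norm (z - x) powr (- 2 * p - d) * norm (z - x)"
    using powr_add[of "norm (z - x)" "- 2 * p - d" 1] by (simp add: algebra_simps)
  then show ?thesis by (simp add: abs_mult profile_nonneg norm_minus_commute)
qed simp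

text \<open>Inside, the explicit quadratic holds on an open ball and is differentiated directly.
  Outside, the kernel is differentiated under the integral, uniformly away from its
  singularity.\<close>

lemma riesz_potential_GDERIV:
  assumes p: "0 < p" "p < 1" and \<rho>: "0 < \<rho>" and x: "norm x \<noteq> \<rho>"
  shows "GDERIV (riesz_potential (2 - 2 * p) (profile p \<rho>)) x :> profile_grad p \<rho> (x::'a::euclidean_space)"
proof (cases "norm x < \<rho>")
  case True
  obtain c where c: "\<And>x::'a. norm x < \<rho> \<Longrightarrow> riesz_potential (2 - 2 * p) (profile p \<rho>) x = c - profile_rate DIM('a) p / 2 * (norm x)\<^sup>2"
    using riesz_potential_inside[OF p \<rho>, where 'a = 'a] by blast
  have "((\<lambda>x. c - profile_rate DIM('a) p / 2 * (x \<bullet> x)) has_derivative (\<lambda>h. h \<bullet> (- profile_rate DIM('a) p *\<^sub>R x))) (at x)"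
    by (auto intro!: derivative_eq_intros simp: fun_eq_iff inner_commute)
  then have "(riesz_potential (2 - 2 * p) (profile p \<rho>) has_derivative (\<lambda>h. h \<bullet> (- profile_rate DIM('a) p *\<^sub>R x))) (at x)"
    by (rule has_derivative_transform_within_open[of _ _ _ _ "ball 0 \<rho>"]) (use True c in \<open>auto simp: power2_norm_eq_inner\<close>)
  then show ?thesis using True by (simp add: gderiv_def profile_grad_def)
next
  case False
  then have x: "\<rho> < norm x" using x by simp
  \<comment> \<open>Half of the gap: points of \<open>ball x e\<close> keep distance at least
    \<open>e\<close> from the support of the profile.\<close>
  define e where "e = (norm x - \<rho>) / 2"
  have e: "0 < e" using x by (simp add: e_def)
  let ?d = "real DIM('a)"
  let ?s = "kernel_slope DIM('a) p"
  define f where "f y z = riesz_kernel (2 - 2 * p) (z - y) * profile p \<rho> z" for y z :: 'a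
  define D where "D y z = (profile p \<rho> z * (?s * norm (z - y) powr (- 2 * p - ?d))) *\<^sub>R (y - z)" for y z :: 'a
  have [measurable]: "f y \<in> borel_measurable borel" for y unfolding f_def by measurable
  have shift: "(LBINT z. riesz_kernel (2 - 2 * p) z * profile p \<rho> (y + z)) = (LBINT z. f y z)" for y
    using integral_translate[of "f y" y] by (simp add: f_def)
  have far: "e \<le> norm (z - y)" if "y \<in> ball x e" "norm z < \<rho>" for y z
  proof -
    have "norm x \<le> norm (x - y) + norm (z - y) + norm z"
      using norm_triangle_ineq[of "x - y" "y - z"] norm_triangle_ineq[of "x - z" z] by (simp add: norm_minus_commute)
    moreover have "norm (x - y) < e" using that by (simp add: dist_norm)
    ultimately show ?thesis using that unfolding e_def by (simp add: field_simps)
  qed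
  have "GDERIV (\<lambda>y. LBINT z. f y z) x :> (LBINT z. D x z)"
  proof (rule GDERIV_integral[of e x lborel f D "\<lambda>z. profile p \<rho> z * (\<bar>?s\<bar> * e powr (1 - 2 * p - ?d))"])
    show "0 < e" by (rule e)
    have "integrable lborel (profile p \<rho> :: 'a \<Rightarrow> real)"
      by (rule integrable_bounded_support[of _ \<rho> "\<rho> powr (2 * p)"])
         (auto simp: profile_eq_0[OF \<rho>] profile_le[OF p(1) \<rho>] profile_nonneg abs_of_nonneg)
    then show "integrable lborel (\<lambda>z::'a. profile p \<rho> z * (\<bar>?s\<bar> * e powr (1 - 2 * p - ?d)))" by (rule integrable_mult_left)
    show "D x \<in> borel_measurable lborel" unfolding D_def by measurable
    fix y assume y: "y \<in> ball x e"
    have "integrable lborel (\<lambda>z. riesz_kernel (2 - 2 * p) z * profile p \<rho> (y + z))"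
      by (rule riesz_integrable) (use p \<rho> in auto)
    from integrable_translate[OF this, of "- y"] show "integrable lborel (f y)" by (simp add: f_def[abs_def])
    fix z :: 'a
    show "GDERIV (\<lambda>y. f y z) y :> D y z"
    proof (cases "norm z < \<rho>")
      case True
      then have "z - y \<noteq> 0" using far[OF y True] e by auto
      then have "(riesz_kernel (2 - 2 * p) has_derivative (\<lambda>h. h \<bullet> ((?s * norm (z - y) powr (- 2 * p - ?d)) *\<^sub>R (z - y)))) (at (z - y))"
        using riesz_kernel_GDERIV[of "z - y" p] p by (simp add: gderiv_def)
      then have "((\<lambda>y. riesz_kernel (2 - 2 * p) (z - y)) has_derivative (\<lambda>h. (- h) \<bullet> ((?s * norm (z - y) powr (- 2 * p - ?d)) *\<^sub>R (z - y)))) (at y)"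
        by (rule has_derivative_compose[where f = "\<lambda>y. z - y" and g = "riesz_kernel (2 - 2 * p)", rotated])
           (auto intro!: derivative_eq_intros)
      then have "((\<lambda>y. riesz_kernel (2 - 2 * p) (z - y) * profile p \<rho> z) has_derivative
          (\<lambda>h. (- h) \<bullet> ((?s * norm (z - y) powr (- 2 * p - ?d)) *\<^sub>R (z - y)) * profile p \<rho> z)) (at y)"
        by (rule has_derivative_mult_left)
      then show ?thesis unfolding gderiv_def f_def D_def
        by (rule has_derivative_eq_rhs) (simp add: fun_eq_iff inner_diff_right algebra_simps)
    next
      case False
      then have "profile p \<rho> z = 0" by (simp add: profile_eq_0[OF \<rho>])
      then show ?thesis by (simp add: f_def D_def GDERIV_const)
    qed
    show "norm (D y z) \<le> profile p \<rho> z * (\<bar>?s\<bar> * e powr (1 - 2 * p - ?d))"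
    proof (cases "norm z < \<rho>")
      case True
      have "1 \<le> ?d" using DIM_positive[where 'a = 'a] by linarith
      then have "1 - 2 * p - ?d \<le> 0" using p by linarith
      then have "norm (z - y) powr (1 - 2 * p - ?d) \<le> e powr (1 - 2 * p - ?d)"
        using far[OF y True] e by (intro powr_mono2') auto
      then show ?thesis unfolding D_def profile_grad_integrand_norm
        by (intro mult_left_mono) (auto simp: profile_nonneg)
    next
      case False
      then have "profile p \<rho> z = 0" by (simp add: profile_eq_0[OF \<rho>])
      then show ?thesis by (simp add: D_def)
    qed
  qed
  then show ?thesis using x p by (simp add: riesz_potential_def[abs_def] shift profile_grad_def D_def)
qed

text \<open>Up to the sphere the differentiated kernel is only |z - x|^(1-2p-d), too singular for p
  >= 1/2. On the ball the profile is at most (2N |z - x|)^p, which improves the exponent to 1 - p -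
  d; this is locally integrable exactly because p < 1. At p = 1 the slope 0 removes the outer
  part.\<close>

lemma profile_grad_bound:
  assumes p: "0 < p" "p \<le> 1" and N: "0 < N"
  shows "\<exists>B. \<forall>\<rho> x. 0 < \<rho> \<longrightarrow> \<rho> \<le> N \<longrightarrow> norm x \<le> N \<longrightarrow> norm (profile_grad p \<rho> (x::'a::euclidean_space)) \<le> B"
proof (cases "p = 1")
  case True
  show ?thesis
  proof (intro exI allI impI)
    fix \<rho> and x :: 'a assume "norm x \<le> N"
    then show "norm (profile_grad p \<rho> x) \<le> \<bar>profile_rate DIM('a) p\<bar> * N"
      using True N by (auto simp: profile_grad_def kernel_slope_def intro!: mult_left_mono)
  qed
next
  case False
  then have p1: "p < 1" using p by simp
  let ?d = "real DIM('a)"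
  let ?s = "kernel_slope DIM('a) p"
  define J where "J = (LBINT w::'a. indicator (cball 0 (2 * N)) w * norm w powr (1 - p - ?d))"
  have iJ: "integrable lborel (\<lambda>w::'a. indicator (cball 0 (2 * N)) w * norm w powr (1 - p - ?d))"
    by (rule integrable_norm_powr_cball) (use N p1 in auto)
  have J0: "0 \<le> J" unfolding J_def by (rule Bochner_Integration.integral_nonneg) simp
  define A where "A = (2 * N) powr p * \<bar>?s\<bar>"
  have A0: "0 \<le> A" by (simp add: A_def)
  show ?thesis
  proof (intro exI allI impI)
    fix \<rho> :: real and x :: 'a assume \<rho>: "0 < \<rho>" "\<rho> \<le> N" and x: "norm x \<le> N"
    have b: "norm ((profile p \<rho> z * (?s * norm (z - x) powr (- 2 * p - ?d))) *\<^sub>R (x - z))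
        \<le> A * (indicator (cball 0 (2 * N)) (- x + z) * norm (- x + z) powr (1 - p - ?d))" if out: "\<rho> < norm x" for z
    proof (cases "norm z < \<rho>")
      case True
      have lb: "\<rho> - norm z \<le> norm (z - x)" using norm_triangle_ineq2[of x z] out by (simp add: norm_minus_commute)
      have ub: "norm (z - x) \<le> 2 * N" using norm_triangle_ineq4[of z x] True x \<rho> by linarith
      have pos: "0 < norm (z - x)" using lb True by linarith
      have "\<rho>\<^sup>2 - (norm z)\<^sup>2 = (\<rho> - norm z) * (\<rho> + norm z)" by (simp add: power2_eq_square algebra_simps)
      also have "\<dots> \<le> norm (z - x) * (2 * N)" using lb True \<rho> by (intro mult_mono) auto
      finally have "profile p \<rho> z \<le> (norm (z - x) * (2 * N)) powr p"
        unfolding profile_def using p pos N by (intro powr_mono2) auto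
      also have "\<dots> = (2 * N) powr p * norm (z - x) powr p" using N by (simp add: powr_mult)
      finally have "profile p \<rho> z * (\<bar>?s\<bar> * norm (z - x) powr (1 - 2 * p - ?d))
          \<le> (2 * N) powr p * norm (z - x) powr p * (\<bar>?s\<bar> * norm (z - x) powr (1 - 2 * p - ?d))"
        by (intro mult_right_mono) auto
      also have "\<dots> = A * (norm (z - x) powr p * norm (z - x) powr (1 - 2 * p - ?d))" by (simp add: A_def)
      also have "norm (z - x) powr p * norm (z - x) powr (1 - 2 * p - ?d) = norm (z - x) powr (1 - p - ?d)"
        by (simp add: powr_add[symmetric] algebra_simps)
      finally show ?thesis unfolding profile_grad_integrand_norm using ub by simp
    next
      case False
      then have "profile p \<rho> z = 0" by (simp add: profile_eq_0[OF \<rho>(1)])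
      then show ?thesis using A0 by simp
    qed
    show "norm (profile_grad p \<rho> x) \<le> \<bar>profile_rate DIM('a) p\<bar> * N + A * J"
    proof (cases "\<rho> < norm x")
      case True
      have i: "integrable lborel (\<lambda>z. A * (indicator (cball 0 (2 * N)) (- x + z) * norm (- x + z) powr (1 - p - ?d)))"
        using integrable_translate[OF iJ, of "- x"] by simp
      have "norm (LBINT z. (profile p \<rho> z * (?s * norm (z - x) powr (- 2 * p - ?d))) *\<^sub>R (x - z))
        \<le> (LBINT z. A * (indicator (cball 0 (2 * N)) (- x + z) * norm (- x + z) powr (1 - p - ?d)))"
      proof (rule Bochner_Integration.integral_norm_bound_integral[OF _ i])
        show "integrable lborel (\<lambda>z. (profile p \<rho> z * (?s * norm (z - x) powr (- 2 * p - ?d))) *\<^sub>R (x - z))"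
          by (rule Bochner_Integration.integrable_bound[OF i])
             (measurable, intro AE_I2 order_trans[OF b[OF True]], simp)
      qed (rule b[OF True])
      also have "\<dots> = A * J" unfolding J_def
        using integral_translate[of "\<lambda>w. indicator (cball 0 (2 * N)) w * norm w powr (1 - p - ?d)" "- x"] by simp
      finally show ?thesis using True N by (simp add: profile_grad_def add_increasing)
    next
      case False
      have "\<bar>profile_rate DIM('a) p\<bar> * norm x \<le> \<bar>profile_rate DIM('a) p\<bar> * N" using x by (intro mult_left_mono) auto
      then show ?thesis using False A0 J0 N by (auto simp: profile_grad_def intro: add_increasing2)
    qed
  qed
qed

section \<open>The endpoint p = 1 and multiples of the profile\<close>

lemma profile_rate_1: "0 < d \<Longrightarrow> profile_rate d 1 = 2"
proof -
  assume d: "0 < d"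
  have "Gamma (real d / 2 + 1) = real d / 2 * Gamma (real d / 2)"
    by (rule Gamma_plus1) (use d in \<open>auto elim!: nonpos_Ints_cases'\<close>)
  then have "profile_rate d 1 = 2 powr 2 * Gamma 2 * (real d / 2 * Gamma (real d / 2)) / (d * Gamma (real d / 2))"
    by (simp only: profile_rate_def mult_1_right one_add_one)
  moreover have "Gamma (real d / 2) > 0" using d by (intro Gamma_real_pos) simp
  ultimately show ?thesis using d Gamma_numeral[of "Num.Bit0 Num.One", where 'a = real] by simp
qed

lemma profile_rate_pos: "0 < d \<Longrightarrow> 0 < p \<Longrightarrow> 0 < profile_rate d p"
  unfolding profile_rate_def by (intro divide_pos_pos mult_pos_pos Gamma_real_pos) (auto intro: add_pos_pos)

lemma riesz_converges_profile:
  assumes p: "0 < p" "p \<le> 1" and \<rho>: "0 < \<rho>"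
  shows "riesz_converges (2 - 2 * p) (\<lambda>x. c * profile p \<rho> x) (x::'a::euclidean_space)"
proof (cases "p = 1")
  case False
  then have "integrable lborel (\<lambda>z. riesz_kernel (2 - 2 * p) z * profile p \<rho> (x + z))"
    by (intro riesz_integrable) (use p \<rho> in auto)
  then have "integrable lborel (\<lambda>z. c * (riesz_kernel (2 - 2 * p) z * profile p \<rho> (x + z)))"
    by (rule integrable_mult_right)
  then show ?thesis by (simp add: riesz_converges_def mult.left_commute)
qed (simp add: riesz_converges_def)

lemma riesz_potential_cmult:
  "riesz_potential \<beta> (\<lambda>x. c * f x) x = c * riesz_potential \<beta> f x"
  unfolding riesz_potential_def by (simp add: mult.left_commute)

lemma riesz_potential_profile_GDERIV:
  assumes p: "0 < p" "p \<le> 1" and \<rho>: "0 < \<rho>" and x: "norm x \<noteq> \<rho>"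
  shows "GDERIV (riesz_potential (2 - 2 * p) (profile p \<rho>)) x :> profile_grad p \<rho> (x::'a::euclidean_space)"
proof (cases "p = 1")
  case True
  have V: "riesz_potential (2 - 2 * p) (profile p \<rho>) = (\<lambda>x::'a. max (\<rho>\<^sup>2 - (norm x)\<^sup>2) 0)"
    using True by (simp add: riesz_potential_def profile_def fun_eq_iff)
  show ?thesis
  proof (cases "norm x < \<rho>")
    case inside: True
    have "((\<lambda>x. \<rho>\<^sup>2 - x \<bullet> x) has_derivative (\<lambda>h. h \<bullet> (- 2 *\<^sub>R x))) (at x)"
      by (auto intro!: derivative_eq_intros simp: fun_eq_iff inner_commute)
    then have "((\<lambda>x. max (\<rho>\<^sup>2 - (norm x)\<^sup>2) 0) has_derivative (\<lambda>h. h \<bullet> (- 2 *\<^sub>R x))) (at x)"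
    proof (rule has_derivative_transform_within_open[of _ _ _ _ "ball 0 \<rho>"])
      fix y :: 'a assume "y \<in> ball 0 \<rho>"
      then have "(norm y)\<^sup>2 \<le> \<rho>\<^sup>2" by (intro power_mono) auto
      then show "\<rho>\<^sup>2 - y \<bullet> y = max (\<rho>\<^sup>2 - (norm y)\<^sup>2) 0" by (simp add: power2_norm_eq_inner)
    qed (use inside in auto)
    then show ?thesis unfolding V gderiv_def using inside True by (simp add: profile_grad_def profile_rate_1)
  next
    case False
    then have x: "\<rho> < norm x" using x by simp
    have "((\<lambda>x. 0) has_derivative (\<lambda>h. h \<bullet> 0)) (at x)" by simp
    then have "((\<lambda>x. max (\<rho>\<^sup>2 - (norm x)\<^sup>2) 0) has_derivative (\<lambda>h. h \<bullet> 0)) (at x)"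
    proof (rule has_derivative_transform_within_open[of _ _ _ _ "- cball 0 \<rho>"])
      fix y :: 'a assume "y \<in> - cball 0 \<rho>"
      then have "\<rho>\<^sup>2 \<le> (norm y)\<^sup>2" using \<rho> by (intro power_mono) auto
      then show "0 = max (\<rho>\<^sup>2 - (norm y)\<^sup>2) 0" by simp
    qed (use x in auto)
    then show ?thesis unfolding V gderiv_def using x True by (simp add: profile_grad_def kernel_slope_def)
  qed
next
  case False
  then show ?thesis using riesz_potential_GDERIV[of p \<rho> x] p \<rho> x by simp
qed

lemma riesz_potential_profile_continuous:
  assumes p: "0 < p" "p \<le> 1" and \<rho>: "0 < \<rho>"
  shows "continuous_on UNIV (riesz_potential (2 - 2 * p) (profile p \<rho>) :: 'a::euclidean_space \<Rightarrow> real)"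
proof (cases "p = 1")
  case True
  then show ?thesis using profile_continuous[of 1 \<rho>, where 'a = 'a] by (simp add: riesz_potential_def[abs_def])
next
  case False
  then show ?thesis by (intro riesz_potential_continuous) (use p \<rho> in auto)
qed

lemma riesz_potential_profile_bound:
  assumes p: "0 < p" "p \<le> 1" and N: "0 < N"
  shows "\<exists>B. \<forall>\<rho> x. 0 < \<rho> \<longrightarrow> \<rho> \<le> N \<longrightarrow> norm x \<le> N \<longrightarrow> \<bar>riesz_potential (2 - 2 * p) (profile p \<rho>) (x::'a::euclidean_space)\<bar> \<le> B"
proof (cases "p = 1")
  case True
  show ?thesis
  proof (intro exI allI impI)
    fix \<rho> :: real and x :: 'a assume \<rho>: "0 < \<rho>" "\<rho> \<le> N"
    have "profile p \<rho> x \<le> \<rho> powr (2 * p)" by (rule profile_le) (use p \<rho> in auto)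
    also have "\<dots> \<le> N powr (2 * p)" by (intro powr_mono2) (use p \<rho> in auto)
    finally show "\<bar>riesz_potential (2 - 2 * p) (profile p \<rho>) x\<bar> \<le> N powr (2 * p)"
      using True profile_nonneg[of 1 \<rho> x] by (simp add: riesz_potential_def)
  qed
next
  case False
  then show ?thesis by (intro riesz_potential_bound) (use p N in auto)
qed

lemma frac_gradient_profile:
  assumes p: "0 < p" "p \<le> 1" and \<rho>: "0 < \<rho>"
  shows "frac_gradient (2 * p - 1) (\<lambda>x. c * profile p \<rho> x) (\<lambda>x::'a::euclidean_space. c *\<^sub>R profile_grad p \<rho> x)"
  unfolding frac_gradient_def
proof
  have \<beta>: "1 - (2 * p - 1) = 2 - 2 * p" by simp
  show "AE x in lborel. riesz_converges (1 - (2 * p - 1)) (\<lambda>x::'a. c * profile p \<rho> x) x"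
    unfolding \<beta> by (intro AE_I2 riesz_converges_profile p \<rho>)
  have V: "riesz_potential (1 - (2 * p - 1)) (\<lambda>x::'a. c * profile p \<rho> x) = (\<lambda>x. c * riesz_potential (2 - 2 * p) (profile p \<rho>) x)"
    unfolding \<beta> by (simp add: fun_eq_iff riesz_potential_cmult)
  show "weak_gradient (riesz_potential (1 - (2 * p - 1)) (\<lambda>x::'a. c * profile p \<rho> x)) (\<lambda>x. c *\<^sub>R profile_grad p \<rho> x)"
    unfolding V
  proof (rule weak_gradient_off_sphere[where \<rho> = \<rho>])
    show "continuous_on UNIV (\<lambda>x::'a. c * riesz_potential (2 - 2 * p) (profile p \<rho>) x)"
      by (intro continuous_intros riesz_potential_profile_continuous p \<rho>)
    have "(\<lambda>x::'a. profile_grad p (fst (\<rho>, x)) (snd (\<rho>, x))) \<in> borel_measurable borel"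
      by (rule measurable_compose[OF _ profile_grad_measurable]) measurable
    then have [measurable]: "(profile_grad p \<rho> :: 'a \<Rightarrow> 'a) \<in> borel_measurable borel" by simp
    show "(\<lambda>x::'a. c *\<^sub>R profile_grad p \<rho> x) \<in> borel_measurable borel" by measurable
    show "\<exists>B. \<forall>x\<in>cball 0 N. norm (c *\<^sub>R profile_grad p \<rho> (x::'a)) \<le> B" for N
    proof -
      \<comment> \<open>The uniform bound asks for one number above both the radius and |x|.\<close>
      have "0 < max N \<rho>" using \<rho> by simp
      from profile_grad_bound[OF p this, where 'a = 'a] obtain B where
        B: "\<forall>\<rho>' x. 0 < \<rho>' \<longrightarrow> \<rho>' \<le> max N \<rho> \<longrightarrow> norm x \<le> max N \<rho> \<longrightarrow> norm (profile_grad p \<rho>' (x::'a)) \<le> B" by (rule exE)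
      show ?thesis
      proof (intro exI ballI)
        fix x :: 'a assume "x \<in> cball 0 N"
        then have "norm (profile_grad p \<rho> x) \<le> B" using B \<rho> by simp
        then show "norm (c *\<^sub>R profile_grad p \<rho> x) \<le> \<bar>c\<bar> * B" by (simp add: mult_left_mono)
      qed
    qed
    fix x :: 'a assume "norm x \<noteq> \<rho>"
    then have "(riesz_potential (2 - 2 * p) (profile p \<rho>) has_derivative (\<lambda>h. h \<bullet> profile_grad p \<rho> x)) (at x)"
      using riesz_potential_profile_GDERIV[OF p \<rho>] by (simp add: gderiv_def)
    then show "GDERIV (\<lambda>x. c * riesz_potential (2 - 2 * p) (profile p \<rho>) x) x :> c *\<^sub>R profile_grad p \<rho> x"
      unfolding gderiv_def by (rule has_derivative_eq_rhs[OF has_derivative_mult_right]) simp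
  qed
qed

section \<open>The self-similar solution\<close>

text \<open>The constant enters only through its product with the rate, which says that the field on
  the support is -(lam/t) x, and \<open>u\<close> only through its similarity form at positive
  times. The Gamma quotient is needed just once, when the locale is interpreted.\<close>

locale barenblatt =
  fixes p m R lam k :: real and \<Phi> :: "'a::euclidean_space \<Rightarrow> real" and u :: "real \<Rightarrow> 'a \<Rightarrow> real"
  assumes p: "0 < p" "p \<le> 1" and m: "1 < m" and R: "0 < R"
    and lam: "lam = 1 / (DIM('a) * (m - 1) + 2 * p)"
    and k: "k * profile_rate DIM('a) p = lam"
    and \<Phi>: "\<And>y. \<Phi> y = (k * profile p R y) powr (1 / (m - 1))"
    and u: "\<And>t x. 0 < t \<Longrightarrow> u t x = t powr (- (DIM('a) * lam)) * \<Phi> (t powr (- lam) *\<^sub>R x)"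
begin

definition radius :: "real \<Rightarrow> real" where "radius t = R * t powr lam"

text \<open>By \<open>u_powr\<close> the density to the power m - 1 is k/t times the profile of the
  current radius, so linearity gives its fractional gradient.\<close>

definition G :: "real \<Rightarrow> 'a \<Rightarrow> 'a" where "G t x = (k / t) *\<^sub>R profile_grad p (radius t) x"

lemma lam_pos: "0 < lam"
  unfolding lam using p m by (intro divide_pos_pos add_nonneg_pos) auto

lemma lam_eq: "lam * (DIM('a) * (m - 1) + 2 * p) = 1"
proof -
  have "0 < DIM('a) * (m - 1) + 2 * p" using p m by (intro add_nonneg_pos) auto
  then show ?thesis by (simp add: lam)
qed

lemma k_pos: "0 < k"
  using k lam_pos profile_rate_pos[of "DIM('a)" p] p by (metis DIM_positive zero_less_mult_pos2)

lemma radius_pos: "0 < t \<Longrightarrow> 0 < radius t"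
  using R by (simp add: radius_def)

lemma \<Phi>_nonneg: "0 \<le> \<Phi> y"
  by (simp add: \<Phi>)

lemma \<Phi>_eq_0: "R \<le> norm y \<Longrightarrow> \<Phi> y = 0"
  by (simp add: \<Phi> profile_eq_0[OF R])

lemma \<Phi>_powr: "\<Phi> y powr (m - 1) = k * profile p R y"
  using m k_pos by (simp add: \<Phi> powr_powr profile_nonneg)

lemma \<Phi>_continuous: "continuous_on UNIV \<Phi>"
proof -
  have "\<Phi> = (\<lambda>y. (k * profile p R y) powr (1 / (m - 1)))" by (simp add: \<Phi> fun_eq_iff)
  then show ?thesis using m k_pos
    by (simp only:) (intro continuous_on_powr' continuous_intros profile_continuous p; simp add: profile_nonneg)
qed

lemma \<Phi>_measurable [measurable]: "\<Phi> \<in> borel_measurable borel"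
  by (rule borel_measurable_continuous_onI[OF \<Phi>_continuous])

lemma \<Phi>_bound: obtains B where "0 \<le> B" "\<And>y. \<Phi> y \<le> B"
proof -
  obtain B where B: "\<forall>y\<in>cball 0 R. norm (\<Phi> y) \<le> B" using continuous_bounded_on_cball[OF \<Phi>_continuous] by (rule exE)
  have "\<Phi> y \<le> \<bar>B\<bar>" for y
  proof (cases "norm y \<le> R")
    case True
    then have "norm (\<Phi> y) \<le> B" using B by simp
    then show ?thesis by simp
  qed (simp add: \<Phi>_eq_0)
  then show thesis by (rule that[OF abs_ge_zero])
qed

lemma norm_less_radius: "0 < t \<Longrightarrow> norm (t powr (- lam) *\<^sub>R x) < R \<longleftrightarrow> norm x < radius t"
  by (simp add: radius_def powr_minus field_simps)

lemma u_eq_0: "0 < t \<Longrightarrow> radius t \<le> norm x \<Longrightarrow> u t x = 0"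
  using norm_less_radius[of t x] by (simp add: u \<Phi>_eq_0)

text \<open>Rescaling the profile produces t^(2 lam p), and the prefactor produces t^(-d lam (m -
  1)). The choice of \<open>lam\<close>, in the form \<open>lam_eq\<close>, is precisely what makes
  the two combine to 1/t.\<close>

lemma u_powr:
  assumes t: "0 < t"
  shows "\<bar>u t x\<bar> powr (m - 1) = k / t * profile p (radius t) x"
proof -
  have "profile p (radius t) x = t powr (2 * lam * p) * profile p R (t powr (- lam) *\<^sub>R x)"
  proof -
    have e: "t powr (2 * lam) * (t powr (- lam))\<^sup>2 = 1" "(t powr lam)\<^sup>2 = t powr (2 * lam)"
      using t by (simp_all add: power2_eq_square flip: powr_add)
    have "max ((radius t)\<^sup>2 - (norm x)\<^sup>2) 0 = t powr (2 * lam) * max (R\<^sup>2 - (norm (t powr (- lam) *\<^sub>R x))\<^sup>2) 0"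
    proof -
      have "(radius t)\<^sup>2 - (norm x)\<^sup>2 = t powr (2 * lam) * (R\<^sup>2 - (norm (t powr (- lam) *\<^sub>R x))\<^sup>2)"
        unfolding radius_def norm_scaleR power_mult_distrib right_diff_distrib e(2)
        using e(1) by (simp add: mult.assoc[symmetric])
      then show ?thesis using t by (simp add: max_mult_distrib_left)
    qed
    then show ?thesis unfolding profile_def using t by (simp add: powr_mult powr_powr)
  qed
  moreover have "\<bar>u t x\<bar> powr (m - 1) = t powr (- (DIM('a) * lam) * (m - 1)) * (k * profile p R (t powr (- lam) *\<^sub>R x))"
    using t by (simp add: u abs_mult \<Phi>_nonneg powr_mult powr_powr \<Phi>_powr)
  moreover have "t powr (- (DIM('a) * lam) * (m - 1)) = t powr (2 * lam * p) / t"
  proof -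
    have "- (DIM('a) * lam) * (m - 1) = 2 * lam * p - 1" using lam_eq by (simp add: algebra_simps)
    then show ?thesis using t by (simp add: powr_diff)
  qed
  ultimately show ?thesis by simp
qed

lemma G_inside: "norm x < radius t \<Longrightarrow> G t x = - (lam / t) *\<^sub>R x"
  using k by (simp add: G_def profile_grad_def)

text \<open>The flux is local: outside the open ball \<open>u\<close> vanishes, whatever the field
  does there.\<close>

lemma u_G: "0 < t \<Longrightarrow> u t x *\<^sub>R G t x = - (lam / t) *\<^sub>R (u t x *\<^sub>R x)"
  using G_inside[of x t] u_eq_0[of t x] by (cases "norm x < radius t") auto

lemma frac_gradient_u:
  assumes t: "0 < t"
  shows "frac_gradient (2 * p - 1) (\<lambda>x. \<bar>u t x\<bar> powr (m - 1)) (G t)"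
  using frac_gradient_profile[OF p radius_pos[OF t], of "k / t", where 'a = 'a]
  by (simp add: u_powr[OF t] G_def[abs_def])

text \<open>The fields \<Phi> G and -lam \<Phi> y coincide pointwise, so the identity of
  distributions is plain linearity.\<close>

lemma stationary:
  "\<exists>G. frac_gradient (2 * p - 1) (\<lambda>y. \<Phi> y powr (m - 1)) G \<and>
     locally_integrable (\<lambda>y. \<Phi> y *\<^sub>R y) \<and> locally_integrable (\<lambda>y. \<Phi> y *\<^sub>R G y) \<and>
     (\<forall>\<phi>. test_function \<phi> \<longrightarrow> - lam * dist_div (\<lambda>y. \<Phi> y *\<^sub>R y) \<phi> = dist_div (\<lambda>y. \<Phi> y *\<^sub>R G y) \<phi>)"
proof (intro exI conjI)
  let ?G = "\<lambda>x::'a. k *\<^sub>R profile_grad p R x"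
  show "frac_gradient (2 * p - 1) (\<lambda>y. \<Phi> y powr (m - 1)) ?G"
    using frac_gradient_profile[OF p R, of k, where 'a = 'a] by (simp add: \<Phi>_powr)
  have \<Phi>G: "(\<lambda>y. \<Phi> y *\<^sub>R ?G y) = (\<lambda>y. - lam *\<^sub>R (\<Phi> y *\<^sub>R y))"
  proof
    fix y show "\<Phi> y *\<^sub>R ?G y = - lam *\<^sub>R (\<Phi> y *\<^sub>R y)"
      by (cases "norm y < R") (auto simp: profile_grad_def k[symmetric] \<Phi>_eq_0)
  qed
  have cont: "continuous_on UNIV (\<lambda>y. \<Phi> y *\<^sub>R y)" by (intro continuous_intros \<Phi>_continuous)
  have cont': "continuous_on UNIV (\<lambda>y. - lam *\<^sub>R (\<Phi> y *\<^sub>R y))" by (intro continuous_intros \<Phi>_continuous)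
  show "locally_integrable (\<lambda>y. \<Phi> y *\<^sub>R y)"
    by (rule locally_integrable_bounded[OF borel_measurable_continuous_onI[OF cont] continuous_bounded_on_cball[OF cont]])
  show "locally_integrable (\<lambda>y. \<Phi> y *\<^sub>R ?G y)" unfolding \<Phi>G
    by (rule locally_integrable_bounded[OF borel_measurable_continuous_onI[OF cont'] continuous_bounded_on_cball[OF cont']])
  show "\<forall>\<phi>. test_function \<phi> \<longrightarrow> - lam * dist_div (\<lambda>y. \<Phi> y *\<^sub>R y) \<phi> = dist_div (\<lambda>y. \<Phi> y *\<^sub>R ?G y) \<phi>"
    unfolding \<Phi>G dist_div_def by (simp add: mult.assoc)
qed

text \<open>The gradient may stay abstract: in \<open>pointwise_solution_u\<close> it occurs with
  the same coefficient in the time derivative and in the divergence, and cancels.\<close>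

lemma \<Phi>_GDERIV:
  assumes y: "norm y < R"
  shows "\<exists>g. GDERIV \<Phi> y :> g"
proof -
  have pos: "0 < R\<^sup>2 - y \<bullet> y" using y R power_strict_mono[of "norm y" R 2] by (simp add: power2_norm_eq_inner)
  have "GDERIV (\<lambda>y. R\<^sup>2 - y \<bullet> y) y :> - 2 *\<^sub>R y" unfolding gderiv_def
    by (auto intro!: derivative_eq_intros simp: fun_eq_iff inner_commute)
  moreover have "((\<lambda>s. (k * s powr p) powr (1 / (m - 1))) has_real_derivative
      (1 / (m - 1)) * (k * (R\<^sup>2 - y \<bullet> y) powr p) powr (1 / (m - 1) - of_nat 1) * (k * (p * (R\<^sup>2 - y \<bullet> y) powr (p - 1)))) (at (R\<^sup>2 - y \<bullet> y))"
    by (rule DERIV_fun_powr[OF DERIV_cmult[OF has_real_derivative_powr[OF pos]]]) (use k_pos pos in auto)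
  ultimately obtain g where "GDERIV (\<lambda>y. (k * (R\<^sup>2 - y \<bullet> y) powr p) powr (1 / (m - 1))) y :> g"
    using GDERIV_DERIV_compose by blast
  then have "(\<Phi> has_derivative (\<lambda>h. h \<bullet> g)) (at y)" unfolding gderiv_def
  proof (rule has_derivative_transform_within_open[of _ _ _ _ "ball 0 R"])
    fix y :: 'a assume "y \<in> ball 0 R"
    then have "(norm y)\<^sup>2 \<le> R\<^sup>2" by (intro power_mono) auto
    then show "(k * (R\<^sup>2 - y \<bullet> y) powr p) powr (1 / (m - 1)) = \<Phi> y"
      by (simp add: \<Phi> profile_def power2_norm_eq_inner)
  qed (use y in auto)
  then show ?thesis by (auto simp: gderiv_def)
qed

text \<open>Inside, differentiating the similarity form and taking the divergence of -(lam/t) u x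
  both give -(lam/t)(d u + x . grad u). Outside, \<open>u\<close> vanishes near the point in space
  and in time.\<close>

lemma pointwise_solution_u:
  assumes t: "0 < t" and x: "norm x \<noteq> radius t"
  shows "pointwise_solution_at (2 * p) m u t x"
proof -
  have ev: "\<forall>\<^sub>F y in nhds x. riesz_converges (2 - 2 * p) (\<lambda>z. \<bar>u t z\<bar> powr (m - 1)) y \<and>
      (GDERIV (riesz_potential (2 - 2 * p) (\<lambda>z. \<bar>u t z\<bar> powr (m - 1))) y :> G t y)"
  proof -
    \<comment> \<open>The gradient is demanded on a whole neighbourhood of \<open>x\<close>, and
      being off the sphere is an open condition.\<close>
    have "open {y::'a. norm y \<noteq> radius t}" by (intro open_Collect_neq continuous_intros)
    then have "\<forall>\<^sub>F y in nhds x. norm y \<noteq> radius t" using x by (auto simp: eventually_nhds)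
    then show ?thesis
    proof eventually_elim
      case (elim y)
      have "(riesz_potential (2 - 2 * p) (profile p (radius t)) has_derivative (\<lambda>h. h \<bullet> profile_grad p (radius t) y)) (at y)"
        using riesz_potential_profile_GDERIV[OF p radius_pos[OF t] elim] by (simp add: gderiv_def)
      then have "((\<lambda>x. k / t * riesz_potential (2 - 2 * p) (profile p (radius t)) x) has_derivative (\<lambda>h. h \<bullet> G t y)) (at y)"
        by (rule has_derivative_eq_rhs[OF has_derivative_mult_right]) (simp add: G_def)
      moreover have "riesz_potential (2 - 2 * p) (\<lambda>z. \<bar>u t z\<bar> powr (m - 1)) = (\<lambda>x. k / t * riesz_potential (2 - 2 * p) (profile p (radius t)) x)"
        unfolding u_powr[OF t] by (intro ext riesz_potential_cmult)
      ultimately show ?case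
        unfolding gderiv_def using riesz_converges_profile[OF p radius_pos[OF t], of "k / t" y] by (simp add: u_powr[OF t])
    qed
  qed
  let ?d = "real DIM('a)"
  have "\<exists>ut D. ((\<lambda>s. u s x) has_real_derivative ut) (at t) \<and> has_divergence (\<lambda>y. u t y *\<^sub>R G t y) D x \<and> ut - D = 0"
  proof (cases "norm x < radius t")
    case True
    define y0 where "y0 = t powr (- lam) *\<^sub>R x"
    have "norm y0 < R" using True norm_less_radius[OF t, of x] by (simp add: y0_def)
    then obtain g where "GDERIV \<Phi> y0 :> g" using \<Phi>_GDERIV by blast
    then have g: "(\<Phi> has_derivative (\<lambda>h. h \<bullet> g)) (at (t powr (- lam) *\<^sub>R x))" by (simp add: gderiv_def y0_def)
    define P where "P = t powr (- (?d * lam))"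
    define L where "L = t powr (- lam)"
    have dP: "((\<lambda>s. s powr (- (?d * lam))) has_real_derivative - (?d * lam) * (P / t)) (at t)"
      using has_real_derivative_powr[OF t, of "- (?d * lam)"] t by (simp add: P_def powr_diff)
    have dL: "((\<lambda>s. s powr (- lam)) has_real_derivative - lam * (L / t)) (at t)"
      using has_real_derivative_powr[OF t, of "- lam"] t by (simp add: L_def powr_diff)
    have "((\<lambda>s. s powr (- lam) *\<^sub>R x) has_derivative (\<lambda>h. (h * (- lam * (L / t))) *\<^sub>R x)) (at t)"
      using dL unfolding has_field_derivative_def
      by (rule has_derivative_eq_rhs[OF has_derivative_scaleR_left]) (simp add: fun_eq_iff mult.commute)
    from has_derivative_compose[OF this g]
    have d\<Phi>: "((\<lambda>s. \<Phi> (s powr (- lam) *\<^sub>R x)) has_real_derivative - lam * (L / t) * (x \<bullet> g)) (at t)"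
      unfolding has_field_derivative_def by (rule has_derivative_eq_rhs) (simp add: fun_eq_iff)
    have "((\<lambda>s. s powr (- (?d * lam)) * \<Phi> (s powr (- lam) *\<^sub>R x)) has_real_derivative
        - (?d * lam) * (P / t) * \<Phi> y0 + - lam * (L / t) * (x \<bullet> g) * P) (at t)"
      using DERIV_mult[OF dP d\<Phi>] by (simp add: y0_def P_def)
    then have ut: "((\<lambda>s. u s x) has_real_derivative
        - (?d * lam) * (P / t) * \<Phi> y0 + - lam * (L / t) * (x \<bullet> g) * P) (at t)"
      unfolding has_field_derivative_def
      by (rule has_derivative_transform_within_open[of _ _ _ _ "{0<..}"]) (use t u in auto)
    have "((\<lambda>y. L *\<^sub>R y) has_derivative (\<lambda>h. L *\<^sub>R h)) (at x)" by (auto intro!: derivative_eq_intros)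
    from has_derivative_compose[OF this g[folded L_def]]
    have "((\<lambda>y. \<Phi> (L *\<^sub>R y)) has_derivative (\<lambda>h. (L *\<^sub>R h) \<bullet> g)) (at x)" .
    then have du: "(u t has_derivative (\<lambda>h. P * (L * (h \<bullet> g)))) (at x)"
      unfolding u[OF t, abs_def] P_def[symmetric] L_def[symmetric]
      by (rule has_derivative_eq_rhs[OF has_derivative_mult_right]) simp
    have "((\<lambda>y. - (lam / t) *\<^sub>R (u t y *\<^sub>R y)) has_derivative (\<lambda>h. - (lam / t) *\<^sub>R (u t x *\<^sub>R h + (P * (L * (h \<bullet> g))) *\<^sub>R x))) (at x)"
      by (intro derivative_intros has_derivative_scaleR du)
    then have dG: "((\<lambda>y. u t y *\<^sub>R G t y) has_derivative (\<lambda>h. - (lam / t) *\<^sub>R (u t x *\<^sub>R h + (P * (L * (h \<bullet> g))) *\<^sub>R x))) (at x)"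
      by (simp add: u_G[OF t])
    have "(\<Sum>b\<in>Basis. (- (lam / t) *\<^sub>R (u t x *\<^sub>R b + (P * (L * (b \<bullet> g))) *\<^sub>R x)) \<bullet> b)
       = (\<Sum>b\<in>Basis. - (lam / t) * (u t x + P * L * ((x \<bullet> b) * (g \<bullet> b))))"
    proof (intro sum.cong refl)
      fix b :: 'a assume b: "b \<in> Basis"
      have "(- (lam / t) *\<^sub>R (u t x *\<^sub>R b + (P * (L * (b \<bullet> g))) *\<^sub>R x)) \<bullet> b
        = - (lam / t) * (u t x * (b \<bullet> b) + P * (L * (b \<bullet> g)) * (x \<bullet> b))"
        by (simp only: inner_scaleR_left inner_add_left)
      then show "(- (lam / t) *\<^sub>R (u t x *\<^sub>R b + (P * (L * (b \<bullet> g))) *\<^sub>R x)) \<bullet> b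
        = - (lam / t) * (u t x + P * L * ((x \<bullet> b) * (g \<bullet> b)))"
        using b by (simp add: inner_commute[of b g] mult_ac)
    qed
    also have "\<dots> = - (lam / t) * (\<Sum>b\<in>Basis. u t x + P * L * ((x \<bullet> b) * (g \<bullet> b)))"
      by (rule sum_distrib_left[symmetric])
    also have "(\<Sum>b\<in>Basis. u t x + P * L * ((x \<bullet> b) * (g \<bullet> b))) = ?d * u t x + P * L * (x \<bullet> g)"
      unfolding euclidean_inner[of x g] by (simp add: sum.distrib sum_distrib_left)
    finally have trace: "(\<Sum>b\<in>Basis. (- (lam / t) *\<^sub>R (u t x *\<^sub>R b + (P * (L * (b \<bullet> g))) *\<^sub>R x)) \<bullet> b)
      = - (lam / t) * (?d * u t x + P * L * (x \<bullet> g))" .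
    have div: "has_divergence (\<lambda>y. u t y *\<^sub>R G t y) (- (lam / t) * (?d * u t x + P * L * (x \<bullet> g))) x"
      unfolding has_divergence_def by (rule exI, rule conjI, rule dG, rule trace[symmetric])
    have "- (?d * lam) * (P / t) * \<Phi> y0 + - lam * (L / t) * (x \<bullet> g) * P - (- (lam / t) * (?d * u t x + P * L * (x \<bullet> g))) = 0"
    proof -
      have "u t x = P * \<Phi> y0" by (simp add: u[OF t] P_def y0_def)
      then show ?thesis by (simp add: divide_inverse algebra_simps)
    qed
    then show ?thesis using ut div by blast
  next
    case False
    then have x: "radius t < norm x" using x by simp
    have ut: "((\<lambda>s. u s x) has_real_derivative 0) (at t)"
    proof -
      \<comment> \<open>The time derivative sees other radii; by continuity of the radius the point
        stays outside the support for times near \<open>t\<close>.\<close>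
      have "isCont (\<lambda>s. R * s powr lam) t" using t by (intro continuous_intros) auto
      then have "((\<lambda>s. R * s powr lam) \<longlongrightarrow> R * t powr lam) (nhds t)" using tendsto_at_iff_tendsto_nhds[of "\<lambda>s. R * s powr lam" t] by (simp add: isCont_def)
      then have "\<forall>\<^sub>F s in nhds t. R * s powr lam < norm x" by (rule order_tendstoD(2)) (use x in \<open>simp add: radius_def\<close>)
      moreover have "\<forall>\<^sub>F s in nhds t. 0 < s" using eventually_nhds_in_open[of "{0<..}" t] t by simp
      ultimately have "\<forall>\<^sub>F s in nhds t. u s x = 0"
        by eventually_elim (simp add: u_eq_0 radius_def)
      then show ?thesis by (subst DERIV_cong_ev[OF refl _ refl]) auto
    qed
    have "((\<lambda>y. u t y *\<^sub>R G t y) has_derivative (\<lambda>h. 0)) (at x)"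
      by (rule has_derivative_transform_within_open[of "\<lambda>_. 0" _ _ _ "- cball 0 (radius t)"])
         (use x u_eq_0[OF t] in auto)
    then have "has_divergence (\<lambda>y. u t y *\<^sub>R G t y) 0 x"
      unfolding has_divergence_def by (intro exI[of _ "\<lambda>h. 0"]) simp
    then show ?thesis using ut by force
  qed
  then show ?thesis unfolding pointwise_solution_at_def using ev by blast
qed

end

section \<open>The weak formulation in self-similar variables\<close>

lemma integral_scaleR_lborel:
  fixes f :: "'a::euclidean_space \<Rightarrow> real"
  assumes [measurable]: "f \<in> borel_measurable borel" and c: "0 < c"
  shows "(LBINT x. f x) = c ^ DIM('a) * (LBINT x. f (c *\<^sub>R x))"
proof -
  have "(LBINT x. f x) = (\<integral>x. f x \<partial>density (distr lborel borel (\<lambda>x::'a. 0 + c *\<^sub>R x)) (\<lambda>_. ennreal (\<bar>c\<bar> ^ DIM('a))))"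
    using lborel_affine[of c "0::'a"] c by simp
  also have "\<dots> = c ^ DIM('a) * (LBINT x. f (c *\<^sub>R x))"
    using c by (subst integral_density) (auto simp: integral_distr)
  finally show ?thesis .
qed

text \<open>Along the curves \<open>t \<mapsto> (t, t\<^bsup>\<lambda>\<^esup> y)\<close> the transport operator \<open>\<partial>\<^sub>t + (\<lambda>/t) x \<cdot> \<nabla>\<close> is the
  derivative of the test function.\<close>

lemma test_function_along_curve:
  fixes \<phi> :: "real \<times> 'a::euclidean_space \<Rightarrow> real"
  assumes \<phi>: "strip_test_function t0 T \<phi> \<phi>t \<phi>x" and t0: "0 < t0" and t: "t \<in> {t0..<T}"
  shows "((\<lambda>t. \<phi> (t, t powr lam *\<^sub>R y)) has_vector_derivative
      \<phi>t (t, t powr lam *\<^sub>R y) + (lam / t) * ((t powr lam *\<^sub>R y) \<bullet> \<phi>x (t, t powr lam *\<^sub>R y))) (at t within {t0..<T})"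
proof -
  have tpos: "0 < t" using t t0 by simp
  let ?c = "\<lambda>t. (t, t powr lam *\<^sub>R y)"
  have "((\<lambda>s. s powr lam) has_real_derivative lam * t powr (lam - 1)) (at t within {t0..<T})"
    by (rule has_field_derivative_at_within[OF has_real_derivative_powr[OF tpos]])
  then have "((\<lambda>s. s powr lam *\<^sub>R y) has_derivative (\<lambda>h. (lam * t powr (lam - 1) * h) *\<^sub>R y)) (at t within {t0..<T})"
    unfolding has_field_derivative_def by (rule has_derivative_scaleR_left)
  then have c: "(?c has_derivative (\<lambda>h. (h, (lam * t powr (lam - 1) * h) *\<^sub>R y))) (at t within {t0..<T})"
    by (intro has_derivative_Pair has_derivative_ident)
  have "(\<phi> has_derivative (\<lambda>(s, v). s * \<phi>t (?c t) + v \<bullet> \<phi>x (?c t))) (at (?c t) within {t0..<T} \<times> UNIV)"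
    using \<phi> t unfolding strip_test_function_def by (elim conjE) (erule bspec, simp)
  \<comment> \<open>The test function is differentiable only relative to the strip, one-sidedly at
    \<open>t0\<close>, so the chain rule is applied within the image of the curve.\<close>
  then have "(\<phi> has_derivative (\<lambda>(s, v). s * \<phi>t (?c t) + v \<bullet> \<phi>x (?c t))) (at (?c t) within ?c ` {t0..<T})"
    by (rule has_derivative_subset) auto
  from has_derivative_in_compose[OF c this]
  have "((\<lambda>t. \<phi> (?c t)) has_derivative (\<lambda>h. h * \<phi>t (?c t) + ((lam * t powr (lam - 1) * h) *\<^sub>R y) \<bullet> \<phi>x (?c t))) (at t within {t0..<T})"
    by simp
  then show ?thesis unfolding has_vector_derivative_def
  proof (rule has_derivative_eq_rhs)
    have "t powr (lam - 1) = t powr lam / t" using tpos by (simp add: powr_diff)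
    then show "(\<lambda>h. h * \<phi>t (?c t) + ((lam * t powr (lam - 1) * h) *\<^sub>R y) \<bullet> \<phi>x (?c t))
       = (\<lambda>h. h *\<^sub>R (\<phi>t (?c t) + (lam / t) * ((t powr lam *\<^sub>R y) \<bullet> \<phi>x (?c t))))"
      by (simp add: fun_eq_iff distrib_left mult_ac)
  qed
qed

context barenblatt
begin

text \<open>The prefactor of \<open>u\<close> is the inverse Jacobian of y -> t^lam y; for f = 1
  this is conservation of mass.\<close>

lemma integral_u_scaled:
  assumes t: "0 < t" and [measurable]: "f \<in> borel_measurable borel"
  shows "(LBINT x. u t x * f x) = (LBINT y. \<Phi> y * f (t powr lam *\<^sub>R y))"
proof -
  let ?P = "t powr (- (DIM('a) * lam))"
  have P: "(t powr lam) ^ DIM('a) * ?P = 1"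
    using t by (simp add: powr_powr mult.commute flip: powr_realpow powr_add)
  have "(LBINT x. u t x * f x) = (LBINT x. ?P * (\<Phi> (t powr (- lam) *\<^sub>R x) * f x))"
    by (simp add: u[OF t] mult.assoc)
  also have "\<dots> = (t powr lam) ^ DIM('a) * (LBINT y. ?P * (\<Phi> (t powr (- lam) *\<^sub>R (t powr lam *\<^sub>R y)) * f (t powr lam *\<^sub>R y)))"
    by (rule integral_scaleR_lborel) (use t in auto)
  also have "\<dots> = ((t powr lam) ^ DIM('a) * ?P) * (LBINT y. \<Phi> (t powr (- lam) *\<^sub>R (t powr lam *\<^sub>R y)) * f (t powr lam *\<^sub>R y))"
    by simp
  also have "\<dots> = (LBINT y. \<Phi> y * f (t powr lam *\<^sub>R y))"
    unfolding P using t by (simp flip: powr_add)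
  finally show ?thesis .
qed

text \<open>In the variable y the weight \<Phi>(y) no longer depends on time. Fubini moves the time
  integral inside, where the integrand is the derivative of the test function along a curve; only
  the value at \<open>t0\<close> survives.\<close>

lemma weak_identity:
  fixes \<phi> :: "real \<times> 'a \<Rightarrow> real"
  assumes t0: "0 < t0" "t0 < T" and \<phi>: "strip_test_function t0 T \<phi> \<phi>t \<phi>x"
  shows "(LBINT t:{t0<..<T}. (LBINT x. u t x * (\<phi>t (t, x) - G t x \<bullet> \<phi>x (t, x)))) + (LBINT x. u t0 x * \<phi> (t0, x)) = 0"
proof -
  let ?S = "{t0..<T} \<times> (UNIV :: 'a set)"
  have ct: "continuous_on ?S \<phi>t" and cx: "continuous_on ?S \<phi>x"
    using \<phi> unfolding strip_test_function_def by blast+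
  have c\<phi>: "continuous_on ?S \<phi>"
    using \<phi> unfolding strip_test_function_def by (intro has_derivative_continuous_on) (drule conjunct1, erule (1) bspec)
  obtain e where e: "0 < e" "\<And>t x. t \<in> {t0..<T} \<Longrightarrow> T - e < t \<Longrightarrow> \<phi> (t, x) = 0"
    using \<phi> unfolding strip_test_function_def by blast
  \<comment> \<open>Late enough for the test function to vanish there, yet strictly before
    \<open>T\<close>, where the test function is not controlled: the fundamental theorem is used on
    a closed interval.\<close>
  define T1 where "T1 = max t0 (T - e / 2)"
  have T1: "t0 \<le> T1" "T1 < T" "T - e < T1" using t0 e by (auto simp: T1_def)
  define h where "h q = \<phi>t (fst q, fst q powr lam *\<^sub>R snd q) + (lam / fst q) * ((fst q powr lam *\<^sub>R snd q) \<bullet> \<phi>x (fst q, fst q powr lam *\<^sub>R snd q))" for q :: "real \<times> 'a"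
  have curve: "((\<lambda>t. \<phi> (t, t powr lam *\<^sub>R y)) has_vector_derivative h (t, y)) (at t within {t0..<T})" if "t \<in> {t0..<T}" for t y
    using test_function_along_curve[OF \<phi> t0(1) that, of lam y] by (simp add: h_def)
  have ch: "continuous_on ?S h" unfolding h_def
    by (intro continuous_intros continuous_on_compose2[OF ct] continuous_on_compose2[OF cx]) (use t0 in auto)
  \<comment> \<open>The given \<open>\<phi>t\<close> and \<open>\<phi>x\<close> are tied to
    \<open>\<phi>\<close> only as its derivatives. Along each curve \<open>\<phi>\<close> is
    constantly 0 after \<open>T1\<close>, and uniqueness of derivatives forces \<open>h\<close> to
    vanish.\<close>
  have h0: "h (t, y) = 0" if t: "T1 < t" "t < T" for t y
  proof -
    have tt: "t \<in> {t0<..<T}" using t T1 by simp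
    have "((\<lambda>t. \<phi> (t, t powr lam *\<^sub>R y)) has_vector_derivative h (t, y)) (at t within {T1<..<T})"
      by (rule has_vector_derivative_within_subset[OF curve]) (use tt T1 in auto)
    then have d: "((\<lambda>t. \<phi> (t, t powr lam *\<^sub>R y)) has_vector_derivative h (t, y)) (at t)"
      using t by (simp add: at_within_open[of t "{T1<..<T}"])
    have "((\<lambda>t. 0) has_vector_derivative h (t, y)) (at t)"
      by (rule has_vector_derivative_transform_within_open[OF d, of "{T1<..<T}"]) (use t T1 e(2) in auto)
    then show ?thesis by (rule vector_derivative_unique_at[OF _ has_vector_derivative_const])
  qed
  have "compact (h ` ({t0..T1} \<times> cball 0 R))"
    by (intro compact_continuous_image continuous_on_subset[OF ch] compact_Times) (use T1 in auto)
  from compact_imp_bounded[OF this, unfolded bounded_iff]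
  obtain B where B: "\<forall>z\<in>h ` ({t0..T1} \<times> cball 0 R). norm z \<le> B" by (rule exE)
  have hB: "\<bar>h (t, y)\<bar> \<le> \<bar>B\<bar>" if "t \<in> {t0<..<T}" "norm y \<le> R" for t y
  proof (cases "t \<le> T1")
    case True
    then have "norm (h (t, y)) \<le> B" by (intro bspec[OF B] imageI) (use that in auto)
    then show ?thesis by simp
  next
    case False
    then show ?thesis using h0[of t y] that by simp
  qed
  obtain M where M: "0 \<le> M" "\<And>y. \<Phi> y \<le> M" using \<Phi>_bound by blast
  \<comment> \<open>Boundedness for Fubini: \<open>\<Phi>\<close> confines y to the ball of radius
    \<open>R\<close>, and \<open>h\<close> is continuous on the compact set with times in [t0, T1]
    and zero afterwards.\<close>
  define K where "K q = indicator ({t0<..<T} \<times> UNIV) q *\<^sub>R (\<Phi> (snd q) * h q)" for q :: "real \<times> 'a"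
  have "continuous_on ({t0<..<T} \<times> UNIV) (\<lambda>q. \<Phi> (snd q) * h q)"
    by (intro continuous_intros continuous_on_subset[OF ch] continuous_on_compose2[OF \<Phi>_continuous]) auto
  then have [measurable]: "K \<in> borel_measurable borel" unfolding K_def
    by (intro borel_measurable_continuous_on_indicator) (auto intro!: borel_open open_Times)
  have "integrable lborel K"
  proof (rule integrable_bounded_support[of _ "T + R" "M * \<bar>B\<bar>"])
    fix q :: "real \<times> 'a"
    obtain t y where q: "q = (t, y)" by force
    show "K q = 0" if "q \<notin> cball 0 (T + R)"
    proof (rule ccontr)
      assume "K q \<noteq> 0"
      then have "t \<in> {t0<..<T}" "\<Phi> y \<noteq> 0" by (auto simp: K_def q indicator_def split: if_splits)
      then have "norm (t, y) \<le> T + R"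
        using \<Phi>_eq_0[of y] t0 norm_Pair_le[of t y] by (cases "R \<le> norm y") auto
      then show False using that q by simp
    qed
    show "norm (K q) \<le> M * \<bar>B\<bar>"
    proof (cases "t \<in> {t0<..<T} \<and> norm y \<le> R")
      case True
      then have "\<Phi> y * \<bar>h (t, y)\<bar> \<le> M * \<bar>B\<bar>" using hB M by (intro mult_mono) auto
      then show ?thesis using True by (simp add: K_def q abs_mult \<Phi>_nonneg)
    next
      case False
      then have "K q = 0" using \<Phi>_eq_0[of y] by (auto simp: K_def q)
      then show ?thesis using M by simp
    qed
  qed simp
  then have iK: "integrable (lborel \<Otimes>\<^sub>M lborel) (\<lambda>(t, y). K (t, y))" by (simp add: lborel_prod)
  have inner: "(LBINT x. u t x * (\<phi>t (t, x) - G t x \<bullet> \<phi>x (t, x))) = (LBINT y. \<Phi> y * h (t, y))" if t: "t \<in> {t0<..<T}" for t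
  proof -
    have tpos: "0 < t" using t t0 by simp
    have "continuous_on UNIV (\<lambda>x. \<phi>t (t, x) + (lam / t) * (x \<bullet> \<phi>x (t, x)))"
      by (intro continuous_intros continuous_on_compose2[OF ct] continuous_on_compose2[OF cx]) (use t in auto)
    then have m: "(\<lambda>x. \<phi>t (t, x) + (lam / t) * (x \<bullet> \<phi>x (t, x))) \<in> borel_measurable borel"
      by (rule borel_measurable_continuous_onI)
    have "u t x * (\<phi>t (t, x) - G t x \<bullet> \<phi>x (t, x)) = u t x * (\<phi>t (t, x) + (lam / t) * (x \<bullet> \<phi>x (t, x)))" for x
    proof -
      have "u t x * (G t x \<bullet> \<phi>x (t, x)) = (u t x *\<^sub>R G t x) \<bullet> \<phi>x (t, x)" by simp
      also have "\<dots> = - (lam / t) * (u t x * (x \<bullet> \<phi>x (t, x)))" unfolding u_G[OF tpos] by simp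
      finally show ?thesis by (simp add: algebra_simps)
    qed
    then have "(LBINT x. u t x * (\<phi>t (t, x) - G t x \<bullet> \<phi>x (t, x))) = (LBINT x. u t x * (\<phi>t (t, x) + (lam / t) * (x \<bullet> \<phi>x (t, x))))"
      by (simp only:)
    also have "\<dots> = (LBINT y. \<Phi> y * h (t, y))"
      unfolding integral_u_scaled[OF tpos m] by (simp add: h_def)
    finally show ?thesis .
  qed
  have "(LBINT t:{t0<..<T}. (LBINT x. u t x * (\<phi>t (t, x) - G t x \<bullet> \<phi>x (t, x)))) = (LBINT t. (LBINT y. K (t, y)))"
    unfolding set_lebesgue_integral_def
    by (intro Bochner_Integration.integral_cong refl) (use inner in \<open>auto simp: K_def indicator_def\<close>)
  also have "\<dots> = (LBINT y. (LBINT t. K (t, y)))"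
    using lborel_pair.Fubini_integral[OF iK] by simp
  also have "\<dots> = (LBINT y. \<Phi> y * - \<phi> (t0, t0 powr lam *\<^sub>R y))"
  proof (rule Bochner_Integration.integral_cong[OF refl])
    fix y :: 'a
    let ?psi = "\<lambda>t. \<phi> (t, t powr lam *\<^sub>R y)"
    have cont: "continuous_on {t0..T1} (\<lambda>t. h (t, y))"
      by (intro continuous_on_compose2[OF ch] continuous_intros) (use T1 in auto)
    have "((\<lambda>t. h (t, y)) has_integral ?psi T1 - ?psi t0) {t0..T1}"
    proof (rule fundamental_theorem_of_calculus[OF T1(1)])
      fix t assume "t \<in> {t0..T1}"
      then have "t \<in> {t0..<T}" using T1 by simp
      from curve[OF this] show "(?psi has_vector_derivative h (t, y)) (at t within {t0..T1})"
        by (rule has_vector_derivative_within_subset) (use T1 in auto)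
    qed
    moreover have "?psi T1 = 0" using e(2) T1 by simp
    ultimately have "integral {t0..T1} (\<lambda>t. h (t, y)) = - ?psi t0" by (simp add: integral_unique)
    moreover have "set_integrable lborel {t0..T1} (\<lambda>t. h (t, y))" by (rule borel_integrable_atLeastAtMost'[OF cont])
    ultimately have I: "(LBINT t:{t0..T1}. h (t, y)) = - ?psi t0" by (simp add: set_borel_integral_eq_integral(2))
    have "(LBINT t. K (t, y)) = (LBINT t. \<Phi> y * (indicator {t0..T1} t *\<^sub>R h (t, y)))"
    proof (rule integral_cong_AE)
      \<comment> \<open>\<open>K\<close> uses the open time interval, and the closed one is needed
        for the primitive; they differ at \<open>t0\<close> only, besides the times after
        \<open>T1\<close> where \<open>h\<close> is 0.\<close>
      have "AE t in lborel. t \<noteq> t0" by (rule AE_lborel_singleton)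
      then show "AE t in lborel. K (t, y) = \<Phi> y * (indicator {t0..T1} t *\<^sub>R h (t, y))"
        by eventually_elim (use h0 T1 in \<open>auto simp: K_def indicator_def not_le\<close>)
      have "(\<lambda>t. indicator {t0..T1} t *\<^sub>R h (t, y)) \<in> borel_measurable borel"
        by (rule borel_measurable_continuous_on_indicator[OF _ cont]) simp
      then show "(\<lambda>t. \<Phi> y * (indicator {t0..T1} t *\<^sub>R h (t, y))) \<in> borel_measurable lborel" by simp
    qed simp
    also have "\<dots> = \<Phi> y * (LBINT t:{t0..T1}. h (t, y))" unfolding set_lebesgue_integral_def by (rule integral_mult_right_zero)
    finally show "(LBINT t. K (t, y)) = \<Phi> y * - \<phi> (t0, t0 powr lam *\<^sub>R y)" unfolding I .
  qed
  also have "\<dots> = - (LBINT x. u t0 x * \<phi> (t0, x))"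
  proof -
    have "continuous_on UNIV (\<lambda>x. \<phi> (t0, x))"
      by (intro continuous_on_compose2[OF c\<phi>] continuous_intros) (use t0 in auto)
    then show ?thesis
      using integral_u_scaled[OF t0(1) borel_measurable_continuous_onI, of "\<lambda>x. \<phi> (t0, x)"] by simp
  qed
  finally show ?thesis by simp
qed

end

text \<open>The solution is prescribed for positive times only, so measurability on the whole space
  comes from a substitute \<open>f\<close> that agrees with \<open>g\<close> on the strip.
  Boundedness and bounded support then give integrability.\<close>

lemma set_integrable_strip:
  fixes f g :: "real \<times> 'a::euclidean_space \<Rightarrow> 'b::{banach,second_countable_topology}"
  assumes f: "f \<in> borel_measurable (borel \<Otimes>\<^sub>M borel)" and K: "K \<in> sets borel"
    and eq: "\<And>t x. t \<in> {t0<..<T} \<Longrightarrow> g (t, x) = f (t, x)"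
    and bnd: "\<And>t x. t \<in> {t0<..<T} \<Longrightarrow> x \<in> K \<Longrightarrow> norm (f (t, x)) \<le> B"
    and supp: "\<And>t x. t \<in> {t0<..<T} \<Longrightarrow> x \<in> K \<Longrightarrow> f (t, x) \<noteq> 0 \<Longrightarrow> norm x \<le> N"
  shows "set_integrable lborel ({t0<..<T} \<times> K) g"
proof -
  have "{t0<..<T} \<times> K \<in> sets (borel \<Otimes>\<^sub>M borel)" using K by (intro pair_measureI) auto
  then have S[measurable]: "{t0<..<T} \<times> K \<in> sets borel" unfolding borel_prod .
  have [measurable]: "f \<in> borel_measurable borel" using f by (simp add: borel_prod)
  have "integrable lborel (\<lambda>q. indicator ({t0<..<T} \<times> K) q *\<^sub>R f q)"
  proof (rule integrable_bounded_support[of _ "\<bar>t0\<bar> + \<bar>T\<bar> + N" "\<bar>B\<bar>"])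
    fix q :: "real \<times> 'a"
    obtain t x where q: "q = (t, x)" by force
    show "norm (indicator ({t0<..<T} \<times> K) q *\<^sub>R f q) \<le> \<bar>B\<bar>"
      using bnd[of t x] by (auto simp: q indicator_def)
    assume out: "q \<notin> cball 0 (\<bar>t0\<bar> + \<bar>T\<bar> + N)"
    show "indicator ({t0<..<T} \<times> K) q *\<^sub>R f q = 0"
    proof (rule ccontr)
      assume "indicator ({t0<..<T} \<times> K) q *\<^sub>R f q \<noteq> 0"
      then have "t \<in> {t0<..<T}" "x \<in> K" "f (t, x) \<noteq> 0" by (auto simp: q indicator_def split: if_splits)
      with supp[of t x] norm_Pair_le[of t x] have "norm (t, x) \<le> \<bar>t0\<bar> + \<bar>T\<bar> + N" by auto
      then show False using out q by simp
    qed
  qed measurable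
  moreover have "(\<lambda>q. indicator ({t0<..<T} \<times> K) q *\<^sub>R f q) = (\<lambda>q. indicator ({t0<..<T} \<times> K) q *\<^sub>R g q)"
    using eq by (auto simp: fun_eq_iff indicator_def)
  ultimately show ?thesis by (simp add: set_integrable_def)
qed

context barenblatt
begin

lemma radius_mono: "0 < s \<Longrightarrow> s \<le> t \<Longrightarrow> radius s \<le> radius t"
  unfolding radius_def using R lam_pos by (intro mult_left_mono powr_mono2) auto

lemma weak_solution_u:
  assumes t0: "0 < t0" "t0 < T"
  shows "weak_solution (2 * p) m t0 T (u t0) u"
proof -
  define U where "U q = fst q powr (- (DIM('a) * lam)) * \<Phi> (fst q powr (- lam) *\<^sub>R snd q)" for q :: "real \<times> 'a"
  have U: "u t x = U (t, x)" if "t \<in> {t0<..<T}" for t x using that t0 by (simp add: U_def u)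
  have [measurable]: "U \<in> borel_measurable (borel \<Otimes>\<^sub>M borel)" unfolding U_def by measurable
  obtain M where M: "0 \<le> M" "\<And>y. \<Phi> y \<le> M" using \<Phi>_bound by blast
  define C where "C = t0 powr (- (DIM('a) * lam)) * M"
  have C0: "0 \<le> C" using M by (simp add: C_def)
  have U_bound: "\<bar>U (t, x)\<bar> \<le> C" if "t \<in> {t0<..<T}" for t x
  proof -
    have "t powr (- (DIM('a) * lam)) \<le> t0 powr (- (DIM('a) * lam))"
      using that t0 lam_pos by (intro powr_mono2') auto
    then show ?thesis unfolding U_def C_def using M by (simp add: abs_mult \<Phi>_nonneg mult_mono)
  qed
  have U_supp: "norm x \<le> radius T" if "t \<in> {t0<..<T}" "U (t, x) \<noteq> 0" for t x
  proof -
    have "norm x < radius t" using u_eq_0[of t x] that t0 U[of t x] by force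
    also have "\<dots> \<le> radius T" using that t0 by (intro radius_mono) auto
    finally show ?thesis by simp
  qed
  have cu: "continuous_on UNIV (u t0)"
  proof -
    have "u t0 = (\<lambda>x. t0 powr (- (DIM('a) * lam)) * \<Phi> (t0 powr (- lam) *\<^sub>R x))" using t0 by (simp add: u fun_eq_iff)
    then show ?thesis by (simp only:) (intro continuous_intros continuous_on_compose2[OF \<Phi>_continuous], auto)
  qed
  have rad: "(\<lambda>q. (R * fst q powr lam, snd q)) \<in> borel \<Otimes>\<^sub>M (borel :: 'a measure) \<rightarrow>\<^sub>M borel \<Otimes>\<^sub>M borel"
    by measurable
  have [measurable]: "(\<lambda>q. riesz_potential (2 - 2 * p) (profile p (R * fst q powr lam)) (snd q)) \<in> borel_measurable (borel \<Otimes>\<^sub>M (borel :: 'a measure))"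
    using measurable_compose[OF rad riesz_potential_measurable] by simp
  have [measurable]: "(\<lambda>q. profile_grad p (R * fst q powr lam) (snd q)) \<in> borel_measurable (borel \<Otimes>\<^sub>M (borel :: 'a measure))"
    using measurable_compose[OF rad profile_grad_measurable] by simp
  \<comment> \<open>The measurable substitute for the flux is its local form from
    \<open>u_G\<close>.\<close>
  have m1: "(\<lambda>q. - (lam / fst q) *\<^sub>R (U q *\<^sub>R snd q)) \<in> borel_measurable (borel \<Otimes>\<^sub>M borel)" by measurable
  have m2: "(\<lambda>q. k / fst q * riesz_potential (2 - 2 * p) (profile p (R * fst q powr lam)) (snd q)) \<in> borel_measurable (borel \<Otimes>\<^sub>M (borel :: 'a measure))"
    by measurable
  have m3: "(\<lambda>q. (k / fst q) *\<^sub>R profile_grad p (R * fst q powr lam) (snd q)) \<in> borel_measurable (borel \<Otimes>\<^sub>M (borel :: 'a measure))"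
    by measurable
  have pot: "riesz_potential (2 - 2 * p) (\<lambda>y. \<bar>u t y\<bar> powr (m - 1)) x = k / t * riesz_potential (2 - 2 * p) (profile p (radius t)) x"
    if "t \<in> {t0<..<T}" for t x
  proof -
    have "0 < t" using that t0 by simp
    then show ?thesis by (simp only: u_powr riesz_potential_cmult)
  qed
  have kt: "\<bar>k / t\<bar> \<le> k / t0" if "t \<in> {t0<..<T}" for t
    using that t0 k_pos by (simp add: frac_le)
  show ?thesis unfolding weak_solution_def
  proof (intro conjI exI[of _ G] allI impI)
    show "set_integrable lborel ({t0<..<T} \<times> UNIV) (\<lambda>(t, x). u t x)"
      by (rule set_integrable_strip[of U _ _ _ _ C "radius T"]) (use U U_bound U_supp in auto)
    show "locally_integrable (u t0)"
      by (rule locally_integrable_bounded[OF borel_measurable_continuous_onI[OF cu] continuous_bounded_on_cball[OF cu]])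
    show "AE t in lborel. t \<in> {t0<..<T} \<longrightarrow> frac_gradient (2 * p - 1) (\<lambda>x. \<bar>u t x\<bar> powr (m - 1)) (G t)"
      using t0 by (intro AE_I2 impI frac_gradient_u) auto
    show "set_integrable lborel ({t0<..<T} \<times> UNIV) (\<lambda>(t, x). u t x *\<^sub>R G t x)"
    proof (rule set_integrable_strip[OF m1, where B = "lam / t0 * (C * radius T)" and N = "radius T"])
      show "UNIV \<in> sets (borel :: 'a measure)" by simp
    next
      fix t :: real and x :: 'a assume t: "t \<in> {t0<..<T}"
      show "(case (t, x) of (t, x) \<Rightarrow> u t x *\<^sub>R G t x) = - (lam / fst (t, x)) *\<^sub>R (U (t, x) *\<^sub>R snd (t, x))"
        using u_G[of t x] U[OF t] t t0 by simp
      show "- (lam / fst (t, x)) *\<^sub>R (U (t, x) *\<^sub>R snd (t, x)) \<noteq> 0 \<Longrightarrow> norm x \<le> radius T"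
        using U_supp[OF t] by auto
      have "lam / t \<le> lam / t0" using t t0 lam_pos by (simp add: frac_le)
      moreover have "\<bar>U (t, x)\<bar> * norm x \<le> C * radius T"
      proof (cases "U (t, x) = 0")
        case True
        then show ?thesis using C0 radius_pos[of T] t0 by simp
      next
        case False
        then show ?thesis using U_bound[OF t] U_supp[OF t False] C0 by (intro mult_mono) auto
      qed
      ultimately have "lam / t * (\<bar>U (t, x)\<bar> * norm x) \<le> lam / t0 * (C * radius T)"
        using t0 lam_pos by - (rule mult_mono, auto)
      then show "norm (- (lam / fst (t, x)) *\<^sub>R (U (t, x) *\<^sub>R snd (t, x))) \<le> lam / t0 * (C * radius T)"
        using t t0 lam_pos by (simp add: abs_mult mult.assoc)
    qed
    fix K :: "'a set" assume K: "compact K"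
    then have Kb: "K \<in> sets borel" by (simp add: borel_compact)
    obtain N' where N': "\<And>x. x \<in> K \<Longrightarrow> norm x \<le> N'"
      using compact_imp_bounded[OF K] unfolding bounded_iff by blast
    \<comment> \<open>One number above the radii at all times of the strip and above the norms on
      the compact set, as the uniform bounds require.\<close>
    define N where "N = max (radius T) N'"
    have N: "0 < N" using radius_pos[of T] t0 by (simp add: N_def)
    have KN: "norm x \<le> N" if "x \<in> K" for x using N'[OF that] by (simp add: N_def)
    have rN: "0 < radius t" "radius t \<le> N" if "t \<in> {t0<..<T}" for t
      using radius_pos[of t] radius_mono[of t T] that t0 by (auto simp: N_def)
    obtain B1 where B1: "\<And>\<rho> x. 0 < \<rho> \<Longrightarrow> \<rho> \<le> N \<Longrightarrow> norm x \<le> N \<Longrightarrow> \<bar>riesz_potential (2 - 2 * p) (profile p \<rho>) (x::'a)\<bar> \<le> B1"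
      using riesz_potential_profile_bound[OF p N, where 'a = 'a] by blast
    obtain B2 where B2: "\<And>\<rho> x. 0 < \<rho> \<Longrightarrow> \<rho> \<le> N \<Longrightarrow> norm x \<le> N \<Longrightarrow> norm (profile_grad p \<rho> (x::'a)) \<le> B2"
      using profile_grad_bound[OF p N, where 'a = 'a] by blast
    show "set_integrable lborel ({t0<..<T} \<times> K) (\<lambda>(t, x). riesz_potential (2 - 2 * p) (\<lambda>y. \<bar>u t y\<bar> powr (m - 1)) x)"
    proof (rule set_integrable_strip[OF m2 Kb, where B = "k / t0 * B1" and N = N])
      fix t :: real and x :: 'a assume t: "t \<in> {t0<..<T}"
      show "(case (t, x) of (t, x) \<Rightarrow> riesz_potential (2 - 2 * p) (\<lambda>y. \<bar>u t y\<bar> powr (m - 1)) x)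
          = k / fst (t, x) * riesz_potential (2 - 2 * p) (profile p (R * fst (t, x) powr lam)) (snd (t, x))"
        using pot[OF t, of x] by (simp add: radius_def)
      assume x: "x \<in> K"
      have "\<bar>k / t\<bar> * \<bar>riesz_potential (2 - 2 * p) (profile p (radius t)) x\<bar> \<le> k / t0 * B1"
        using kt[OF t] B1[OF rN[OF t] KN[OF x]] k_pos t0 by (intro mult_mono) auto
      then show "norm (k / fst (t, x) * riesz_potential (2 - 2 * p) (profile p (R * fst (t, x) powr lam)) (snd (t, x))) \<le> k / t0 * B1"
        by (simp add: radius_def abs_mult)
      show "norm x \<le> N" by (rule KN[OF x])
    qed
    show "set_integrable lborel ({t0<..<T} \<times> K) (\<lambda>(t, x). G t x)"
    proof (rule set_integrable_strip[OF m3 Kb, where B = "k / t0 * B2" and N = N])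
      fix t :: real and x :: 'a assume t: "t \<in> {t0<..<T}"
      show "(case (t, x) of (t, x) \<Rightarrow> G t x) = (k / fst (t, x)) *\<^sub>R profile_grad p (R * fst (t, x) powr lam) (snd (t, x))"
        by (simp add: G_def radius_def)
      assume x: "x \<in> K"
      have "\<bar>k / t\<bar> * norm (profile_grad p (radius t) x) \<le> k / t0 * B2"
        using kt[OF t] B2[OF rN[OF t] KN[OF x]] k_pos t0 by (intro mult_mono) auto
      then show "norm ((k / fst (t, x)) *\<^sub>R profile_grad p (R * fst (t, x) powr lam) (snd (t, x))) \<le> k / t0 * B2"
        by (simp add: radius_def)
      show "norm x \<le> N" by (rule KN[OF x])
    qed
  next
    fix \<phi> \<phi>t :: "real \<times> 'a \<Rightarrow> real" and \<phi>x :: "real \<times> 'a \<Rightarrow> 'a"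
    assume "strip_test_function t0 T \<phi> \<phi>t \<phi>x"
    then show "(LBINT t:{t0<..<T}. (LBINT x. u t x * (\<phi>t (t, x) - G t x \<bullet> \<phi>x (t, x)))) + (LBINT x. u t0 x * \<phi> (t0, x)) = 0"
      by (rule weak_identity[OF t0])
  qed
qed

end

section \<open>Hoelder continuity\<close>

text \<open>For q <= 1 this is subadditivity of the power, and for q > 1 the mean value theorem on
  [0, M]. The constant is the sum of those of the two cases.\<close>

lemma powr_diff_le_holder:
  fixes a b q M :: real
  assumes q: "0 < q" and a: "0 \<le> a" "a \<le> M" and b: "0 \<le> b" "b \<le> M"
  shows "\<bar>a powr q - b powr q\<bar> \<le> (1 + q * M powr (q - 1)) * \<bar>a - b\<bar> powr (min q 1)"
proof -
  have main: "b powr q - a powr q \<le> (1 + q * M powr (q - 1)) * (b - a) powr (min q 1)"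
    if a: "0 \<le> a" and ab: "a < b" and b: "b \<le> M" for a b
  proof (cases "q \<le> 1")
    case True
    have "b powr q \<le> a powr q + (b - a) powr q"
    proof (cases "a = 0")
      case False
      then have a0: "0 < a" using a by simp
      \<comment> \<open>Two numbers of (0, 1) with sum 1: raising them to a power q <= 1 can only
        increase them, and multiplying by b^q gives subadditivity.\<close>
      let ?s = "a / b" and ?t = "(b - a) / b"
      have "?s powr 1 \<le> ?s powr q" using True a0 ab by (intro powr_mono') auto
      moreover have "?t powr 1 \<le> ?t powr q" using True a0 ab by (intro powr_mono') auto
      moreover have "?s + ?t = 1" using a0 ab by (simp add: field_simps)
      moreover have "?s powr 1 = ?s" "?t powr 1 = ?t" using a0 ab by auto
      ultimately have "1 \<le> ?s powr q + ?t powr q" by linarith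
      then have "1 * b powr q \<le> (?s powr q + ?t powr q) * b powr q" by (intro mult_right_mono) auto
      moreover have "?s powr q * b powr q = a powr q" "?t powr q * b powr q = (b - a) powr q"
        using a0 ab by (simp_all add: powr_divide)
      ultimately show ?thesis by (simp add: distrib_right)
    qed (use q in simp)
    then have "b powr q - a powr q \<le> 1 * (b - a) powr q" by simp
    also have "\<dots> \<le> (1 + q * M powr (q - 1)) * (b - a) powr q" using q by (intro mult_right_mono) auto
    finally show ?thesis using True by (simp add: min_def)
  next
    case False
    have "continuous_on {a..b} (\<lambda>x. x powr q)" using a q by (intro continuous_on_powr' continuous_intros) auto
    moreover have "(\<lambda>x. x powr q) differentiable (at x)" if "a < x" "x < b" for x
      using has_real_derivative_powr[of x q] that a by (auto simp: real_differentiable_def)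
    ultimately obtain l z where lz: "a < z" "z < b" "((\<lambda>x. x powr q) has_real_derivative l) (at z)" "b powr q - a powr q = (b - a) * l"
      using MVT[OF ab] by blast
    moreover have "l = q * z powr (q - 1)"
      using DERIV_unique[OF lz(3) has_real_derivative_powr[of z q]] lz a by simp
    ultimately have z: "a < z" "z < b" "b powr q - a powr q = (b - a) * (q * z powr (q - 1))" by auto
    have "z powr (q - 1) \<le> M powr (q - 1)" using z a b False by (intro powr_mono2) auto
    then have "b powr q - a powr q \<le> (b - a) * (q * M powr (q - 1))"
      unfolding z(3) using ab q by (intro mult_left_mono) auto
    also have "\<dots> \<le> (b - a) * (1 + q * M powr (q - 1))" using ab by (intro mult_left_mono) auto
    finally show ?thesis using False ab by (simp add: min_def mult.commute)
  qed
  show ?thesis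
  proof (cases a b rule: linorder_cases)
    case less
    then have "a powr q \<le> b powr q" using a q by (intro powr_mono2) auto
    then show ?thesis using main[of a b] less a b by simp
  next
    case greater
    then have "b powr q \<le> a powr q" using b q by (intro powr_mono2) auto
    then show ?thesis using main[of b a] greater a b by simp
  qed simp
qed

lemma powr_lipschitz:
  fixes a s t c :: real
  assumes c: "0 \<le> c" and a: "0 < a" and s: "a \<le> s" "a \<le> t"
  shows "\<bar>s powr (- c) - t powr (- c)\<bar> \<le> c * a powr (- c - 1) * \<bar>s - t\<bar>"
proof -
  have "norm (s powr (- c) - t powr (- c)) \<le> (c * a powr (- c - 1)) * norm (s - t)"
  proof (rule field_differentiable_bound[of "{a..}"])
    fix z assume z: "z \<in> {a..}"
    show "((\<lambda>z. z powr (- c)) has_field_derivative (- c * z powr (- c - 1))) (at z within {a..})"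
      by (rule has_field_derivative_at_within[OF has_real_derivative_powr]) (use z a in auto)
    have "z powr (- c - 1) \<le> a powr (- c - 1)" using z a c by (intro powr_mono2') auto
    then show "norm (- c * z powr (- c - 1)) \<le> c * a powr (- c - 1)"
      using c by (simp add: abs_mult mult_left_mono)
  qed (use s in auto)
  then show ?thesis by simp
qed

text \<open>Away from time 0 the function \<open>w\<close> is Lipschitz in space-time, so the power
  \<open>q\<close> alone limits the exponent. The prefactor is Lipschitz too and is absorbed at
  distances below 1.\<close>

lemma holder_at_profile:
  fixes x :: "'a::euclidean_space" and t R A c e q :: real
  assumes t: "0 < t" and R: "0 < R" and A: "0 \<le> A" and c: "0 \<le> c" and e: "0 \<le> e" and q: "0 < q"
  shows "holder_at (min q 1) (\<lambda>(s, y). s powr (- c) * (A * (max (R\<^sup>2 - (norm y)\<^sup>2 * s powr (- e)) 0) powr q)) (t, x)"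
proof -
  define \<gamma> where "\<gamma> = min q 1"
  have \<gamma>: "0 < \<gamma>" "\<gamma> \<le> 1" using q by (auto simp: \<gamma>_def)
  \<comment> \<open>The bound t/2 keeps times above t/2. The bound 1/2 keeps distances of two points
    of \<open>U\<close> below 1, so that a Lipschitz bound implies one with exponent
    \<open>\<gamma>\<close>.\<close>
  define r where "r = min (1 / 2) (t / 2)"
  define U where "U = ball (t, x) r"
  define a where "a = t / 2"
  have a: "0 < a" using t by (simp add: a_def)
  define X where "X = norm x + 1"
  define w where "w s y = max (R\<^sup>2 - (norm y)\<^sup>2 * s powr (- e)) 0" for s :: real and y :: 'a
  have inU: "a \<le> s" "norm y \<le> X" if "(s, y) \<in> U" for s y
  proof -
    have d: "dist (t, x) (s, y) < r" using that by (simp add: U_def)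
    have "dist t s \<le> dist (t, x) (s, y)" using dist_fst_le[of "(t, x)" "(s, y)"] by simp
    then show "a \<le> s" using d by (auto simp: r_def a_def dist_real_def)
    have "dist x y \<le> dist (t, x) (s, y)" using dist_snd_le[of "(t, x)" "(s, y)"] by simp
    then have "dist x y < 1" using d by (simp add: r_def)
    then show "norm y \<le> X" using norm_triangle_ineq2[of y x] by (simp add: X_def dist_norm norm_minus_commute)
  qed
  define L where "L = X\<^sup>2 * (e * a powr (- e - 1)) + 2 * X * a powr (- e)"
  define C1 where "C1 = 1 + q * (R\<^sup>2) powr (q - 1)"
  define C2 where "C2 = c * a powr (- c - 1)"
  have X0: "0 \<le> X" by (simp add: X_def add_nonneg_nonneg)
  have L0: "0 \<le> L" unfolding L_def using e X0 by simp
  have C10: "0 \<le> C1" unfolding C1_def using q by simp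
  have C20: "0 \<le> C2" unfolding C2_def using c by simp
  have w0: "0 \<le> w s y" "w s y \<le> R\<^sup>2" for s y by (auto simp: w_def)
  show ?thesis unfolding holder_at_def \<gamma>_def[symmetric]
  proof (intro exI[of _ U] conjI)
    show "open U" "(t, x) \<in> U" using t by (auto simp: U_def r_def)
    show "holder_on \<gamma> U (\<lambda>(s, y). s powr (- c) * (A * (max (R\<^sup>2 - (norm y)\<^sup>2 * s powr (- e)) 0) powr q))"
      unfolding holder_on_def
    proof (intro exI ballI)
      fix P Q assume PQ: "P \<in> U" "Q \<in> U"
      obtain s y where P: "P = (s, y)" by force
      obtain s' y' where Q: "Q = (s', y')" by force
      note s = inU[OF PQ(1)[unfolded P]] and s' = inU[OF PQ(2)[unfolded Q]]
      define D where "D = dist P Q"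
      have "D \<le> dist (t, x) P + dist (t, x) Q" unfolding D_def by (rule dist_triangle3[of P Q "(t, x)"])
      also have "\<dots> < r + r" using PQ by (simp add: U_def)
      also have "\<dots> \<le> 1" by (simp add: r_def)
      finally have D1: "D \<le> 1" by simp
      have D0: "0 \<le> D" by (simp add: D_def)
      have Ds: "\<bar>s - s'\<bar> \<le> D" using dist_fst_le[of P Q] by (simp add: D_def P Q dist_real_def)
      have Dy: "norm (y - y') \<le> D" using dist_snd_le[of P Q] by (simp add: D_def P Q dist_norm)
      have D\<gamma>: "D \<le> D powr \<gamma>"
      proof (cases "D = 0")
        case False
        then have "D powr 1 \<le> D powr \<gamma>" using D0 D1 \<gamma> by (intro powr_mono') auto
        then show ?thesis using D0 by simp
      qed simp
      have sq: "\<bar>(norm y)\<^sup>2 - (norm y')\<^sup>2\<bar> \<le> 2 * X * D"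
      proof -
        have "\<bar>(norm y)\<^sup>2 - (norm y')\<^sup>2\<bar> = \<bar>norm y - norm y'\<bar> * (norm y + norm y')"
          by (simp add: power2_eq_square square_diff_square_factored abs_mult)
        also have "\<dots> \<le> D * (X + X)"
          using norm_triangle_ineq3[of y y'] Dy s s' D0 by (intro mult_mono) auto
        finally show ?thesis by (simp add: mult_ac)
      qed
      have "\<bar>w s y - w s' y'\<bar> \<le> \<bar>(norm y)\<^sup>2 * s powr (- e) - (norm y')\<^sup>2 * s' powr (- e)\<bar>"
        unfolding w_def by (simp add: max_def abs_if)
      also have "\<dots> = \<bar>(norm y)\<^sup>2 * (s powr (- e) - s' powr (- e)) + ((norm y)\<^sup>2 - (norm y')\<^sup>2) * s' powr (- e)\<bar>"
        by (simp add: algebra_simps)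
      also have "\<dots> \<le> (norm y)\<^sup>2 * \<bar>s powr (- e) - s' powr (- e)\<bar> + \<bar>(norm y)\<^sup>2 - (norm y')\<^sup>2\<bar> * s' powr (- e)"
        by (rule order_trans[OF abs_triangle_ineq]) (simp add: abs_mult)
      also have "\<dots> \<le> X\<^sup>2 * (e * a powr (- e - 1) * D) + (2 * X * D) * a powr (- e)"
      proof (intro add_mono mult_mono)
        show "(norm y)\<^sup>2 \<le> X\<^sup>2" using s by (intro power_mono) auto
        have "\<bar>s powr (- e) - s' powr (- e)\<bar> \<le> e * a powr (- e - 1) * \<bar>s - s'\<bar>"
          by (rule powr_lipschitz[OF e a s(1) s'(1)])
        also have "\<dots> \<le> e * a powr (- e - 1) * D" using Ds e by (intro mult_left_mono) auto
        finally show "\<bar>s powr (- e) - s' powr (- e)\<bar> \<le> e * a powr (- e - 1) * D" .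
        show "s' powr (- e) \<le> a powr (- e)" using s'(1) a e by (intro powr_mono2') auto
      qed (use sq X0 D0 in auto)
      also have "\<dots> = L * D" by (simp add: L_def algebra_simps)
      finally have wL: "\<bar>w s y - w s' y'\<bar> \<le> L * D" .
      have "\<bar>w s y powr q - w s' y' powr q\<bar> \<le> C1 * \<bar>w s y - w s' y'\<bar> powr \<gamma>"
        unfolding C1_def \<gamma>_def by (rule powr_diff_le_holder[OF q]) (use w0 in auto)
      also have "\<dots> \<le> C1 * (L * D) powr \<gamma>" using wL \<gamma> C10 by (intro mult_left_mono powr_mono2) auto
      also have "\<dots> = C1 * L powr \<gamma> * D powr \<gamma>" using L0 D0 by (simp add: powr_mult)
      finally have wq: "\<bar>w s y powr q - w s' y' powr q\<bar> \<le> C1 * L powr \<gamma> * D powr \<gamma>" .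
      have "\<bar>s powr (- c) - s' powr (- c)\<bar> \<le> C2 * \<bar>s - s'\<bar>"
        unfolding C2_def by (rule powr_lipschitz[OF c a s(1) s'(1)])
      also have "\<dots> \<le> C2 * D powr \<gamma>" using Ds D\<gamma> C20 by (intro mult_left_mono) auto
      finally have sc: "\<bar>s powr (- c) - s' powr (- c)\<bar> \<le> C2 * D powr \<gamma>" .
      have "\<bar>s powr (- c) * (A * w s y powr q) - s' powr (- c) * (A * w s' y' powr q)\<bar>
        = \<bar>A * (s powr (- c) * (w s y powr q - w s' y' powr q) + (s powr (- c) - s' powr (- c)) * w s' y' powr q)\<bar>"
        by (simp add: algebra_simps)
      also have "\<dots> = A * \<bar>s powr (- c) * (w s y powr q - w s' y' powr q) + (s powr (- c) - s' powr (- c)) * w s' y' powr q\<bar>"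
        using A by (simp add: abs_mult)
      also have "\<dots> \<le> A * (s powr (- c) * \<bar>w s y powr q - w s' y' powr q\<bar> + \<bar>s powr (- c) - s' powr (- c)\<bar> * w s' y' powr q)"
        using A by (intro mult_left_mono order_trans[OF abs_triangle_ineq]) (auto simp: abs_mult)
      also have "\<dots> \<le> A * (a powr (- c) * (C1 * L powr \<gamma> * D powr \<gamma>) + (C2 * D powr \<gamma>) * (R\<^sup>2) powr q)"
      proof (intro mult_left_mono[OF _ A] add_mono mult_mono wq sc)
        show "s powr (- c) \<le> a powr (- c)" using s(1) a c by (intro powr_mono2') auto
        show "w s' y' powr q \<le> (R\<^sup>2) powr q" using w0 q by (intro powr_mono2) auto
      qed (use C20 in auto)
      also have "\<dots> = A * (a powr (- c) * (C1 * L powr \<gamma>) + C2 * (R\<^sup>2) powr q) * D powr \<gamma>"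
        by (simp add: algebra_simps)
      finally show "dist (case P of (s, y) \<Rightarrow> s powr (- c) * (A * (max (R\<^sup>2 - (norm y)\<^sup>2 * s powr (- e)) 0) powr q))
          (case Q of (s, y) \<Rightarrow> s powr (- c) * (A * (max (R\<^sup>2 - (norm y)\<^sup>2 * s powr (- e)) 0) powr q))
          \<le> A * (a powr (- c) * (C1 * L powr \<gamma>) + C2 * (R\<^sup>2) powr q) * dist P Q powr \<gamma>"
        by (simp add: P Q w_def D_def dist_real_def)
    qed
  qed
qed

theorem theorem2p2:
  fixes d :: nat
    and \<alpha> m R lam k :: real
    and \<Phi> :: "'a::euclidean_space \<Rightarrow> real"
    and u :: "real \<Rightarrow> 'a \<Rightarrow> real"
  assumes d: "d = DIM('a)"
    and \<alpha>: "0 < \<alpha>" "\<alpha> \<le> 2"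
    and m: "1 < m"
    and R: "0 < R"
    and lam: "lam = 1 / (real d * (m - 1) + \<alpha>)"
    and k: "k = (real d / (real d * (m - 1) + \<alpha>)) *
              (Gamma (real d / 2) /
                (2 powr \<alpha> * Gamma (1 + \<alpha> / 2) * Gamma ((real d + \<alpha>) / 2)))"
    and \<Phi>: "\<And>y. \<Phi> y = (k * (max (R\<^sup>2 - (norm y)\<^sup>2) 0) powr (\<alpha> / 2)) powr (1 / (m - 1))"
    and u: "\<And>t x. 0 < t \<Longrightarrow> u t x =
              t powr (- (real d / (real d * (m - 1) + \<alpha>))) *
              (k * (max (R\<^sup>2 - (norm x)\<^sup>2 * t powr (- (2 / (real d * (m - 1) + \<alpha>)))) 0)
                    powr (\<alpha> / 2)) powr (1 / (m - 1))"
  shows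
    "(\<exists>G. frac_gradient (\<alpha> - 1) (\<lambda>y. \<Phi> y powr (m - 1)) G \<and>
          locally_integrable (\<lambda>y. \<Phi> y *\<^sub>R y) \<and>
          locally_integrable (\<lambda>y. \<Phi> y *\<^sub>R G y) \<and>
          (\<forall>\<phi>. test_function \<phi> \<longrightarrow>
             - lam * dist_div (\<lambda>y. \<Phi> y *\<^sub>R y) \<phi> = dist_div (\<lambda>y. \<Phi> y *\<^sub>R G y) \<phi>)) \<and>
     (\<forall>t0 T. 0 < t0 \<and> t0 < T \<longrightarrow> weak_solution \<alpha> m t0 T (u t0) u) \<and>
     (\<forall>t x. 0 < t \<and> norm x \<noteq> R * t powr (1 / (real d * (m - 1) + \<alpha>)) \<longrightarrow>
        pointwise_solution_at \<alpha> m u t x) \<and>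
     (\<forall>t x. 0 < t \<and> norm x = R * t powr (1 / (real d * (m - 1) + \<alpha>)) \<longrightarrow>
        holder_at (min (\<alpha> / (2 * (m - 1))) 1) (\<lambda>(s, y). u s y) (t, x))"
proof -
  define p where "p = \<alpha> / 2"
  have \<alpha>p: "\<alpha> = 2 * p" by (simp add: p_def)
  have p: "0 < p" "p \<le> 1" using \<alpha> by (auto simp: p_def)
  define D where "D = real d * (m - 1) + \<alpha>"
  have D: "0 < D" using \<alpha> m by (auto simp: D_def intro: add_nonneg_pos)
  have lam': "lam = 1 / D" by (simp add: lam D_def)
  have e1: "real d / (real d * (m - 1) + \<alpha>) = real DIM('a) * lam" "2 / (real d * (m - 1) + \<alpha>) = 2 * lam"
      "1 / (real d * (m - 1) + \<alpha>) = lam"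
    by (simp_all add: lam d)
  \<comment> \<open>\<open>k\<close> was built as \<open>lam\<close> divided by the rate: all Gamma
    values, the dimension and the power of 2 cancel.\<close>
  have k_rate: "k * profile_rate DIM('a) p = lam"
  proof -
    have g: "(real d + \<alpha>) / 2 = real d / 2 + p" "1 + \<alpha> / 2 = 1 + p" by (simp_all add: p_def add_divide_distrib)
    have pos: "0 < Gamma (real d / 2)" "0 < Gamma (1 + p)" "0 < Gamma (real d / 2 + p)" "0 < real d" "0 < (2::real) powr \<alpha>"
      using p d by (auto intro!: Gamma_real_pos add_pos_pos divide_pos_pos)
    note pos[THEN less_imp_neq, symmetric]
    moreover have "dd / D * (g1 / (w * g2 * g3)) * (w * g2 * g3 / (dd * g1)) = 1 / D"
      if "g1 \<noteq> 0" "g2 \<noteq> 0" "g3 \<noteq> 0" "dd \<noteq> 0" "w \<noteq> 0" for dd g1 g2 g3 w :: real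
      using that by simp
    ultimately show ?thesis unfolding k profile_rate_def lam' g D_def[symmetric] d[symmetric] \<alpha>p[symmetric] by blast
  qed
  have k0: "0 < k"
    using \<alpha> d D unfolding k D_def by (intro mult_pos_pos divide_pos_pos Gamma_real_pos) (auto intro: add_pos_pos)
  have prof: "\<Phi> y = (k * profile p R y) powr (1 / (m - 1))" for y
    by (simp add: \<Phi> profile_def p_def)
  have u': "u t x = t powr (- (real DIM('a) * lam)) * (k * (max (R\<^sup>2 - (norm x)\<^sup>2 * t powr (- (2 * lam))) 0) powr p) powr (1 / (m - 1))"
    if "0 < t" for t x
    using u[OF that, of x] unfolding e1 by (simp add: p_def)
  have sq: "(norm (t powr (- lam) *\<^sub>R x))\<^sup>2 = (norm x)\<^sup>2 * t powr (- (2 * lam))" if "0 < t" for t and x :: 'a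
    by (simp add: power_mult_distrib power2_eq_square[of "t powr (- lam)"] mult.commute flip: powr_add)
  interpret barenblatt p m R lam k \<Phi> u
  proof
    show "lam = 1 / (real DIM('a) * (m - 1) + 2 * p)" by (simp add: lam d p_def)
    show "u t x = t powr (- (real DIM('a) * lam)) * \<Phi> (t powr (- lam) *\<^sub>R x)" if "0 < t" for t x
      by (simp only: u'[OF that] prof profile_def sq[OF that])
  qed (use p m R k_rate prof in auto)
  have part3: "pointwise_solution_at \<alpha> m u t x" if "0 < t" "norm x \<noteq> R * t powr lam" for t x
    using pointwise_solution_u[OF that(1), of x] that(2) unfolding radius_def \<alpha>p by blast
  have part4: "holder_at (min (\<alpha> / (2 * (m - 1))) 1) (\<lambda>(s, y). u s y) (t, x)" if t: "0 < t" for t and x :: 'a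
  proof -
    define q where "q = p / (m - 1)"
    define A where "A = k powr (1 / (m - 1))"
    define c where "c = real DIM('a) * lam"
    let ?v = "\<lambda>(s, y::'a). s powr (- c) * (A * (max (R\<^sup>2 - (norm y)\<^sup>2 * s powr (- (2 * lam))) 0) powr q)"
    have uv: "u s y = ?v (s, y)" if "0 < s" for s y
      using k0 that by (simp add: u' c_def A_def q_def powr_mult powr_powr)
    have "holder_at (min q 1) ?v (t, x)"
      using holder_at_profile[of t R A c "2 * lam" q x] t R m p lam_pos by (simp add: q_def A_def c_def)
    then obtain U where U: "open U" "(t, x) \<in> U" "holder_on (min q 1) U ?v" unfolding holder_at_def by blast
    have "holder_at (min q 1) (\<lambda>(s, y). u s y) (t, x)" unfolding holder_at_def
    \<comment> \<open>The neighbourhood is cut to positive times, where alone the formula for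
      \<open>u\<close> is given.\<close>
    proof (intro exI[of _ "U \<inter> ({0<..} \<times> UNIV)"] conjI)
      show "open (U \<inter> ({0<..} \<times> UNIV))" by (intro open_Int U(1) open_Times) auto
      show "(t, x) \<in> U \<inter> ({0<..} \<times> UNIV)" using U(2) t by simp
      obtain C where C: "\<And>P Q. P \<in> U \<Longrightarrow> Q \<in> U \<Longrightarrow> dist (?v P) (?v Q) \<le> C * dist P Q powr min q 1"
        using U(3) unfolding holder_on_def by blast
      show "holder_on (min q 1) (U \<inter> ({0<..} \<times> UNIV)) (\<lambda>(s, y). u s y)" unfolding holder_on_def
      proof (intro exI[of _ C] ballI)
        fix P Q assume PQ: "P \<in> U \<inter> ({0<..} \<times> UNIV)" "Q \<in> U \<inter> ({0<..} \<times> UNIV)"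
        then have "(case P of (s, y) \<Rightarrow> u s y) = ?v P" "(case Q of (s, y) \<Rightarrow> u s y) = ?v Q"
          using uv by (cases P; cases Q; simp)+
        then show "dist (case P of (s, y) \<Rightarrow> u s y) (case Q of (s, y) \<Rightarrow> u s y) \<le> C * dist P Q powr min q 1"
          using C[of P Q] PQ by (simp only: Int_iff)
      qed
    qed
    moreover have "q = \<alpha> / (2 * (m - 1))" by (simp add: q_def p_def)
    ultimately show ?thesis by simp
  qed
  show ?thesis unfolding e1
    using stationary weak_solution_u part3 part4 unfolding \<alpha>p by blast
qed

end
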